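(* For all non-negative integers $n$ and $g$, there is a bijection $\Phi$ from $\{1,\dots,2^{n+1}\}\times\mathcal{E}_g(n)$ to $\mathcal{T}_g(n)$ such that, for every $(i,M)$, writing $\Phi(i,M)=(T,\sigma)$, there is a correspondence between the vertices of $M$ and the cycles of $\sigma$ under which the underlying graph of $M$ and the underlying graph of $(T,\sigma)$ are the same (isomorphic as vertex-rooted multigraphs). In particular $2^{n+1}|\mathcal{E}_g(n)|=|\mathcal{T}_g(n)|$.
   Context: A map of genus $g$ is a connected graph (loops and multiple edges allowed) embedded in a closed compact oriented surface of genus $g$ such that the complement is a union of topological disks (faces); equivalently, a connected graph with a rotation system (a cyclic ordering of half-edges around each vertex). A corner is the angular sector between two consecutive edges around a vertex; a rooted map has a distinguished corner, whose vertex is the root vertex. A unicellular map is a map with one face. $\mathcal{E}_g(n)$ denotes the set of rooted unicellular maps of genus $g$ with $n$ edges; the underlying graph of such a map is its graph, rooted at the root vertex. A plane tree is a rooted unicellular map of genus $0$; a plane tree with $n$ edges has $n+1$ vertices, canonically numbered $1,\dots,n+1$ following a left-to-right depth-first traversal from the root. A C-permutation on a finite set is a permutation all of whose cycles have odd length, each cycle carrying a sign $+$ or $-$; for a C-permutation on $m$ elements with $\ell$ cycles, its genus is $(m-\ell)/2$. A C-decorated tree with $n$ edges is a pair $(T,\sigma)$ with $T$ a plane tree with $n$ edges and $\sigma$ a C-permutation of $\{1,\dots,n+1\}$, viewed as a permutation of the vertices of $T$; its genus is that of $\sigma$. $\mathcal{T}_g(n)$ denotes the set of C-decorated trees of genus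 $g$ with $n$ edges. The underlying graph of $(T,\sigma)$ is the vertex-rooted multigraph obtained from $T$ by merging into a single vertex the vertices of each cycle of $\sigma$ (rooted at the vertex corresponding to the cycle containing the root vertex of $T$). *)

theory Defs
  imports Main "HOL-Library.FuncSet" "HOL-Combinatorics.Combinatorics"
begin

section \<open>Vertex-rooted multigraphs\<close>

text \<open>Each edge is sent to its set of endpoints: a singleton for a loop, a two-element set
  otherwise. Several edges may have the same endpoints.\<close>

record ('v, 'e) rgraph =
  rg_verts :: "'v set"
  rg_edges :: "'e set"
  rg_ends :: "'e \<Rightarrow> 'v set"
  rg_root :: 'v

definition rgraph_iso :: "('v, 'e) rgraph \<Rightarrow> ('w, 'f) rgraph \<Rightarrow> bool" where
  "rgraph_iso G G' \<longleftrightarrow>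
     (\<exists>f k. bij_betw f (rg_verts G) (rg_verts G') \<and>
            bij_betw k (rg_edges G) (rg_edges G') \<and>
            (\<forall>e \<in> rg_edges G. rg_ends G' (k e) = f ` rg_ends G e) \<and>
            rg_root G' = f (rg_root G))"


section \<open>Rooted maps as rotation systems\<close>

text \<open>\<^term>\<open>Sector h\<close> is the corner delimited by the half-edge preceding \<open>h\<close> in the
  rotation around its vertex and by \<open>h\<close> itself. \<^term>\<open>Around v\<close> is the single corner of a vertex
  without incident half-edges; it occurs only in the map with one vertex and no edge.\<close>

datatype ('v, 'h) corner = Sector 'h | Around 'v

text \<open>\<open>opp\<close> exchanges the two half-edges of each edge, and \<open>rot\<close> sends a half-edge to the next one
  in the cyclic order around its vertex.\<close>

record ('v, 'h) rmap =
  verts :: "'v set"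
  halfedges :: "'h set"
  vert :: "'h \<Rightarrow> 'v"
  opp :: "'h \<Rightarrow> 'h"
  rot :: "'h \<Rightarrow> 'h"
  root :: "('v, 'h) corner"

definition corners :: "('v, 'h) rmap \<Rightarrow> ('v, 'h) corner set" where
  "corners M = Sector ` halfedges M \<union> Around ` (verts M - vert M ` halfedges M)"

primrec corner_vertex :: "('v, 'h) rmap \<Rightarrow> ('v, 'h) corner \<Rightarrow> 'v" where
  "corner_vertex M (Sector h) = vert M h"
| "corner_vertex M (Around v) = v"

definition root_vertex :: "('v, 'h) rmap \<Rightarrow> 'v" where
  "root_vertex M = corner_vertex M (root M)"

definition edges :: "('v, 'h) rmap \<Rightarrow> 'h set set" where
  "edges M = (\<lambda>h. {h, opp M h}) ` halfedges M"

definition rooted_map :: "('v, 'h) rmap \<Rightarrow> bool" where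
  "rooted_map M \<longleftrightarrow>
     finite (verts M) \<and> verts M \<noteq> {} \<and> finite (halfedges M) \<and>
     vert M ` halfedges M \<subseteq> verts M \<and>
     opp M permutes halfedges M \<and>
     (\<forall>h \<in> halfedges M. opp M h \<noteq> h \<and> opp M (opp M h) = h) \<and>
     rot M permutes halfedges M \<and>
     (\<forall>h \<in> halfedges M. orbit (rot M) h = {h' \<in> halfedges M. vert M h' = vert M h}) \<and>
     (\<forall>u \<in> verts M. \<forall>v \<in> verts M. (u, v) \<in> {(vert M h, vert M (opp M h)) |h. h \<in> halfedges M}\<^sup>*) \<and>
     root M \<in> corners M"

text \<open>Walking along the boundary of a face from \<^term>\<open>Sector h\<close>, one follows the edge of \<open>h\<close> to its
  other end and enters the corner between \<open>opp M h\<close> and its successor. Faces are the cycles of this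
  permutation of the corners; in particular the map without edges has one face.\<close>

primrec next_corner :: "('v, 'h) rmap \<Rightarrow> ('v, 'h) corner \<Rightarrow> ('v, 'h) corner" where
  "next_corner M (Sector h) = Sector (rot M (opp M h))"
| "next_corner M (Around v) = Around v"

definition faces :: "('v, 'h) rmap \<Rightarrow> ('v, 'h) corner set set" where
  "faces M = orbit (next_corner M) ` corners M"

definition has_genus :: "('v, 'h) rmap \<Rightarrow> nat \<Rightarrow> bool" where
  "has_genus M g \<longleftrightarrow>
     int (card (verts M)) - int (card (edges M)) + int (card (faces M)) = 2 - 2 * int g"

definition underlying_graph :: "('v, 'h) rmap \<Rightarrow> ('v, 'h set) rgraph" where
  "underlying_graph M =
     \<lparr>rg_verts = verts M, rg_edges = edges M, rg_ends = (\<lambda>e. vert M ` e),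
      rg_root = root_vertex M\<rparr>"

definition rmap_iso :: "('v, 'h) rmap \<Rightarrow> ('w, 'k) rmap \<Rightarrow> bool" where
  "rmap_iso M N \<longleftrightarrow>
     (\<exists>f k. bij_betw f (verts M) (verts N) \<and>
            bij_betw k (halfedges M) (halfedges N) \<and>
            (\<forall>h \<in> halfedges M. vert N (k h) = f (vert M h) \<and>
                                opp N (k h) = k (opp M h) \<and>
                                rot N (k h) = k (rot M h)) \<and>
            root N = map_corner f k (root M))"

text \<open>As usual, maps are considered up to root- and orientation-preserving isomorphism. Every finite
  map is isomorphic to one whose vertices and half-edges are natural numbers, so the sets of maps
  below are sets of isomorphism classes of such labelled representatives.\<close>

type_synonym nmap = "(nat, nat) rmap"

definition labelled_unicellular_maps :: "nat \<Rightarrow> nat \<Rightarrow> nmap set" where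
  "labelled_unicellular_maps g n =
     {M. rooted_map M \<and> card (faces M) = 1 \<and> card (edges M) = n \<and> has_genus M g}"

definition unicellular_maps :: "nat \<Rightarrow> nat \<Rightarrow> nmap set set" where
  "unicellular_maps g n =
     labelled_unicellular_maps g n //
       {(M, N). M \<in> labelled_unicellular_maps g n \<and> N \<in> labelled_unicellular_maps g n \<and>
                rmap_iso M N}"

abbreviation plane_trees :: "nat \<Rightarrow> nmap set set" where
  "plane_trees n \<equiv> unicellular_maps 0 n"

text \<open>In a plane tree, the walk around the unique face from the root corner is the left-to-right
  depth-first traversal. Vertices are numbered from 1 by order of first visit.\<close>

definition first_visit :: "('v, 'h) rmap \<Rightarrow> 'v \<Rightarrow> nat" where
  "first_visit M v = (LEAST i. corner_vertex M ((next_corner M ^^ i) (root M)) = v)"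

definition dfs_number :: "('v, 'h) rmap \<Rightarrow> 'v \<Rightarrow> nat" where
  "dfs_number M v = card {w \<in> verts M. first_visit M w \<le> first_visit M v}"


section \<open>C-permutations and C-decorated trees\<close>

text \<open>Fixed points count as cycles of length 1.\<close>

definition perm_cycles :: "('a \<Rightarrow> 'a) \<Rightarrow> 'a set \<Rightarrow> 'a set set" where
  "perm_cycles p A = orbit p ` A"

datatype sign = Positive | Negative

text \<open>The sign function is extensional, so that it carries no information beyond the signs of the
  cycles.\<close>

type_synonym 'a cperm = "('a \<Rightarrow> 'a) \<times> ('a set \<Rightarrow> sign)"

definition cperms :: "'a set \<Rightarrow> 'a cperm set" where
  "cperms A = {(p, s). p permutes A \<and> (\<forall>c \<in> perm_cycles p A. odd (card c)) \<and>
                       s \<in> perm_cycles p A \<rightarrow>\<^sub>E UNIV}"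

text \<open>The difference below is even, since it is the sum of \<open>card c - 1\<close> over the cycles \<open>c\<close>,
  all of odd length.\<close>

definition cperm_genus :: "'a set \<Rightarrow> 'a cperm \<Rightarrow> nat" where
  "cperm_genus A \<sigma> = (card A - card (perm_cycles (fst \<sigma>) A)) div 2"

definition decorated_trees :: "nat \<Rightarrow> nat \<Rightarrow> (nmap set \<times> nat cperm) set" where
  "decorated_trees g n =
     {(T, \<sigma>). T \<in> plane_trees n \<and> \<sigma> \<in> cperms {1..n + 1} \<and> cperm_genus {1..n + 1} \<sigma> = g}"

text \<open>Here \<open>T\<close> is a labelled representative of a plane tree; the cycle containing a vertex is the
  cycle containing its number.\<close>

definition decorated_graph :: "('v, 'h) rmap \<Rightarrow> nat cperm \<Rightarrow> (nat set, 'h set) rgraph" where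
  "decorated_graph T \<sigma> =
     (let cycle_of_vertex = (\<lambda>v. orbit (fst \<sigma>) (dfs_number T v)) in
      \<lparr>rg_verts = perm_cycles (fst \<sigma>) {1..card (verts T)},
       rg_edges = edges T,
       rg_ends = (\<lambda>e. cycle_of_vertex ` vert T ` e),
       rg_root = cycle_of_vertex (root_vertex T)\<rparr>)"

end

theory Submission
  imports Defs
begin

text \<open>Fix the half-edges, the matching \<open>\<alpha>\<close> that forms the edges, and the root. A unicellular map is then
  a permutation \<open>\<sigma>\<close>, with the vertices as cycles, such that \<open>\<alpha> \<circ> \<sigma>\<close> is one long cycle, and its graph
  depends only on the set partition of the half-edges into cycles of \<open>\<sigma>\<close>. Let \<open>E(\<pi>)\<close> be the number of
  \<open>\<sigma>\<close> with partition \<open>\<pi>\<close>. Order the half-edges along the face. In this order \<open>\<sigma>\<close> has exactly \<open>n + 1\<close> weak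
  descents, and each cycle of \<open>\<sigma>\<close> has a trivial one, into its minimum; the others are Chapuy's
  trisections. Gluing three vertices and, conversely, slicing a vertex at a trisection is a bijection,
  and its iteration gives \<open>(n + 1) E(\<pi>) = \<Sum> E(\<pi>')\<close>, where \<open>\<pi>'\<close> arises from \<open>\<pi>\<close> by splitting one block
  into an odd number of blocks.

  The number of C-decorated trees with partition \<open>\<pi>\<close> satisfies the same recurrence, because there are
  \<open>2 \<cdot> m!\<close> C-permutations of \<open>m \<ge> 1\<close> elements, of which \<open>2 \<cdot> (m - 1)!\<close> have a single cycle
    if \<open>m\<close> is odd.
  Both sides agree up to the factor \<open>2 ^ (n + 1)\<close> when \<open>\<pi>\<close> has \<open>n + 1\<close> blocks, hence
    for every \<open>\<pi>\<close>. Rooted maps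
  have no automorphisms, so the equality passes to isomorphism classes, separately for every underlying
  graph, and the bijection is chosen graph by graph.\<close>


section \<open>Cycles of permutations\<close>

text \<open>Composing \<open>\<sigma>\<close> with a transposition always changes the number of
  faces; a 3-cycle can preserve a single face. This is why three vertices are glued, why the number
  of pieces moves in steps of two, and why only odd numbers of pieces occur. The tree side produces
  the same parity from the odd cycle lengths. If a block holds \<open>m\<close> tree vertices, the
  C-permutations on them with an odd number of cycles number \<open>2 * m!\<close> for odd
  \<open>m\<close> and 0 otherwise, which is \<open>m\<close> times the number of those with one
  cycle. The numbers \<open>m\<close> add up to \<open>n + 1\<close>, the coefficient on the left of
  the recurrence. Splitting a block into one piece changes nothing, so the right-hand side contains
  as many copies of the left-hand count as \<open>\<pi>\<close> has blocks. The recurrence therefore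
  determines the count at \<open>\<pi>\<close> from partitions with more blocks, except when
  \<open>\<pi>\<close> has exactly \<open>n + 1\<close> blocks. That case is the base: only fixed
  points are left on the tree side, and their signs give \<open>2 ^ (n + 1)\<close>. Since the
  bijection has to respect nothing but the graph, equal counts suffice, and no map-by-map
  construction is carried through the iteration.\<close>

definition cycle_list :: "('a \<Rightarrow> 'a) \<Rightarrow> 'a list \<Rightarrow> bool" where
  "cycle_list f xs \<longleftrightarrow> xs \<noteq> [] \<and> distinct xs \<and> map f xs = rotate1 xs"

lemma rotate1_snoc: "rotate1 (xs @ [x]) = tl (xs @ [x]) @ [hd (xs @ [x])]"
  by (cases xs) auto

text \<open>Cycles are listed with the distinguished element last, so the list begins at its image.
  In this form merging cycles is concatenation of lists, and cutting a cycle is cutting its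
  list.\<close>

lemma cycle_list_snoc_iff:
  "cycle_list f (xs @ [x]) \<longleftrightarrow>
     distinct (xs @ [x]) \<and> map f xs = tl (xs @ [x]) \<and> f x = hd (xs @ [x])"
  unfolding cycle_list_def rotate1_snoc map_append by (auto simp del: tl_append hd_append)

lemma cycle_list_nth:
  assumes "cycle_list f xs" "i < length xs"
  shows "f (xs ! i) = xs ! (Suc i mod length xs)"
  using assms nth_rotate1[of i xs] by (metis cycle_list_def nth_map)

lemma cycle_list_funpow:
  assumes "cycle_list f xs" "i < length xs"
  shows "(f ^^ k) (xs ! i) = xs ! ((i + k) mod length xs)"
proof (induction k)
  case (Suc k)
  have "0 < length xs" using assms by auto
  then show ?case
    using Suc cycle_list_nth[OF assms(1), of "(i + k) mod length xs"] by (simp add: mod_Suc_eq)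
qed (use assms in simp)

lemma orbit_cycle_list:
  assumes "cycle_list f xs" "x \<in> set xs"
  shows "orbit f x = set xs"
proof -
  obtain i where i: "i < length xs" "x = xs ! i" using assms(2) by (metis in_set_conv_nth)
  let ?n = "length xs"
  have n: "0 < ?n" using i by auto
  show ?thesis
  proof
    show "orbit f x \<subseteq> set xs"
      unfolding orbit_altdef i using cycle_list_funpow[OF assms(1) i(1)] n by auto
    show "set xs \<subseteq> orbit f x"
    proof
      fix y assume "y \<in> set xs"
      then obtain j where j: "j < ?n" "y = xs ! j" by (metis in_set_conv_nth)
      have "(i + (?n - i + j)) mod ?n = j" using i j by simp
      then have "(f ^^ (?n - i + j)) x = y" using cycle_list_funpow[OF assms(1) i(1)] i j by simp
      moreover have "0 < ?n - i + j" using i by simp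
      ultimately show "y \<in> orbit f x" unfolding orbit_altdef by blast
    qed
  qed
qed

text \<open>The last entry fixes the starting point, and iterating \<open>f\<close> from there fixes
  every other entry.\<close>

lemma cycle_list_unique:
  assumes "cycle_list f (xs @ [x])" "cycle_list f (ys @ [x])"
  shows "xs = ys"
proof -
  have "set (xs @ [x]) = set (ys @ [x])"
    using orbit_cycle_list[OF assms(1), of x] orbit_cycle_list[OF assms(2), of x] by simp
  then have len: "length xs = length ys"
    using assms distinct_card[of "xs @ [x]"] distinct_card[of "ys @ [x]"] by (simp add: cycle_list_def)
  have "(xs @ [x]) ! i = (ys @ [x]) ! i" if "i < Suc (length xs)" for i
  proof -
    \<comment> \<open>Index \<open>i\<close> is \<open>Suc i\<close> steps after the last index,
      modulo the length.\<close>
    have *: "(length xs + Suc i) mod Suc (length xs) = i"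
      using that by (metis add_Suc_right add_Suc_shift mod_add_self1 mod_less)
    show ?thesis
      using cycle_list_funpow[OF assms(1), of "length xs" "Suc i"]
        cycle_list_funpow[OF assms(2), of "length xs" "Suc i"] len *
      by (metis length_append_singleton lessI nth_append_length)
  qed
  then have "xs @ [x] = ys @ [x]" using len by (intro nth_equalityI) auto
  then show ?thesis by simp
qed

lemma cycle_list_exists:
  assumes "x \<in> orbit f x"
  shows "\<exists>xs. cycle_list f (xs @ [x])"
proof -
  define d where "d = funpow_dist f (f x) x"
  let ?g = "\<lambda>i. (f ^^ Suc i) x"
  have dx: "(f ^^ Suc d) x = x" unfolding d_def using funpow_dist1_prop[OF assms] by simp
  have inj: "inj_on (\<lambda>n. (f ^^ n) x) {0..<Suc d}"
    unfolding d_def using inj_on_funpow_dist1[OF assms] by simp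
  have "inj_on ?g {..<Suc d}"
  proof (rule inj_onI)
    fix i j assume ij: "i \<in> {..<Suc d}" "j \<in> {..<Suc d}" and eq: "?g i = ?g j"
    \<comment> \<open>The list uses the exponents from 1 to \<open>Suc d\<close>, whereas
      injectivity is known for those from 0 to \<open>d\<close>; the top exponent is folded back to
      0.\<close>
    define u where "u = (\<lambda>i. if i = d then 0 else Suc i)"
    have *: "?g i = (f ^^ u i) x" for i using dx by (simp add: u_def)
    have "u i \<in> {0..<Suc d}" "u j \<in> {0..<Suc d}" using ij by (auto simp: u_def)
    then have "u i = u j" using eq inj unfolding * by (meson inj_onD)
    then show "i = j" using ij by (auto simp: u_def split: if_splits)
  qed
  then have dist: "distinct (map ?g [0..<Suc d])"
    by (simp only: distinct_map distinct_upt set_upt atLeast0LessThan simp_thms)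
  have "map f (map ?g [0..<Suc d]) = rotate1 (map ?g [0..<Suc d])"
  proof (rule nth_equalityI)
    fix i assume i: "i < length (map f (map ?g [0..<Suc d]))"
    then show "map f (map ?g [0..<Suc d]) ! i = rotate1 (map ?g [0..<Suc d]) ! i"
      using dx by (cases "i = d") (auto simp: nth_rotate1 simp del: upt_Suc)
  qed simp
  then have "cycle_list f (map ?g [0..<Suc d])" using dist by (simp add: cycle_list_def del: upt_Suc)
  moreover have "map ?g [0..<Suc d] = map ?g [0..<d] @ [x]" using dx by simp
  ultimately show ?thesis by metis
qed

section \<open>Merging three cycles by a 3-cycle\<close>

definition glue :: "('a \<Rightarrow> 'a) \<Rightarrow> 'a \<Rightarrow> 'a \<Rightarrow> 'a \<Rightarrow> 'a \<Rightarrow> 'a" where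
  "glue f x y z = f(x := f y, y := f z, z := f x)"

text \<open>\<open>glue f x y z\<close> is \<open>f\<close> after the 3-cycle that sends
  \<open>x\<close> to \<open>y\<close>, \<open>y\<close> to \<open>z\<close> and \<open>z\<close> to
  \<open>x\<close>; exchanging the last two arguments gives the inverse 3-cycle.\<close>

lemma glue_glue: "distinct [x, y, z] \<Longrightarrow> glue (glue f x y z) x z y = f"
  by (auto simp: glue_def fun_eq_iff)

lemma glue_permutes:
  assumes "f permutes H" "x \<in> H" "y \<in> H" "z \<in> H" "distinct [x, y, z]"
  shows "glue f x y z permutes H"
proof -
  have "glue f x y z = f \<circ> (transpose x y \<circ> transpose y z)"
    using assms(5) by (auto simp: glue_def fun_eq_iff transpose_def)
  then show ?thesis using assms permutes_compose permutes_swap_id by metis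
qed

text \<open>The glued permutation jumps from \<open>a1\<close> to the head of the list of
  \<open>a2\<close>, from \<open>a2\<close> to that of \<open>a3\<close> and from \<open>a3\<close>
  to that of \<open>a1\<close>, and agrees with \<open>f\<close> elsewhere. As an equivalence it
  serves both for merging and for cutting.\<close>

lemma cycle_list_glue_iff:
  assumes "distinct (ys @ [a2] @ zs @ [a3] @ ws @ [a1])"
  shows "cycle_list (glue f a1 a2 a3) (ys @ [a2] @ zs @ [a3] @ ws @ [a1]) \<longleftrightarrow>
           cycle_list f (ys @ [a2]) \<and> cycle_list f (zs @ [a3]) \<and> cycle_list f (ws @ [a1])"
proof -
  let ?g = "glue f a1 a2 a3"
  have m: "map ?g ys = map f ys" "map ?g zs = map f zs" "map ?g ws = map f ws"
    using assms by (auto simp: glue_def)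
  have e: "?g a1 = f a2" "?g a2 = f a3" "?g a3 = f a1"
    using assms by (auto simp: glue_def)
  \<comment> \<open>Isolates the heads of the segments: they are the values at \<open>a1\<close>,
    \<open>a2\<close>, \<open>a3\<close>, while all other values are shifts inside one
    segment.\<close>
  have split: "us @ [u] @ vs = hd (us @ [u]) # tl (us @ [u]) @ vs" for us vs and u :: 'a
    by (cases us) auto
  have len: "length (map f us) = length (tl (us @ [u]))" for us and u :: 'a
    by simp
  have "tl (ys @ [a2] @ zs @ [a3] @ ws @ [a1]) =
          tl (ys @ [a2]) @ [hd (zs @ [a3])] @ tl (zs @ [a3]) @ [hd (ws @ [a1])] @ tl (ws @ [a1])"
    using split[of zs a3 "ws @ [a1]"] split[of ws a1 "[]"] by (cases ys) auto
  moreover have "hd (ys @ [a2] @ zs @ [a3] @ ws @ [a1]) = hd (ys @ [a2])"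
    by (cases ys) auto
  ultimately have "cycle_list ?g ((ys @ [a2] @ zs @ [a3] @ ws) @ [a1]) \<longleftrightarrow>
      map f ys @ [f a3] @ map f zs @ [f a1] @ map f ws =
        tl (ys @ [a2]) @ [hd (zs @ [a3])] @ tl (zs @ [a3]) @ [hd (ws @ [a1])] @ tl (ws @ [a1]) \<and>
      f a2 = hd (ys @ [a2])"
    unfolding cycle_list_snoc_iff map_append m list.map e using assms by simp
  also have "\<dots> \<longleftrightarrow> cycle_list f (ys @ [a2]) \<and> cycle_list f (zs @ [a3]) \<and> cycle_list f (ws @ [a1])"
    unfolding cycle_list_snoc_iff using assms by (cases ws) (auto simp: append_eq_append_conv len)
  finally show ?thesis by simp
qed

section \<open>Gluing and slicing in one-face maps\<close>

lemma orbit_permutes_cong: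
  assumes "f permutes H" "finite H" "\<And>y. y \<in> orbit f x \<Longrightarrow> g y = f y"
  shows "orbit g x = orbit f x"
  using assms by (intro orbit_cong permutation_self_in_orbit) (auto simp: permutation_permutes)

locale rooted_matching =
  fixes H :: "'a set" and \<alpha> :: "'a \<Rightarrow> 'a" and r :: 'a
  assumes finite_H: "finite H" and alpha_permutes: "\<alpha> permutes H" and root_in: "r \<in> H"
begin

text \<open>Half-edges are numbered along the face by \<open>\<alpha> \<circ> \<sigma>\<close>, which leaves a half-edge \<open>h\<close> through \<open>\<sigma> h\<close>. It is
  conjugate under \<open>\<alpha>\<close> to the permutation \<open>\<sigma> \<circ> \<alpha>\<close> underlying \<open>next_corner\<close>.\<close>

definition rotations :: "('a \<Rightarrow> 'a) set" where
  "rotations = {\<sigma>. \<sigma> permutes H \<and> cyclic_on (\<alpha> \<circ> \<sigma>) H}"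

definition pos :: "('a \<Rightarrow> 'a) \<Rightarrow> 'a \<Rightarrow> nat" where
  "pos \<sigma> x = funpow_dist (\<alpha> \<circ> \<sigma>) r x"

lemma rotationsD:
  assumes "\<sigma> \<in> rotations"
  shows "\<sigma> permutes H" "cyclic_on (\<alpha> \<circ> \<sigma>) H" "permutation \<sigma>" "x \<in> orbit \<sigma> x"
    "x \<in> H \<Longrightarrow> \<sigma> x \<in> H" "x \<in> H \<Longrightarrow> orbit \<sigma> x \<subseteq> H"
proof -
  show 1: "\<sigma> permutes H" "cyclic_on (\<alpha> \<circ> \<sigma>) H" using assms by (auto simp: rotations_def)
  then show 2: "permutation \<sigma>" using finite_H by (auto simp: permutation_permutes)
  then show "x \<in> orbit \<sigma> x" by (rule permutation_self_in_orbit)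
  show "x \<in> H \<Longrightarrow> \<sigma> x \<in> H" using 1 by (simp add: permutes_in_image)
  show "x \<in> H \<Longrightarrow> orbit \<sigma> x \<subseteq> H" using 1 permutes_orbit_subset by metis
qed

lemma funpow_pos:
  assumes "\<sigma> \<in> rotations" "x \<in> H"
  shows "((\<alpha> \<circ> \<sigma>) ^^ pos \<sigma> x) r = x"
  using rotationsD(2)[OF assms(1)] assms(2) root_in
  unfolding pos_def by (metis cyclic_on_alldef funpow_dist_prop)

lemma pos_root [simp]: "pos \<sigma> r = 0"
  by (simp add: pos_def funpow_dist_0)

lemma pos_inj: "\<sigma> \<in> rotations \<Longrightarrow> inj_on (pos \<sigma>) H"
  by (metis funpow_pos inj_onI)

lemma pos_bij:
  assumes "\<sigma> \<in> rotations"
  shows "bij_betw (pos \<sigma>) H {..<card H}"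
proof -
  let ?f = "\<alpha> \<circ> \<sigma>"
  have orb: "orbit ?f r = H"
    using rotationsD(2)[OF assms] root_in by (metis cyclic_on_alldef)
  then have self: "r \<in> orbit ?f r" using root_in by simp
  have inj: "inj_on (\<lambda>n. (?f ^^ n) r) {0..<funpow_dist1 ?f r r}"
    using inj_on_funpow_dist1[OF self] .
  then have c: "card H = funpow_dist1 ?f r r"
    using orbit_conv_funpow_dist1[OF self] orb by (metis card_image card_atLeastLessThan diff_zero)
  have "pos \<sigma> x < card H" if "x \<in> H" for x
  proof -
    obtain i where i: "i < card H" "(?f ^^ i) r = x"
    proof -
      have "x \<in> (\<lambda>n. (?f ^^ n) r) ` {0..<card H}"
        using orbit_conv_funpow_dist1[OF self] \<open>x \<in> H\<close> unfolding orb c by blast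
      then show thesis using that by auto
    qed
    then have "pos \<sigma> x \<le> i" unfolding pos_def funpow_dist_def by (intro Least_le)
    then show ?thesis using i by simp
  qed
  then have "pos \<sigma> ` H = {..<card H}"
    using pos_inj[OF assms] by (intro card_subset_eq) (auto simp: card_image)
  then show ?thesis using pos_inj[OF assms] by (simp add: bij_betw_def)
qed

lemma pos_lt: "\<sigma> \<in> rotations \<Longrightarrow> x \<in> H \<Longrightarrow> pos \<sigma> x < card H"
  using pos_bij by (auto simp: bij_betw_def)

lemma pos_step:
  assumes "\<sigma> \<in> rotations" "x \<in> H" "Suc (pos \<sigma> x) < card H"
  shows "pos \<sigma> (\<alpha> (\<sigma> x)) = Suc (pos \<sigma> x)"
proof -
  let ?f = "\<alpha> \<circ> \<sigma>"
  obtain y where y: "y \<in> H" "pos \<sigma> y = Suc (pos \<sigma> x)"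
    using pos_bij[OF assms(1)] assms(3) unfolding bij_betw_def by (metis imageE lessThan_iff)
  have "y = ?f x" using funpow_pos[OF assms(1) y(1)] funpow_pos[OF assms(1,2)] y(2) by simp
  then show ?thesis using y by simp
qed

text \<open>If the image had a positive position, it would already be the successor of another
  half-edge, against the injectivity of \<open>\<alpha> \<circ> \<sigma>\<close>.\<close>

lemma pos_wrap:
  assumes "\<sigma> \<in> rotations" "x \<in> H" "Suc (pos \<sigma> x) = card H"
  shows "\<alpha> (\<sigma> x) = r"
proof -
  let ?y = "\<alpha> (\<sigma> x)"
  have y: "?y \<in> H" using rotationsD[OF assms(1)] assms(2) alpha_permutes
    by (simp add: permutes_in_image)
  have inj: "inj (\<alpha> \<circ> \<sigma>)"
    using rotationsD(1)[OF assms(1)] alpha_permutes by (meson permutes_compose permutes_inj)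
  have "pos \<sigma> ?y = 0"
  proof (rule ccontr)
    assume "pos \<sigma> ?y \<noteq> 0"
    then obtain k where k: "pos \<sigma> ?y = Suc k" using not0_implies_Suc by blast
    then have kl: "Suc k < card H" using pos_lt[OF assms(1) y] by simp
    then obtain z where z: "z \<in> H" "pos \<sigma> z = k"
      using pos_bij[OF assms(1)] unfolding bij_betw_def by (metis imageE lessThan_iff Suc_lessD)
    have "pos \<sigma> (\<alpha> (\<sigma> z)) = pos \<sigma> ?y" using pos_step[OF assms(1) z(1)] z k kl by simp
    moreover have "\<alpha> (\<sigma> z) \<in> H"
      using rotationsD[OF assms(1)] z(1) alpha_permutes by (simp add: permutes_in_image)
    ultimately have "\<alpha> (\<sigma> z) = ?y" using pos_inj[OF assms(1)] y by (meson inj_onD)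
    then have "z = x" using inj by (metis comp_apply injD)
    then show False using z kl assms(3) by simp
  qed
  then show ?thesis using pos_inj[OF assms(1)] y root_in pos_root by (metis inj_onD)
qed

text \<open>A candidate numbering does two jobs at once: it certifies that there is a single face
  and it identifies \<open>pos\<close>. The step is demanded only below the last position, where the
  walk wraps around.\<close>

lemma pos_unique:
  assumes "\<sigma> permutes H" "bij_betw q H {..<card H}" "q r = 0"
    and step: "\<And>x. x \<in> H \<Longrightarrow> Suc (q x) < card H \<Longrightarrow> q (\<alpha> (\<sigma> x)) = Suc (q x)"
  shows "\<sigma> \<in> rotations" "x \<in> H \<Longrightarrow> pos \<sigma> x = q x"
proof -
  let ?f = "\<alpha> \<circ> \<sigma>"
  have fp: "?f permutes H" using assms(1) alpha_permutes by (rule permutes_compose)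
  have inH: "(?f ^^ i) r \<in> H" for i
    using permutes_in_image[OF permutes_funpow[OF fp]] root_in by simp
  have it: "i < card H \<Longrightarrow> q ((?f ^^ i) r) = i" for i
  proof (induction i)
    case (Suc i)
    have "(?f ^^ Suc i) r = \<alpha> (\<sigma> ((?f ^^ i) r))" by simp
    then show ?case using Suc step[OF inH[of i]] by (metis Suc_lessD)
  qed (simp add: assms(3))
  have fq: "(?f ^^ q x) r = x" if "x \<in> H" for x
  proof -
    have "q x < card H" using assms(2) that by (auto simp: bij_betw_def)
    then show ?thesis using it[of "q x"] inH[of "q x"] assms(2) that by (metis bij_betw_def inj_onD)
  qed
  have perm: "permutation ?f" using fp finite_H by (auto simp: permutation_permutes)
  have "orbit ?f r = H"
  proof
    show "orbit ?f r \<subseteq> H" using fp root_in by (rule permutes_orbit_subset)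
    show "H \<subseteq> orbit ?f r"
    proof
      fix x assume "x \<in> H"
      then show "x \<in> orbit ?f r"
        using fq[of x] unfolding orbit_altdef_permutation[OF perm]
        by (metis (mono_tags, lifting) mem_Collect_eq)
    qed
  qed
  then show 1: "\<sigma> \<in> rotations" using assms(1) root_in unfolding rotations_def cyclic_on_def by blast
  show "pos \<sigma> x = q x" if "x \<in> H"
  proof -
    have "q x < card H" using assms(2) that by (auto simp: bij_betw_def)
    moreover have "pos \<sigma> x < card H" using pos_lt[OF 1 that] .
    ultimately show ?thesis using it[of "q x"] it[of "pos \<sigma> x"] funpow_pos[OF 1 that] fq[OF that]
      by simp
  qed
qed

definition block_swap :: "nat \<Rightarrow> nat \<Rightarrow> nat \<Rightarrow> nat \<Rightarrow> nat" where
  "block_swap i j k t = (if t \<le> i then t else if t \<le> j then t + (k - j) else if t \<le> k then t - (j - i) else t)"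

lemma block_swap_bij:
  assumes "i < j" "j < k" "k < m"
  shows "bij_betw (block_swap i j k) {..<m} {..<m}"
proof -
  have "inj_on (block_swap i j k) {..<m}"
    using assms by (auto simp: inj_on_def block_swap_def split: if_splits)
  moreover have "block_swap i j k ` {..<m} \<subseteq> {..<m}"
    using assms by (auto simp: block_swap_def)
  ultimately show ?thesis
    by (metis bij_betw_def endo_inj_surj finite_lessThan)
qed

text \<open>Cut the face walk after \<open>x1\<close>, \<open>x2\<close> and \<open>x3\<close> into words \<open>A B C D\<close>. Gluing turns it into \<open>A C B D\<close>, so there is
  still one face.\<close>

lemma glue_rotation:
  assumes \<sigma>: "\<sigma> \<in> rotations" and xH: "x1 \<in> H" "x2 \<in> H" "x3 \<in> H"
    and lt: "pos \<sigma> x1 < pos \<sigma> x2" "pos \<sigma> x2 < pos \<sigma> x3"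
  shows "glue \<sigma> x1 x2 x3 \<in> rotations"
    and "x \<in> H \<Longrightarrow> pos (glue \<sigma> x1 x2 x3) x = block_swap (pos \<sigma> x1) (pos \<sigma> x2) (pos \<sigma> x3) (pos \<sigma> x)"
proof -
  let ?i = "pos \<sigma> x1" and ?j = "pos \<sigma> x2" and ?k = "pos \<sigma> x3"
  let ?s = "glue \<sigma> x1 x2 x3" and ?q = "\<lambda>x. block_swap ?i ?j ?k (pos \<sigma> x)"
  have klt: "?k < card H" using pos_lt[OF \<sigma> xH(3)] .
  have d: "x1 \<noteq> x2" "x1 \<noteq> x3" "x2 \<noteq> x3" using lt by auto
  have perm: "?s permutes H" using rotationsD(1)[OF \<sigma>] xH d by (intro glue_permutes) auto
  have bij: "bij_betw ?q H {..<card H}"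
    using bij_betw_trans[OF pos_bij[OF \<sigma>] block_swap_bij[OF lt klt]] by (simp add: comp_def)
  have root: "?q r = 0" by (simp add: block_swap_def)
  have step: "?q (\<alpha> (?s x)) = Suc (?q x)" if x: "x \<in> H" and q: "Suc (?q x) < card H" for x
  proof -
    have p1: "pos \<sigma> (\<alpha> (\<sigma> x1)) = Suc ?i" "pos \<sigma> (\<alpha> (\<sigma> x2)) = Suc ?j"
      using pos_step[OF \<sigma> xH(1)] pos_step[OF \<sigma> xH(2)] lt klt by auto
    consider "x = x1" | "x = x2" | "x = x3" | "x \<noteq> x1" "x \<noteq> x2" "x \<noteq> x3" by blast
    then show ?thesis
    proof cases
      case 1
      then show ?thesis using p1 d lt by (auto simp: glue_def block_swap_def)
    next
      case 2
      \<comment> \<open>In the new word \<open>x2\<close> takes position \<open>?k\<close>, so its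
        successor is the beginning of the last block, which must be nonempty.\<close>
      then have "Suc ?k < card H" using q lt by (auto simp: block_swap_def)
      then have "pos \<sigma> (\<alpha> (\<sigma> x3)) = Suc ?k" using pos_step[OF \<sigma> xH(3)] by simp
      then show ?thesis using 2 d lt by (auto simp: glue_def block_swap_def)
    next
      case 3
      then show ?thesis using p1 d lt by (auto simp: glue_def block_swap_def)
    next
      case 4
      then have ne: "pos \<sigma> x \<noteq> ?i" "pos \<sigma> x \<noteq> ?j" "pos \<sigma> x \<noteq> ?k"
        using pos_inj[OF \<sigma>] x xH by (meson inj_onD)+
      \<comment> \<open>Either \<open>x\<close> comes before \<open>x3\<close>, or it lies in the
        last block, whose positions do not change.\<close>
      have "Suc (pos \<sigma> x) < card H"
        using q ne lt klt by (auto simp: block_swap_def split: if_splits)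
      then have "pos \<sigma> (\<alpha> (\<sigma> x)) = Suc (pos \<sigma> x)" using pos_step[OF \<sigma> x] by simp
      then show ?thesis using 4 ne lt by (auto simp: glue_def block_swap_def)
    qed
  qed
  show "?s \<in> rotations" using pos_unique(1)[OF perm bij root step] .
  show "x \<in> H \<Longrightarrow> pos ?s x = ?q x" using pos_unique(2)[OF perm bij root step] .
qed

end

section \<open>The effect of gluing on the set of cycles\<close>

lemma orbit_sym_permutes:
  assumes "f permutes H" "finite H" "y \<in> orbit f x"
  shows "orbit f y = orbit f x"
  using assms by (metis cyclic_on_orbit orbit_cyclic_eq3)

lemma orbit_closed: "(\<And>y. y \<in> B \<Longrightarrow> f y \<in> B) \<Longrightarrow> x \<in> B \<Longrightarrow> orbit f x \<subseteq> B"
proof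
  fix y assume "y \<in> orbit f x" "\<And>y. y \<in> B \<Longrightarrow> f y \<in> B" "x \<in> B"
  then show "y \<in> B" by induct auto
qed

text \<open>Three cycles inside \<open>B\<close> become one and all others stay, hence the
  difference of two. Inside and outside of \<open>B\<close> are kept apart because only the block
  \<open>B\<close> is being cut while the other vertices stay as they are.\<close>

lemma glue_orbits:
  assumes perm: "\<sigma> permutes H" "finite H" and B: "B \<subseteq> H" "\<And>x. x \<in> B \<Longrightarrow> \<sigma> x \<in> B"
    and cyc: "cycle_list \<sigma> (ys @ [a2])" "cycle_list \<sigma> (zs @ [a3])" "cycle_list \<sigma> (ws @ [a1])"
    and dist: "distinct (ys @ [a2] @ zs @ [a3] @ ws @ [a1])"
    and L: "set (ys @ [a2] @ zs @ [a3] @ ws @ [a1]) \<subseteq> B"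
  shows "x \<notin> set (ys @ [a2] @ zs @ [a3] @ ws @ [a1]) \<Longrightarrow> orbit (glue \<sigma> a1 a2 a3) x = orbit \<sigma> x"
    and "x \<in> B \<Longrightarrow> glue \<sigma> a1 a2 a3 x \<in> B"
    and "orbit (glue \<sigma> a1 a2 a3) ` (H - B) = orbit \<sigma> ` (H - B)"
    and "card (orbit \<sigma> ` B) = card (orbit (glue \<sigma> a1 a2 a3) ` B) + 2"
proof -
  let ?L = "ys @ [a2] @ zs @ [a3] @ ws @ [a1]" and ?s = "glue \<sigma> a1 a2 a3"
  let ?Y = "set (ys @ [a2])" and ?Z = "set (zs @ [a3])" and ?W = "set (ws @ [a1])"
  have self: "y \<in> orbit \<sigma> y" for y
    using perm permutation_self_in_orbit permutation_permutes by metis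
  have orb: "y \<in> ?Y \<Longrightarrow> orbit \<sigma> y = ?Y" "y \<in> ?Z \<Longrightarrow> orbit \<sigma> y = ?Z" "y \<in> ?W \<Longrightarrow> orbit \<sigma> y = ?W" for y
    using cyc orbit_cycle_list by metis+
  \<comment> \<open>A cycle that meets one of the three lists is that list.\<close>
  have notin: "y \<notin> set ?L" if "y \<in> orbit \<sigma> x" "x \<notin> set ?L" for x y
  proof
    assume "y \<in> set ?L"
    then have "orbit \<sigma> y \<subseteq> set ?L" using orb[of y] by (simp only: set_append Un_iff) blast
    then show False using orbit_sym_permutes[OF perm that(1)] self[of x] that(2) by blast
  qed
  show *: "orbit ?s x = orbit \<sigma> x" if x: "x \<notin> set ?L" for x
  proof (rule orbit_permutes_cong[OF perm])
    fix y assume "y \<in> orbit \<sigma> x"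
    then have "y \<notin> set ?L" using notin x by blast
    then show "?s y = \<sigma> y" by (simp add: glue_def)
  qed
  show "x \<in> B \<Longrightarrow> ?s x \<in> B" for x using B L by (auto simp: glue_def)
  show "orbit ?s ` (H - B) = orbit \<sigma> ` (H - B)"
    using L by (intro image_cong *) auto
  have cL: "cycle_list ?s ?L" using cycle_list_glue_iff[OF dist] cyc by simp
  let ?R = "orbit \<sigma> ` (B - set ?L)"
  have finR: "finite ?R" using B(1) perm(2) by (meson finite_Diff finite_imageI finite_subset)
  have notR: "X \<notin> ?R" if "X \<inter> set ?L \<noteq> {}" for X
    using notin that by blast
  have B_split: "B = ?Y \<union> ?Z \<union> ?W \<union> (B - set ?L)" using L by auto
  have img: "orbit \<sigma> ` S = {X}" if "\<And>y. y \<in> S \<Longrightarrow> orbit \<sigma> y = X" "S \<noteq> {}" for S X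
    using that by auto
  have "orbit \<sigma> ` B = orbit \<sigma> ` ?Y \<union> orbit \<sigma> ` ?Z \<union> orbit \<sigma> ` ?W \<union> ?R"
    by (subst B_split) (simp only: image_Un)
  also have "orbit \<sigma> ` ?Y = {?Y}" by (rule img[OF orb(1)]) auto
  also have "orbit \<sigma> ` ?Z = {?Z}" by (rule img[OF orb(2)]) auto
  also have "orbit \<sigma> ` ?W = {?W}" by (rule img[OF orb(3)]) auto
  finally have 1: "orbit \<sigma> ` B = insert ?Y (insert ?Z (insert ?W ?R))"
    by (simp only: insert_is_Un[symmetric] Un_insert_left Un_empty_left)
  have "?Y \<noteq> ?Z" "?Y \<noteq> ?W" "?Z \<noteq> ?W" using dist by auto
  moreover have "?Y \<notin> ?R" "?Z \<notin> ?R" "?W \<notin> ?R" by (rule notR; auto)+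
  ultimately have c1: "card (orbit \<sigma> ` B) = card ?R + 3" using finR unfolding 1 by simp
  have "orbit ?s ` B = orbit ?s ` set ?L \<union> orbit ?s ` (B - set ?L)"
    using L by auto
  also have "orbit ?s ` set ?L = {set ?L}"
    using orbit_cycle_list[OF cL] by auto
  also have "orbit ?s ` (B - set ?L) = ?R" using * by (intro image_cong) auto
  finally have "orbit ?s ` B = insert (set ?L) ?R" by simp
  moreover have "set ?L \<notin> ?R" by (rule notR) auto
  ultimately show "card (orbit \<sigma> ` B) = card (orbit ?s ` B) + 2" using finR c1 by simp
qed

section \<open>Marked weak descents, gluing data and slicing data\<close>

context rooted_matching
begin

text \<open>The set \<open>B\<close> is the vertex to be sliced and \<open>Q\<close> consists of all other vertices. A permutation in
  \<open>family B Q j\<close> cuts \<open>B\<close> into \<open>j\<close> cycles. Marks are weak descents \<open>h \<mapsto> \<sigma> h\<close> in the cycle of \<open>B\<close> whose first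
  half-edge comes last, recorded by their target \<open>\<sigma> h\<close>.\<close>

definition family :: "'a set \<Rightarrow> 'a set set \<Rightarrow> nat \<Rightarrow> ('a \<Rightarrow> 'a) set" where
  "family B Q j = {\<sigma> \<in> rotations. (\<forall>x\<in>B. \<sigma> x \<in> B) \<and> orbit \<sigma> ` (H - B) = Q \<and> card (orbit \<sigma> ` B) = j}"

definition first_pos :: "('a \<Rightarrow> 'a) \<Rightarrow> 'a \<Rightarrow> nat" where
  "first_pos \<sigma> x = Min (pos \<sigma> ` orbit \<sigma> x)"

definition descent_targets :: "('a \<Rightarrow> 'a) \<Rightarrow> 'a set" where
  "descent_targets \<sigma> = {\<sigma> h |h. h \<in> H \<and> pos \<sigma> (\<sigma> h) \<le> pos \<sigma> h}"

definition marked :: "'a set \<Rightarrow> 'a set set \<Rightarrow> nat \<Rightarrow> (('a \<Rightarrow> 'a) \<times> 'a) set" where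
  "marked B Q j = {(\<sigma>, b). \<sigma> \<in> family B Q j \<and> b \<in> B \<inter> descent_targets \<sigma> \<and>
                     (\<forall>x\<in>B. first_pos \<sigma> x \<le> first_pos \<sigma> b)}"

definition trisected :: "'a set \<Rightarrow> 'a set set \<Rightarrow> nat \<Rightarrow> (('a \<Rightarrow> 'a) \<times> 'a) set" where
  "trisected B Q j = {(\<sigma>, b) \<in> marked B Q j. first_pos \<sigma> b < pos \<sigma> b}"

text \<open>Among the cycles of \<open>B\<close>, those of \<open>a1\<close>, \<open>a2\<close>,
  \<open>a3\<close> are the three whose first half-edges come last, in this order. Here
  \<open>a1\<close> and \<open>a2\<close> are these first half-edges, while \<open>a3\<close> is any
  weak descent target in the last cycle: \<open>last zs\<close> is its preimage, and for empty
  \<open>zs\<close> it is a fixed point. Positions are compared entry by entry, so that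
  \<open>block_swap\<close> can be applied to every condition.\<close>

definition glue_data :: "'a set \<Rightarrow> 'a set set \<Rightarrow> nat \<Rightarrow> (('a \<Rightarrow> 'a) \<times> 'a \<times> 'a \<times> 'a) set" where
  "glue_data B Q j = {(\<sigma>, a1, a2, a3). \<sigma> \<in> family B Q (j + 2) \<and> pos \<sigma> a1 < pos \<sigma> a2 \<and>
     (\<exists>ys zs ws. cycle_list \<sigma> (ys @ [a2]) \<and> cycle_list \<sigma> (zs @ [a3]) \<and> cycle_list \<sigma> (ws @ [a1]) \<and>
        distinct (ys @ [a2] @ zs @ [a3] @ ws @ [a1]) \<and> set (ys @ [a2] @ zs @ [a3] @ ws @ [a1]) \<subseteq> B \<and>
        (\<forall>x \<in> set ws. pos \<sigma> a1 < pos \<sigma> x) \<and>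
        (\<forall>x \<in> set ys \<union> set zs \<union> {a3}. pos \<sigma> a2 < pos \<sigma> x) \<and>
        (zs \<noteq> [] \<longrightarrow> pos \<sigma> a3 < pos \<sigma> (last zs)) \<and>
        (\<forall>x \<in> B - set (ys @ [a2] @ zs @ [a3] @ ws @ [a1]). \<exists>y \<in> orbit \<sigma> x. pos \<sigma> y < pos \<sigma> a1))}"

text \<open>Gluing at \<open>a1\<close>, \<open>a2\<close>, \<open>a3\<close> makes \<open>a3\<close> the target of a trisection. To undo it one has to recover
  \<open>a1\<close> and \<open>a2\<close>: \<open>a1\<close> is the first half-edge of the merged cycle,
    and \<open>a2\<close> is the first half-edge after \<open>a3\<close> on
  the face among those met between \<open>a1\<close> and \<open>a3\<close> around the vertex.\<close>

definition slice_data :: "'a set \<Rightarrow> 'a set set \<Rightarrow> nat \<Rightarrow> (('a \<Rightarrow> 'a) \<times> 'a \<times> 'a \<times> 'a) set" where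
  "slice_data B Q j = {(\<sigma>, a1, a3, a2). \<sigma> \<in> family B Q j \<and> pos \<sigma> a1 < pos \<sigma> a3 \<and> pos \<sigma> a3 < pos \<sigma> a2 \<and>
     (\<exists>ys zs ws. cycle_list \<sigma> (ys @ [a2] @ zs @ [a3] @ ws @ [a1]) \<and>
        set (ys @ [a2] @ zs @ [a3] @ ws @ [a1]) \<subseteq> B \<and>
        (\<forall>x \<in> set ys \<union> set zs \<union> set ws. pos \<sigma> a1 < pos \<sigma> x) \<and>
        (\<forall>x \<in> set ys \<union> set zs. pos \<sigma> x < pos \<sigma> a3 \<or> pos \<sigma> a2 < pos \<sigma> x) \<and>
        (zs \<noteq> [] \<longrightarrow> pos \<sigma> a3 < pos \<sigma> (last zs)) \<and>
        (\<forall>x \<in> B - set (ys @ [a2] @ zs @ [a3] @ ws @ [a1]). \<exists>y \<in> orbit \<sigma> x. pos \<sigma> y < pos \<sigma> a1))}"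

text \<open>Gluing exchanges the second and third of the four words into which the face is cut. The
  half-edges of \<open>ys\<close> and \<open>zs\<close> lie in the third and fourth word. Afterwards
  \<open>a3\<close> ends the third word and \<open>a2\<close> ends the second one, which now follows
  it, so they come before \<open>a3\<close> or after \<open>a2\<close>.\<close>

lemma glue_data_slice_data:
  assumes "B \<subseteq> H" "(\<sigma>, a1, a2, a3) \<in> glue_data B Q j"
  shows "(glue \<sigma> a1 a2 a3, a1, a3, a2) \<in> slice_data B Q j"
proof -
  let ?s = "glue \<sigma> a1 a2 a3"
  obtain ys zs ws where fam: "\<sigma> \<in> family B Q (j + 2)" and lt1: "pos \<sigma> a1 < pos \<sigma> a2"
    and cyc: "cycle_list \<sigma> (ys @ [a2])" "cycle_list \<sigma> (zs @ [a3])" "cycle_list \<sigma> (ws @ [a1])"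
    and dist: "distinct (ys @ [a2] @ zs @ [a3] @ ws @ [a1])"
    and L: "set (ys @ [a2] @ zs @ [a3] @ ws @ [a1]) \<subseteq> B"
    and c1: "\<forall>x \<in> set ws. pos \<sigma> a1 < pos \<sigma> x"
    and c2: "\<forall>x \<in> set ys \<union> set zs \<union> {a3}. pos \<sigma> a2 < pos \<sigma> x"
    and c3: "zs \<noteq> [] \<longrightarrow> pos \<sigma> a3 < pos \<sigma> (last zs)"
    and c4: "\<forall>x \<in> B - set (ys @ [a2] @ zs @ [a3] @ ws @ [a1]). \<exists>y \<in> orbit \<sigma> x. pos \<sigma> y < pos \<sigma> a1"
    using assms(2) unfolding glue_data_def mem_Collect_eq prod.case by (elim conjE exE) (rule that)
  have rot: "\<sigma> \<in> rotations" and inv: "\<And>x. x \<in> B \<Longrightarrow> \<sigma> x \<in> B"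
    and out: "orbit \<sigma> ` (H - B) = Q" and num: "card (orbit \<sigma> ` B) = j + 2"
    using fam by (auto simp: family_def)
  note go = glue_orbits[OF rotationsD(1)[OF rot] finite_H assms(1) inv cyc dist L]
  have aH: "a1 \<in> H" "a2 \<in> H" "a3 \<in> H" using L assms(1) by auto
  have lt2: "pos \<sigma> a2 < pos \<sigma> a3" using c2 by simp
  note gr = glue_rotation[OF rot aH lt1 lt2]
  let ?b = "block_swap (pos \<sigma> a1) (pos \<sigma> a2) (pos \<sigma> a3)"
  have LH: "x \<in> H" if "x \<in> set ys \<union> set zs \<union> set ws" for x using that L assms(1) by auto
  have pos_ne: "pos \<sigma> x \<noteq> pos \<sigma> a3" if "x \<in> set ys \<union> set zs" for x
  proof -
    have "x \<noteq> a3" using dist that by auto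
    then show ?thesis using pos_inj[OF rot] aH LH[of x] that by (metis UnCI inj_onD)
  qed
  have fam': "?s \<in> family B Q j"
    using go(2-4) gr(1) out num by (auto simp: family_def)
  have "cycle_list ?s (ys @ [a2] @ zs @ [a3] @ ws @ [a1])"
    using cycle_list_glue_iff[OF dist] cyc by simp
  moreover have "pos ?s a1 < pos ?s a3" "pos ?s a3 < pos ?s a2"
    using lt1 lt2 by (auto simp: gr(2) aH block_swap_def)
  moreover have "\<forall>x \<in> set ys \<union> set zs \<union> set ws. pos ?s a1 < pos ?s x"
  proof
    fix x assume x: "x \<in> set ys \<union> set zs \<union> set ws"
    then have "pos \<sigma> a1 < pos \<sigma> x" using c1 c2 lt1 by (metis UnE UnI1 UnI2 less_trans)
    then show "pos ?s a1 < pos ?s x" using lt1 lt2 by (auto simp: gr(2) aH LH[OF x] block_swap_def)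
  qed
  moreover have "\<forall>x \<in> set ys \<union> set zs. pos ?s x < pos ?s a3 \<or> pos ?s a2 < pos ?s x"
  proof
    fix x assume x: "x \<in> set ys \<union> set zs"
    then have "pos \<sigma> a2 < pos \<sigma> x" "x \<in> H" using c2 LH by auto
    then show "pos ?s x < pos ?s a3 \<or> pos ?s a2 < pos ?s x"
      using pos_ne[OF x] lt1 lt2 by (auto simp: gr(2) aH block_swap_def)
  qed
  moreover have "zs \<noteq> [] \<longrightarrow> pos ?s a3 < pos ?s (last zs)"
  proof
    assume zs: "zs \<noteq> []"
    then show "pos ?s a3 < pos ?s (last zs)"
      using c3 lt1 lt2 LH[of "last zs"] by (auto simp: gr(2) aH block_swap_def)
  qed
  moreover have "\<forall>x \<in> B - set (ys @ [a2] @ zs @ [a3] @ ws @ [a1]). \<exists>y \<in> orbit ?s x. pos ?s y < pos ?s a1"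
  proof
    fix x assume x: "x \<in> B - set (ys @ [a2] @ zs @ [a3] @ ws @ [a1])"
    then obtain y where y: "y \<in> orbit \<sigma> x" "pos \<sigma> y < pos \<sigma> a1" using c4 by blast
    then have "y \<in> H" using rotationsD(6)[OF rot] x assms(1) by blast
    then have "pos ?s y < pos ?s a1" using y lt1 lt2 by (auto simp: gr(2) aH block_swap_def)
    then show "\<exists>y \<in> orbit ?s x. pos ?s y < pos ?s a1" using go(1)[of x] x y(1) by (metis Diff_iff)
  qed
  ultimately show ?thesis
    unfolding slice_data_def mem_Collect_eq prod.case
    using fam' L by (intro conjI exI[of _ ys] exI[of _ zs] exI[of _ ws])
qed

text \<open>The same exchange of words, now cut after \<open>a1\<close>, \<open>a3\<close>,
  \<open>a2\<close> in the order of the face: the stretch from \<open>a3\<close> to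
  \<open>a2\<close>, free of \<open>ys\<close> and \<open>zs\<close>, moves back to the front, so
  that \<open>a2\<close> precedes all of \<open>ys\<close>, \<open>zs\<close> and
  \<open>a3\<close>.\<close>

lemma slice_data_glue_data:
  assumes "B \<subseteq> H" "(\<sigma>, a1, a3, a2) \<in> slice_data B Q j"
  shows "(glue \<sigma> a1 a3 a2, a1, a2, a3) \<in> glue_data B Q j"
proof -
  let ?s = "glue \<sigma> a1 a3 a2"
  obtain ys zs ws where fam: "\<sigma> \<in> family B Q j" and lt1: "pos \<sigma> a1 < pos \<sigma> a3"
    and lt2: "pos \<sigma> a3 < pos \<sigma> a2"
    and cL: "cycle_list \<sigma> (ys @ [a2] @ zs @ [a3] @ ws @ [a1])"
    and L: "set (ys @ [a2] @ zs @ [a3] @ ws @ [a1]) \<subseteq> B"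
    and c1: "\<forall>x \<in> set ys \<union> set zs \<union> set ws. pos \<sigma> a1 < pos \<sigma> x"
    and c2: "\<forall>x \<in> set ys \<union> set zs. pos \<sigma> x < pos \<sigma> a3 \<or> pos \<sigma> a2 < pos \<sigma> x"
    and c3: "zs \<noteq> [] \<longrightarrow> pos \<sigma> a3 < pos \<sigma> (last zs)"
    and c4: "\<forall>x \<in> B - set (ys @ [a2] @ zs @ [a3] @ ws @ [a1]). \<exists>y \<in> orbit \<sigma> x. pos \<sigma> y < pos \<sigma> a1"
    using assms(2) unfolding slice_data_def mem_Collect_eq prod.case by (elim conjE exE) (rule that)
  have rot: "\<sigma> \<in> rotations" and inv: "\<And>x. x \<in> B \<Longrightarrow> \<sigma> x \<in> B"
    and out: "orbit \<sigma> ` (H - B) = Q" and num: "card (orbit \<sigma> ` B) = j"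
    using fam by (auto simp: family_def)
  have aH: "a1 \<in> H" "a3 \<in> H" "a2 \<in> H" using L assms(1) by auto
  have dist: "distinct (ys @ [a2] @ zs @ [a3] @ ws @ [a1])" using cL by (simp add: cycle_list_def)
  \<comment> \<open>Presents \<open>\<sigma>\<close> as a glued permutation, so that the lemmas on
    gluing can be read backwards.\<close>
  have unglued: "glue ?s a1 a2 a3 = \<sigma>" by (rule glue_glue) (use dist in auto)
  note gr = glue_rotation[OF rot aH lt1 lt2]
  have cyc: "cycle_list ?s (ys @ [a2])" "cycle_list ?s (zs @ [a3])" "cycle_list ?s (ws @ [a1])"
    using cycle_list_glue_iff[OF dist, of ?s] cL by (auto simp: unglued)
  have inv1: "?s x \<in> B" if "x \<in> B" for x using that inv L by (auto simp: glue_def)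
  note go = glue_orbits[OF rotationsD(1)[OF gr(1)] finite_H assms(1) inv1 cyc dist L, unfolded unglued]
  have LH: "x \<in> H" if "x \<in> set ys \<union> set zs \<union> set ws" for x using that L assms(1) by auto
  have fam': "?s \<in> family B Q (j + 2)"
    using go(3-4) inv1 gr(1) out num by (auto simp: family_def)
  have "pos ?s a1 < pos ?s a2"
    using lt1 lt2 by (auto simp: gr(2) aH block_swap_def)
  moreover have "\<forall>x \<in> set ws. pos ?s a1 < pos ?s x"
  proof
    fix x assume x: "x \<in> set ws"
    then have "pos \<sigma> a1 < pos \<sigma> x" "x \<in> H" using c1 LH by auto
    then show "pos ?s a1 < pos ?s x" using lt1 lt2 by (auto simp: gr(2) aH block_swap_def)
  qed
  moreover have "\<forall>x \<in> set ys \<union> set zs \<union> {a3}. pos ?s a2 < pos ?s x"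
  proof
    fix x assume x: "x \<in> set ys \<union> set zs \<union> {a3}"
    then have "pos \<sigma> a1 < pos \<sigma> x" "x \<in> H" "x = a3 \<or> pos \<sigma> x < pos \<sigma> a3 \<or> pos \<sigma> a2 < pos \<sigma> x"
      using c1 c2 LH lt1 aH by auto
    then show "pos ?s a2 < pos ?s x" using lt1 lt2 by (auto simp: gr(2) aH block_swap_def)
  qed
  moreover have "zs \<noteq> [] \<longrightarrow> pos ?s a3 < pos ?s (last zs)"
  proof
    assume zs: "zs \<noteq> []"
    then have "pos \<sigma> (last zs) < pos \<sigma> a3 \<or> pos \<sigma> a2 < pos \<sigma> (last zs)" "last zs \<in> H"
      using c2 LH by auto
    then show "pos ?s a3 < pos ?s (last zs)"
      using zs c3 lt1 lt2 by (auto simp: gr(2) aH block_swap_def)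
  qed
  moreover have "\<forall>x \<in> B - set (ys @ [a2] @ zs @ [a3] @ ws @ [a1]). \<exists>y \<in> orbit ?s x. pos ?s y < pos ?s a1"
  proof
    fix x assume x: "x \<in> B - set (ys @ [a2] @ zs @ [a3] @ ws @ [a1])"
    then obtain y where y: "y \<in> orbit \<sigma> x" "pos \<sigma> y < pos \<sigma> a1" using c4 by blast
    then have "y \<in> H" using rotationsD(6)[OF rot] x assms(1) by blast
    then have "pos ?s y < pos ?s a1" using y lt1 lt2 by (auto simp: gr(2) aH block_swap_def)
    then show "\<exists>y \<in> orbit ?s x. pos ?s y < pos ?s a1" using go(1)[of x] x y(1) by (metis Diff_iff)
  qed
  ultimately show ?thesis
    unfolding glue_data_def mem_Collect_eq prod.case
    using fam' L cyc dist by (intro conjI exI[of _ ys] exI[of _ zs] exI[of _ ws])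
qed

lemma glue_data_bij:
  assumes "B \<subseteq> H"
  shows "bij_betw (\<lambda>(\<sigma>, a1, a2, a3). (glue \<sigma> a1 a2 a3, a1, a3, a2)) (glue_data B Q j) (slice_data B Q j)"
proof (rule bij_betw_byWitness[where f' = "\<lambda>(\<sigma>, a1, a3, a2). (glue \<sigma> a1 a3 a2, a1, a2, a3)"])
  show "\<forall>x\<in>glue_data B Q j. (\<lambda>(\<sigma>, a1, a3, a2). (glue \<sigma> a1 a3 a2, a1, a2, a3))
          ((\<lambda>(\<sigma>, a1, a2, a3). (glue \<sigma> a1 a2 a3, a1, a3, a2)) x) = x"
    by (auto simp: glue_data_def intro!: glue_glue)
  show "\<forall>x\<in>slice_data B Q j. (\<lambda>(\<sigma>, a1, a2, a3). (glue \<sigma> a1 a2 a3, a1, a3, a2))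
          ((\<lambda>(\<sigma>, a1, a3, a2). (glue \<sigma> a1 a3 a2, a1, a2, a3)) x) = x"
    by (auto simp: slice_data_def intro!: glue_glue)
qed (use glue_data_slice_data[OF assms] slice_data_glue_data[OF assms] in auto)

end

lemma cycle_list_last:
  assumes "cycle_list f (us @ [u, x])"
  shows "f u = x"
proof -
  have "map f (us @ [u]) = tl (us @ [u, x])"
    using assms cycle_list_snoc_iff[of f "us @ [u]" x] by simp
  then have "last (map f (us @ [u])) = last (tl (us @ [u, x]))" by simp
  then show ?thesis by (cases us) auto
qed

context rooted_matching
begin

lemma finite_rotations: "finite rotations"
  by (rule finite_subset[OF _ finite_permutations[OF finite_H]]) (auto simp: rotations_def)

lemma finite_family: "finite (family B Q j)"
  using finite_rotations by (auto simp: family_def)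

lemma familyD:
  assumes "B \<subseteq> H" "\<sigma> \<in> family B Q j"
  shows "\<sigma> \<in> rotations" "\<And>x. x \<in> B \<Longrightarrow> \<sigma> x \<in> B" "orbit \<sigma> ` (H - B) = Q" "card (orbit \<sigma> ` B) = j"
    "\<And>x. x \<in> B \<Longrightarrow> orbit \<sigma> x \<subseteq> B"
proof -
  show inv: "\<And>x. x \<in> B \<Longrightarrow> \<sigma> x \<in> B" using assms by (simp add: family_def)
  show "\<And>x. x \<in> B \<Longrightarrow> orbit \<sigma> x \<subseteq> B" by (rule orbit_closed[OF inv])
qed (use assms in \<open>simp_all add: family_def\<close>)

context
  fixes \<sigma> assumes \<sigma>: "\<sigma> \<in> rotations"
begin

lemma finite_orbit_rotation: "finite (orbit \<sigma> x)"
  using rotationsD(4)[OF \<sigma>] by (rule finite_orbit)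

lemma orbit_eq: "y \<in> orbit \<sigma> x \<Longrightarrow> orbit \<sigma> y = orbit \<sigma> x"
  by (rule orbit_sym_permutes[OF rotationsD(1)[OF \<sigma>] finite_H])

lemma first_pos_le: "y \<in> orbit \<sigma> x \<Longrightarrow> first_pos \<sigma> x \<le> pos \<sigma> y"
  unfolding first_pos_def using finite_orbit_rotation by (intro Min_le) auto

lemma first_pos_attained: "\<exists>y \<in> orbit \<sigma> x. first_pos \<sigma> x = pos \<sigma> y"
proof -
  have "first_pos \<sigma> x \<in> pos \<sigma> ` orbit \<sigma> x"
    unfolding first_pos_def using finite_orbit_rotation orbit_nonempty[of \<sigma> x] by (intro Min_in) auto
  then show ?thesis by auto
qed

lemma first_pos_lt_iff: "first_pos \<sigma> x < k \<longleftrightarrow> (\<exists>y \<in> orbit \<sigma> x. pos \<sigma> y < k)"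
  using first_pos_le first_pos_attained by (metis le_less_trans)

lemma first_pos_orbit: "y \<in> orbit \<sigma> x \<Longrightarrow> first_pos \<sigma> y = first_pos \<sigma> x"
  by (simp add: first_pos_def orbit_eq)

text \<open>As \<open>pos\<close> is injective, first positions serve as names of the cycles and
  order the cycles of a block linearly.\<close>

lemma first_pos_eq_iff:
  assumes "x \<in> H" "y \<in> H"
  shows "first_pos \<sigma> x = first_pos \<sigma> y \<longleftrightarrow> orbit \<sigma> x = orbit \<sigma> y"
proof
  assume eq: "first_pos \<sigma> x = first_pos \<sigma> y"
  obtain u v where u: "u \<in> orbit \<sigma> x" "first_pos \<sigma> x = pos \<sigma> u"
    and v: "v \<in> orbit \<sigma> y" "first_pos \<sigma> y = pos \<sigma> v" using first_pos_attained by metis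
  have "u \<in> H" "v \<in> H" using u v rotationsD(6)[OF \<sigma>] assms by auto
  then have "u = v" using eq u v pos_inj[OF \<sigma>] by (metis inj_onD)
  then show "orbit \<sigma> x = orbit \<sigma> y" using orbit_eq u v by metis
qed (simp add: first_pos_def)

lemma first_pos_eqI:
  assumes "\<And>y. y \<in> orbit \<sigma> x \<Longrightarrow> pos \<sigma> x \<le> pos \<sigma> y"
  shows "first_pos \<sigma> x = pos \<sigma> x"
  using assms first_pos_le[OF rotationsD(4)[OF \<sigma>]] first_pos_attained by (metis le_antisym)

lemma obtain_first:
  obtains y where "y \<in> orbit \<sigma> x" "first_pos \<sigma> y = pos \<sigma> y" "first_pos \<sigma> x = pos \<sigma> y"
  using first_pos_attained first_pos_orbit by metis

lemma card_first_pos: "B \<subseteq> H \<Longrightarrow> card (first_pos \<sigma> ` B) = card (orbit \<sigma> ` B)"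
proof -
  assume B: "B \<subseteq> H"
  have "first_pos \<sigma> ` B = (\<lambda>X. Min (pos \<sigma> ` X)) ` (orbit \<sigma> ` B)"
    by (auto simp: first_pos_def)
  moreover have "inj_on (\<lambda>X. Min (pos \<sigma> ` X)) (orbit \<sigma> ` B)"
  proof (rule inj_onI)
    fix X Y assume "X \<in> orbit \<sigma> ` B" "Y \<in> orbit \<sigma> ` B" and eq: "Min (pos \<sigma> ` X) = Min (pos \<sigma> ` Y)"
    then obtain x y where "x \<in> B" "y \<in> B" "X = orbit \<sigma> x" "Y = orbit \<sigma> y" by auto
    then show "X = Y" using eq B first_pos_eq_iff[of x y] by (auto simp: first_pos_def)
  qed
  ultimately show ?thesis by (simp add: card_image)
qed

end

text \<open>The three largest elements \<open>pos \<sigma> a1 < pos \<sigma> a2 < first_pos \<sigma> a3\<close> of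
  \<open>first_pos \<sigma> ` B\<close> determine \<open>a1\<close> and \<open>a2\<close>.\<close>

lemma glue_data_iff:
  assumes "B \<subseteq> H"
  shows "(\<sigma>, a1, a2, a3) \<in> glue_data B Q j \<longleftrightarrow>
    (\<sigma>, a3) \<in> marked B Q (j + 2) \<and> a1 \<in> B \<and> a2 \<in> B \<and>
    first_pos \<sigma> a1 = pos \<sigma> a1 \<and> first_pos \<sigma> a2 = pos \<sigma> a2 \<and>
    pos \<sigma> a1 < pos \<sigma> a2 \<and> pos \<sigma> a2 < first_pos \<sigma> a3 \<and>
    (\<forall>x \<in> B. first_pos \<sigma> x < pos \<sigma> a1 \<or> first_pos \<sigma> x \<in> {pos \<sigma> a1, pos \<sigma> a2, first_pos \<sigma> a3})"
    (is "?L \<longleftrightarrow> ?R")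
proof
  assume ?L
  then obtain ys zs ws where fam: "\<sigma> \<in> family B Q (j + 2)" and lt1: "pos \<sigma> a1 < pos \<sigma> a2"
    and cyc: "cycle_list \<sigma> (ys @ [a2])" "cycle_list \<sigma> (zs @ [a3])" "cycle_list \<sigma> (ws @ [a1])"
    and L: "set (ys @ [a2] @ zs @ [a3] @ ws @ [a1]) \<subseteq> B"
    and c1: "\<forall>x \<in> set ws. pos \<sigma> a1 < pos \<sigma> x"
    and c2: "\<forall>x \<in> set ys \<union> set zs \<union> {a3}. pos \<sigma> a2 < pos \<sigma> x"
    and c3: "zs \<noteq> [] \<longrightarrow> pos \<sigma> a3 < pos \<sigma> (last zs)"
    and c4: "\<forall>x \<in> B - set (ys @ [a2] @ zs @ [a3] @ ws @ [a1]). \<exists>y \<in> orbit \<sigma> x. pos \<sigma> y < pos \<sigma> a1"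
    unfolding glue_data_def mem_Collect_eq prod.case by (elim conjE exE) (rule that)
  have \<sigma>: "\<sigma> \<in> rotations" using fam by (simp add: family_def)
  have orb: "orbit \<sigma> a2 = set (ys @ [a2])" "orbit \<sigma> a3 = set (zs @ [a3])" "orbit \<sigma> a1 = set (ws @ [a1])"
    using cyc orbit_cycle_list by (metis in_set_conv_decomp)+
  have f1: "first_pos \<sigma> a1 = pos \<sigma> a1" using c1
    by (intro first_pos_eqI[OF \<sigma>]) (auto simp: orb less_imp_le)
  have f2: "first_pos \<sigma> a2 = pos \<sigma> a2" using c2[unfolded ball_Un]
    by (intro first_pos_eqI[OF \<sigma>]) (auto simp: orb less_imp_le)
  obtain y where "y \<in> orbit \<sigma> a3" "first_pos \<sigma> a3 = pos \<sigma> y" using first_pos_attained[OF \<sigma>] by metis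
  then have f3: "pos \<sigma> a2 < first_pos \<sigma> a3" using c2[unfolded ball_Un] by (auto simp: orb)
  have f4: "first_pos \<sigma> x < pos \<sigma> a1 \<or> first_pos \<sigma> x \<in> {pos \<sigma> a1, pos \<sigma> a2, first_pos \<sigma> a3}"
    if "x \<in> B" for x
  proof -
    have "x \<in> orbit \<sigma> a1 \<or> x \<in> orbit \<sigma> a2 \<or> x \<in> orbit \<sigma> a3 \<or>
        x \<in> B - set (ys @ [a2] @ zs @ [a3] @ ws @ [a1])"
      unfolding orb using that by auto
    then consider "x \<in> orbit \<sigma> a1" | "x \<in> orbit \<sigma> a2" | "x \<in> orbit \<sigma> a3"
      | "x \<in> B - set (ys @ [a2] @ zs @ [a3] @ ws @ [a1])" by blast
    then show ?thesis
    proof cases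
      case 4
      then have "first_pos \<sigma> x < pos \<sigma> a1" using c4 first_pos_lt_iff[OF \<sigma>, of x] by simp
      then show ?thesis ..
    next
      case 1 then show ?thesis using f1 first_pos_orbit[OF \<sigma> 1] by simp
    next
      case 2 then show ?thesis using f2 first_pos_orbit[OF \<sigma> 2] by simp
    next
      case 3 then show ?thesis using first_pos_orbit[OF \<sigma> 3] by simp
    qed
  qed
  have mx: "\<forall>x\<in>B. first_pos \<sigma> x \<le> first_pos \<sigma> a3" using f4 f3 lt1 by fastforce
  \<comment> \<open>The preimage of \<open>a3\<close>, which is \<open>a3\<close> itself if
    \<open>zs\<close> is empty.\<close>
  define h where "h = last (a3 # zs)"
  have "\<sigma> h = a3"
  proof (cases zs rule: rev_cases)
    case Nil then show ?thesis using cyc(2) by (simp add: h_def cycle_list_def)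
  next
    case (snoc us u)
    then have "\<sigma> u = a3" using cyc(2) cycle_list_last[of \<sigma> us u a3] by simp
    then show ?thesis using snoc by (simp add: h_def)
  qed
  moreover have "h \<in> H" using L assms last_in_set[of "a3 # zs"]
    by (auto simp: h_def simp del: last.simps)
  moreover have "pos \<sigma> a3 \<le> pos \<sigma> h" using c3 by (auto simp: h_def)
  ultimately have "a3 \<in> descent_targets \<sigma>" unfolding descent_targets_def by blast
  then show ?R using fam mx L f1 f2 f3 f4 lt1 by (simp add: marked_def)
next
  assume R: ?R
  then have fam: "\<sigma> \<in> family B Q (j + 2)" and aB: "a1 \<in> B" "a2 \<in> B" "a3 \<in> B"
    and f1: "first_pos \<sigma> a1 = pos \<sigma> a1" and f2: "first_pos \<sigma> a2 = pos \<sigma> a2"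
    and lt: "pos \<sigma> a1 < pos \<sigma> a2" "pos \<sigma> a2 < first_pos \<sigma> a3"
    and f4: "\<And>x. x \<in> B \<Longrightarrow> first_pos \<sigma> x < pos \<sigma> a1 \<or> first_pos \<sigma> x \<in> {pos \<sigma> a1, pos \<sigma> a2, first_pos \<sigma> a3}"
    and dt: "a3 \<in> descent_targets \<sigma>"
    unfolding marked_def by auto
  note \<sigma> = familyD(1)[OF assms fam]
  have aH: "a1 \<in> H" "a2 \<in> H" "a3 \<in> H" using aB assms by auto
  obtain ys zs ws where cyc: "cycle_list \<sigma> (ys @ [a2])" "cycle_list \<sigma> (zs @ [a3])" "cycle_list \<sigma> (ws @ [a1])"
    using cycle_list_exists rotationsD(4)[OF \<sigma>] by metis
  have orb: "orbit \<sigma> a2 = set (ys @ [a2])" "orbit \<sigma> a3 = set (zs @ [a3])" "orbit \<sigma> a1 = set (ws @ [a1])"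
    using cyc orbit_cycle_list by (metis in_set_conv_decomp)+
  have ne: "orbit \<sigma> a1 \<noteq> orbit \<sigma> a2" "orbit \<sigma> a1 \<noteq> orbit \<sigma> a3" "orbit \<sigma> a2 \<noteq> orbit \<sigma> a3"
    using first_pos_eq_iff[OF \<sigma> aH(1,2)] first_pos_eq_iff[OF \<sigma> aH(1,3)] first_pos_eq_iff[OF \<sigma> aH(2,3)] lt f1 f2
    by simp_all
  have dj: "orbit \<sigma> x \<inter> orbit \<sigma> y = {}" if "orbit \<sigma> x \<noteq> orbit \<sigma> y" for x y
    using that by (metis disjoint_iff orbit_eq[OF \<sigma>])
  have dist: "distinct (ys @ [a2] @ zs @ [a3] @ ws @ [a1])"
    using dj[OF ne(1)] dj[OF ne(2)] dj[OF ne(3)] cyc unfolding orb by (auto simp: cycle_list_def)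
  have LB: "set (ys @ [a2] @ zs @ [a3] @ ws @ [a1]) \<subseteq> B"
    using familyD(5)[OF assms fam] aB orb by (metis (no_types) Un_subset_iff set_append)
  have pne: "pos \<sigma> x \<noteq> pos \<sigma> y" if "x \<in> B" "y \<in> B" "x \<noteq> y" for x y
    using pos_inj[OF \<sigma>] that assms by (meson inj_onD subsetD)
  have c1: "\<forall>x \<in> set ws. pos \<sigma> a1 < pos \<sigma> x"
  proof
    fix x assume x: "x \<in> set ws"
    then have "pos \<sigma> a1 \<le> pos \<sigma> x" using first_pos_le[OF \<sigma>, of x a1] f1 orb by simp
    moreover have "pos \<sigma> a1 \<noteq> pos \<sigma> x" using x LB dist aB by (intro pne) auto
    ultimately show "pos \<sigma> a1 < pos \<sigma> x" by simp
  qed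
  have c2: "\<forall>x \<in> set ys \<union> set zs \<union> {a3}. pos \<sigma> a2 < pos \<sigma> x"
  proof
    fix x assume x: "x \<in> set ys \<union> set zs \<union> {a3}"
    show "pos \<sigma> a2 < pos \<sigma> x"
    proof (cases "x \<in> set ys")
      case True
      then have "pos \<sigma> a2 \<le> pos \<sigma> x" using first_pos_le[OF \<sigma>, of x a2] f2 orb by simp
      moreover have "pos \<sigma> a2 \<noteq> pos \<sigma> x" using True LB dist aB by (intro pne) auto
      ultimately show ?thesis by simp
    next
      case False
      then have "x \<in> orbit \<sigma> a3" using x orb by auto
      then show ?thesis using first_pos_le[OF \<sigma>, of x a3] lt by simp
    qed
  qed
  obtain h where h: "h \<in> H" "\<sigma> h = a3" "pos \<sigma> a3 \<le> pos \<sigma> h" using dt unfolding descent_targets_def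
    by auto
  have c3: "zs \<noteq> [] \<longrightarrow> pos \<sigma> a3 < pos \<sigma> (last zs)"
  proof
    assume "zs \<noteq> []"
    then obtain us u where zs: "zs = us @ [u]" by (metis rev_exhaust)
    then have "\<sigma> u = a3" using cyc(2) cycle_list_last[of \<sigma> us u a3] by simp
    then have "u = h" using h permutes_inj[OF rotationsD(1)[OF \<sigma>]] by (metis injD)
    moreover have "u \<noteq> a3" using dist zs by auto
    ultimately have "pos \<sigma> u \<noteq> pos \<sigma> a3" using LB zs by (intro pne) auto
    then show "pos \<sigma> a3 < pos \<sigma> (last zs)" using zs h(3) \<open>u = h\<close> by simp
  qed
  have c4: "\<forall>x \<in> B - set (ys @ [a2] @ zs @ [a3] @ ws @ [a1]). \<exists>y \<in> orbit \<sigma> x. pos \<sigma> y < pos \<sigma> a1"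
  proof
    fix x assume x: "x \<in> B - set (ys @ [a2] @ zs @ [a3] @ ws @ [a1])"
    have "x \<in> orbit \<sigma> x" by (rule rotationsD(4)[OF \<sigma>])
    then have "orbit \<sigma> x \<noteq> orbit \<sigma> a1" "orbit \<sigma> x \<noteq> orbit \<sigma> a2" "orbit \<sigma> x \<noteq> orbit \<sigma> a3"
      using x unfolding orb by (auto simp del: Diff_iff)
    moreover have "x \<in> H" using x assms by blast
    ultimately have "first_pos \<sigma> x \<notin> {first_pos \<sigma> a1, first_pos \<sigma> a2, first_pos \<sigma> a3}"
      using first_pos_eq_iff[OF \<sigma> _ aH(1)] first_pos_eq_iff[OF \<sigma> _ aH(2)] first_pos_eq_iff[OF \<sigma> _ aH(3)]
      by simp
    then have "first_pos \<sigma> x < pos \<sigma> a1" using f4[of x] x f1 f2 by simp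
    then show "\<exists>y \<in> orbit \<sigma> x. pos \<sigma> y < pos \<sigma> a1" using first_pos_lt_iff[OF \<sigma>] by blast
  qed
  show ?L unfolding glue_data_def mem_Collect_eq prod.case
    using fam lt(1) cyc dist LB c1 c2 c3 c4 by (intro conjI exI[of _ ys] exI[of _ zs] exI[of _ ws])
qed

text \<open>The mark is \<open>a3\<close>. The other two are forced: they are the first half-edges
  of the cycles that rank second and third from the end. The condition \<open>0 < j\<close> provides
  the three cycles.\<close>

lemma glue_data_marked:
  assumes B: "B \<subseteq> H" and j: "0 < j"
  shows "bij_betw (\<lambda>(\<sigma>, a1, a2, a3). (\<sigma>, a3)) (glue_data B Q j) (marked B Q (j + 2))"
  unfolding bij_betw_def
proof
  note iff = glue_data_iff[OF B]
  show "inj_on (\<lambda>(\<sigma>, a1, a2, a3). (\<sigma>, a3)) (glue_data B Q j)"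
  proof (rule inj_onI)
    fix x y :: "('a \<Rightarrow> 'a) \<times> 'a \<times> 'a \<times> 'a"
    assume x: "x \<in> glue_data B Q j" and y: "y \<in> glue_data B Q j"
      and eq: "(\<lambda>(\<sigma>, a1, a2, a3). (\<sigma>, a3)) x = (\<lambda>(\<sigma>, a1, a2, a3). (\<sigma>, a3)) y"
    obtain \<sigma> a1 a2 a3 where xe: "x = (\<sigma>, a1, a2, a3)" by (metis surj_pair)
    obtain b1 b2 where ye: "y = (\<sigma>, b1, b2, a3)" using eq xe by (cases y) auto
    note a = x[unfolded xe] and b = y[unfolded ye]
    have "\<sigma> \<in> rotations" using a by (simp add: glue_data_def family_def)
    note inj = pos_inj[OF this]
    have mem: "a1 \<in> B" "a2 \<in> B" "b1 \<in> B" "b2 \<in> B" using a b iff by blast+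
    have lt: "pos \<sigma> a1 < pos \<sigma> a2" "pos \<sigma> a2 < first_pos \<sigma> a3" "pos \<sigma> b1 < pos \<sigma> b2" "pos \<sigma> b2 < first_pos \<sigma> a3"
      and fp: "first_pos \<sigma> a1 = pos \<sigma> a1" "first_pos \<sigma> a2 = pos \<sigma> a2" "first_pos \<sigma> b1 = pos \<sigma> b1" "first_pos \<sigma> b2 = pos \<sigma> b2"
      and A: "\<And>x. x \<in> B \<Longrightarrow> first_pos \<sigma> x < pos \<sigma> a1 \<or> first_pos \<sigma> x \<in> {pos \<sigma> a1, pos \<sigma> a2, first_pos \<sigma> a3}"
      and A': "\<And>x. x \<in> B \<Longrightarrow> first_pos \<sigma> x < pos \<sigma> b1 \<or> first_pos \<sigma> x \<in> {pos \<sigma> b1, pos \<sigma> b2, first_pos \<sigma> a3}"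
      using a b unfolding iff by simp_all
    \<comment> \<open>Both are the second largest value of \<open>first_pos\<close> on
      \<open>B\<close>; likewise \<open>a1\<close> and \<open>b1\<close> give the third
      largest.\<close>
    have "pos \<sigma> a2 = pos \<sigma> b2" using A[OF mem(4)] A'[OF mem(2)] lt fp by auto
    moreover from this have "pos \<sigma> a1 = pos \<sigma> b1" using A[OF mem(3)] A'[OF mem(1)] lt fp by auto
    ultimately have "a1 = b1 \<and> a2 = b2" using inj mem B by (meson inj_onD subsetD)
    then show "x = y" by (simp add: xe ye)
  qed
  show "(\<lambda>(\<sigma>, a1, a2, a3). (\<sigma>, a3)) ` glue_data B Q j = marked B Q (j + 2)"
  proof (intro subset_antisym subsetI)
    fix x assume "x \<in> (\<lambda>(\<sigma>, a1, a2, a3). (\<sigma>, a3)) ` glue_data B Q j"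
    then show "x \<in> marked B Q (j + 2)" using iff by fastforce
  next
    fix x assume x: "x \<in> marked B Q (j + 2)"
    obtain \<sigma> b where xe: "x = (\<sigma>, b)" by fastforce
    have fam: "\<sigma> \<in> family B Q (j + 2)" and bB: "b \<in> B"
      and mx: "\<And>x. x \<in> B \<Longrightarrow> first_pos \<sigma> x \<le> first_pos \<sigma> b" using x unfolding xe marked_def by auto
    note \<sigma> = familyD(1)[OF B fam]
    let ?M = "first_pos \<sigma> ` B"
    have fin: "finite ?M" using B finite_H finite_subset by blast
    have cM: "card ?M = j + 2" using card_first_pos[OF \<sigma> B] familyD(4)[OF B fam] by simp
    let ?M2 = "?M - {first_pos \<sigma> b}"
    have c2: "card ?M2 = j + 1" using cM bB fin by simp
    then have ne2: "?M2 \<noteq> {}" by (intro notI) simp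
    \<comment> \<open>\<open>k2\<close>, and \<open>k1\<close> below, are the second and third
      largest first positions; \<open>ex\<close> turns them into half-edges.\<close>
    define k2 where "k2 = Max ?M2"
    have k2: "k2 \<in> ?M2" "\<And>k. k \<in> ?M2 \<Longrightarrow> k \<le> k2" unfolding k2_def using fin ne2
      by (simp_all add: Max_in del: Diff_iff)
    let ?M1 = "?M2 - {k2}"
    have "card ?M1 = j" using c2 k2(1) fin by simp
    then have ne1: "?M1 \<noteq> {}" using j by (intro notI) simp
    define k1 where "k1 = Max ?M1"
    have k1: "k1 \<in> ?M1" "\<And>k. k \<in> ?M1 \<Longrightarrow> k \<le> k1" unfolding k1_def using fin ne1
      by (simp_all add: Max_in del: Diff_iff)
    have ex: "\<exists>a \<in> B. first_pos \<sigma> a = pos \<sigma> a \<and> pos \<sigma> a = k" if k: "k \<in> ?M" for k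
    proof -
      obtain x where "x \<in> B" "k = first_pos \<sigma> x" using k by blast
      then show ?thesis using obtain_first[OF \<sigma>, of x] familyD(5)[OF B fam, of x] by (metis subsetD)
    qed
    obtain a1 where a1: "a1 \<in> B" "first_pos \<sigma> a1 = pos \<sigma> a1" "pos \<sigma> a1 = k1" using ex[of k1] k1(1)
      by blast
    obtain a2 where a2: "a2 \<in> B" "first_pos \<sigma> a2 = pos \<sigma> a2" "pos \<sigma> a2 = k2" using ex[of k2] k2(1)
      by blast
    have lt1: "k1 < k2" using k1(1) k2 by (metis DiffD1 DiffD2 insertI1 nat_less_le)
    have lt2: "k2 < first_pos \<sigma> b" using k2(1) mx by (metis DiffE imageE insertI1 nat_less_le)
    have "\<forall>x\<in>B. first_pos \<sigma> x < k1 \<or> first_pos \<sigma> x \<in> {k1, k2, first_pos \<sigma> b}"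
    proof
      fix x assume "x \<in> B"
      then show "first_pos \<sigma> x < k1 \<or> first_pos \<sigma> x \<in> {k1, k2, first_pos \<sigma> b}"
        using k1(2)[of "first_pos \<sigma> x"] by fastforce
    qed
    then have "(\<sigma>, a1, a2, b) \<in> glue_data B Q j"
      unfolding iff using a1 a2 lt1 lt2 x xe by simp
    then show "x \<in> (\<lambda>(\<sigma>, a1, a2, a3). (\<sigma>, a3)) ` glue_data B Q j"
      unfolding xe by (rule rev_image_eqI) simp
  qed
qed

lemma slice_dataE:
  assumes "(\<sigma>, a1, a3, a2) \<in> slice_data B Q j"
  obtains ys zs ws where "\<sigma> \<in> family B Q j" "pos \<sigma> a1 < pos \<sigma> a3" "pos \<sigma> a3 < pos \<sigma> a2"
    "cycle_list \<sigma> (ys @ [a2] @ zs @ [a3] @ ws @ [a1])"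
    "set (ys @ [a2] @ zs @ [a3] @ ws @ [a1]) \<subseteq> B"
    "\<forall>x \<in> set ys \<union> set zs \<union> set ws. pos \<sigma> a1 < pos \<sigma> x"
    "\<forall>x \<in> set ys \<union> set zs. pos \<sigma> x < pos \<sigma> a3 \<or> pos \<sigma> a2 < pos \<sigma> x"
    "zs \<noteq> [] \<longrightarrow> pos \<sigma> a3 < pos \<sigma> (last zs)"
    "\<forall>x \<in> B - set (ys @ [a2] @ zs @ [a3] @ ws @ [a1]). \<exists>y \<in> orbit \<sigma> x. pos \<sigma> y < pos \<sigma> a1"
  using assms unfolding slice_data_def mem_Collect_eq prod.case by (elim conjE exE) (rule that)

text \<open>Everything is recovered from the trisection target \<open>b\<close>. Its cycle is listed
  up to its first half-edge, which is \<open>a1\<close>. Among the entries before \<open>b\<close>,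
  the predecessor of \<open>b\<close> comes after \<open>b\<close> on the face because
  \<open>b\<close> is a descent target; the earliest entry of this kind is
  \<open>a2\<close>.\<close>

lemma slice_data_trisected:
  assumes B: "B \<subseteq> H"
  shows "bij_betw (\<lambda>(\<sigma>, a1, a3, a2). (\<sigma>, a3)) (slice_data B Q j) (trisected B Q j)"
  unfolding bij_betw_def
proof
  let ?p = "\<lambda>(\<sigma>, a1, a3, a2). (\<sigma>, a3)"
  show "inj_on ?p (slice_data B Q j)"
  proof (rule inj_onI)
    fix x y :: "('a \<Rightarrow> 'a) \<times> 'a \<times> 'a \<times> 'a"
    assume x: "x \<in> slice_data B Q j" and y: "y \<in> slice_data B Q j" and eq: "?p x = ?p y"
    obtain \<sigma> a1 a2 a3 where xe: "x = (\<sigma>, a1, a3, a2)" by (metis surj_pair)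
    obtain b1 b2 where ye: "y = (\<sigma>, b1, a3, b2)" using eq xe by (cases y) auto
    note a = x[unfolded xe] and b = y[unfolded ye]
    obtain ys zs ws where A: "\<sigma> \<in> family B Q j" "pos \<sigma> a1 < pos \<sigma> a3" "pos \<sigma> a3 < pos \<sigma> a2"
      "cycle_list \<sigma> (ys @ [a2] @ zs @ [a3] @ ws @ [a1])"
      "set (ys @ [a2] @ zs @ [a3] @ ws @ [a1]) \<subseteq> B"
      "\<forall>x \<in> set ys \<union> set zs \<union> set ws. pos \<sigma> a1 < pos \<sigma> x"
      "\<forall>x \<in> set ys \<union> set zs. pos \<sigma> x < pos \<sigma> a3 \<or> pos \<sigma> a2 < pos \<sigma> x"
      using a by (rule slice_dataE) (rule that)
    obtain ys' zs' ws' where A': "pos \<sigma> b1 < pos \<sigma> a3" "pos \<sigma> a3 < pos \<sigma> b2"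
      "cycle_list \<sigma> (ys' @ [b2] @ zs' @ [a3] @ ws' @ [b1])"
      "set (ys' @ [b2] @ zs' @ [a3] @ ws' @ [b1]) \<subseteq> B"
      "\<forall>x \<in> set ys' \<union> set zs' \<union> set ws'. pos \<sigma> b1 < pos \<sigma> x"
      "\<forall>x \<in> set ys' \<union> set zs'. pos \<sigma> x < pos \<sigma> a3 \<or> pos \<sigma> b2 < pos \<sigma> x"
      using b by (rule slice_dataE) (rule that)
    note \<sigma> = familyD(1)[OF B A(1)]
    have inj: "x = y" if "pos \<sigma> x = pos \<sigma> y" "x \<in> B" "y \<in> B" for x y
      using pos_inj[OF \<sigma>] that B by (meson inj_onD subsetD)
    have sets: "set (ys @ [a2] @ zs @ [a3] @ ws @ [a1]) = set (ys' @ [b2] @ zs' @ [a3] @ ws' @ [b1])"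
      using orbit_cycle_list[OF A(4), of a3] orbit_cycle_list[OF A'(3), of a3] by simp
    have le1: "pos \<sigma> a1 \<le> pos \<sigma> x" if "x \<in> set (ys @ [a2] @ zs @ [a3] @ ws @ [a1])" for x
      using that A(2,3) A(6)[unfolded ball_Un] by (auto simp: less_imp_le)
    have le2: "pos \<sigma> b1 \<le> pos \<sigma> x" if "x \<in> set (ys @ [a2] @ zs @ [a3] @ ws @ [a1])" for x
      using that A'(1,2) A'(5)[unfolded ball_Un] unfolding sets by (auto simp: less_imp_le)
    have b1: "b1 \<in> set (ys @ [a2] @ zs @ [a3] @ ws @ [a1])" unfolding sets by simp
    have "pos \<sigma> a1 = pos \<sigma> b1" using le1[OF b1] le2[of a1] by simp
    then have e1: "a1 = b1" using A(5) A'(4) by (intro inj) auto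
    have "ys @ [a2] @ zs @ [a3] @ ws = ys' @ [b2] @ zs' @ [a3] @ ws'"
      using cycle_list_unique[of \<sigma> "ys @ [a2] @ zs @ [a3] @ ws" a1 "ys' @ [b2] @ zs' @ [a3] @ ws'"] A(4) A'(3) e1
      by simp
    then have "(ys @ [a2] @ zs) @ a3 # ws = (ys' @ [b2] @ zs') @ a3 # ws'" by simp
    moreover have "a3 \<notin> set (ys @ [a2] @ zs)" "a3 \<notin> set (ys' @ [b2] @ zs')" "a3 \<notin> set ws"
      using A(4) A'(3) by (auto simp: cycle_list_def)
    ultimately have pre: "ys @ [a2] @ zs = ys' @ [b2] @ zs'"
      using append_Cons_eq_iff[of a3 "ys @ [a2] @ zs" ws "ys' @ [b2] @ zs'" ws'] by simp
    \<comment> \<open>Each of \<open>a2\<close> and \<open>b2\<close> is the earliest half-edge of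
      the common prefix that comes after \<open>a3\<close>.\<close>
    have "b2 \<in> set (ys @ [a2] @ zs)" unfolding pre by simp
    then have "pos \<sigma> a2 \<le> pos \<sigma> b2" using A(7) A'(2) by (auto simp: ball_Un dest!: bspec)
    moreover have "a2 \<in> set (ys' @ [b2] @ zs')" unfolding pre[symmetric] by simp
    then have "pos \<sigma> b2 \<le> pos \<sigma> a2" using A'(6) A(3) by (auto simp: ball_Un dest!: bspec)
    ultimately have "a2 = b2" using A(5) A'(4) by (intro inj) auto
    with e1 show "x = y" by (simp add: xe ye)
  qed
  show "?p ` slice_data B Q j = trisected B Q j"
  proof (intro subset_antisym subsetI)
    fix x assume "x \<in> ?p ` slice_data B Q j"
    then obtain \<sigma> a1 a2 a3 where x: "x = (\<sigma>, a3)" and a: "(\<sigma>, a1, a3, a2) \<in> slice_data B Q j" by auto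
    obtain ys zs ws where A: "\<sigma> \<in> family B Q j" "pos \<sigma> a1 < pos \<sigma> a3" "pos \<sigma> a3 < pos \<sigma> a2"
      "cycle_list \<sigma> (ys @ [a2] @ zs @ [a3] @ ws @ [a1])"
      "set (ys @ [a2] @ zs @ [a3] @ ws @ [a1]) \<subseteq> B"
      "\<forall>x \<in> set ys \<union> set zs \<union> set ws. pos \<sigma> a1 < pos \<sigma> x"
      "zs \<noteq> [] \<longrightarrow> pos \<sigma> a3 < pos \<sigma> (last zs)"
      "\<forall>x \<in> B - set (ys @ [a2] @ zs @ [a3] @ ws @ [a1]). \<exists>y \<in> orbit \<sigma> x. pos \<sigma> y < pos \<sigma> a1"
      using a by (rule slice_dataE) (rule that)
    note \<sigma> = familyD(1)[OF B A(1)]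
    have orb: "orbit \<sigma> y = set (ys @ [a2] @ zs @ [a3] @ ws @ [a1])"
      if "y \<in> set (ys @ [a2] @ zs @ [a3] @ ws @ [a1])" for y
      using orbit_cycle_list[OF A(4) that] .
    have fp: "first_pos \<sigma> y = pos \<sigma> a1" if y: "y \<in> set (ys @ [a2] @ zs @ [a3] @ ws @ [a1])" for y
    proof -
      have "first_pos \<sigma> a1 = pos \<sigma> a1"
        using A(2,3) A(6)[unfolded ball_Un] by (intro first_pos_eqI[OF \<sigma>]) (auto simp: orb less_imp_le)
      then show ?thesis using first_pos_orbit[OF \<sigma>, of a1 y] orb[OF y] by simp
    qed
    have mx: "\<forall>x\<in>B. first_pos \<sigma> x \<le> first_pos \<sigma> a3"
    proof
      fix x assume "x \<in> B"
      then show "first_pos \<sigma> x \<le> first_pos \<sigma> a3"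
        using A(8) first_pos_lt_iff[OF \<sigma>, of x "pos \<sigma> a1"] fp[of x] fp[of a3]
        by (cases "x \<in> set (ys @ [a2] @ zs @ [a3] @ ws @ [a1])") (auto simp: less_imp_le)
    qed
    \<comment> \<open>The preimage of \<open>a3\<close> in the merged cycle; if \<open>zs\<close> is
      empty, it is \<open>a2\<close>.\<close>
    define h where "h = last (a2 # zs)"
    have "\<sigma> h = a3"
    proof -
      obtain us where us: "a2 # zs = us @ [h]" unfolding h_def
        by (metis append_butlast_last_id list.distinct(1))
      let ?L = "ys @ us @ [h] @ [a3] @ ws @ [a1]"
      have L: "cycle_list \<sigma> ?L" using A(4) us by (metis append.assoc append_Cons append_Nil)
      have "\<sigma> (?L ! length (ys @ us)) = ?L ! (Suc (length (ys @ us)) mod length ?L)"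
        by (rule cycle_list_nth[OF L]) simp
      then show ?thesis by (simp add: nth_append)
    qed
    moreover have "h \<in> H" using A(5) B last_in_set[of "a2 # zs"]
      by (auto simp: h_def simp del: last.simps)
    moreover have "pos \<sigma> a3 \<le> pos \<sigma> h" using A(3,7) by (auto simp: h_def)
    ultimately have "a3 \<in> descent_targets \<sigma>" unfolding descent_targets_def by blast
    then show "x \<in> trisected B Q j" using mx A(1,2,5) fp[of a3]
      by (simp add: x trisected_def marked_def)
  next
    fix x assume x: "x \<in> trisected B Q j"
    obtain \<sigma> b where xe: "x = (\<sigma>, b)" by fastforce
    have fam: "\<sigma> \<in> family B Q j" and bB: "b \<in> B" and lt: "first_pos \<sigma> b < pos \<sigma> b"
      and mx: "\<And>x. x \<in> B \<Longrightarrow> first_pos \<sigma> x \<le> first_pos \<sigma> b" and dt: "b \<in> descent_targets \<sigma>"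
      using x unfolding xe trisected_def marked_def by auto
    note \<sigma> = familyD(1)[OF B fam]
    obtain m where m: "m \<in> orbit \<sigma> b" "first_pos \<sigma> m = pos \<sigma> m" "first_pos \<sigma> b = pos \<sigma> m"
      using obtain_first[OF \<sigma>] by metis
    obtain L where L: "cycle_list \<sigma> (L @ [m])" using cycle_list_exists rotationsD(4)[OF \<sigma>] by metis
    have orb: "set (L @ [m]) = orbit \<sigma> b"
      using orbit_cycle_list[OF L, of m] orbit_eq[OF \<sigma> m(1)] by simp
    have LB: "set (L @ [m]) \<subseteq> B" unfolding orb using familyD(5)[OF B fam bB] .
    have pne: "pos \<sigma> x \<noteq> pos \<sigma> y" if "x \<in> B" "y \<in> B" "x \<noteq> y" for x y
      using pos_inj[OF \<sigma>] that B by (meson inj_onD subsetD)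
    have "b \<in> set L" using rotationsD(4)[OF \<sigma>, of b] lt m(3) orb by auto
    then obtain P ws where P: "L = P @ b # ws" by (meson split_list)
    obtain h where h: "h \<in> H" "\<sigma> h = b" "pos \<sigma> b \<le> pos \<sigma> h" using dt unfolding descent_targets_def
      by auto
    have inj: "inj \<sigma>" using permutes_inj[OF rotationsD(1)[OF \<sigma>]] .
    \<comment> \<open>Otherwise \<open>b\<close> would be the image of \<open>m\<close>, which
      precedes it on the face, and this is no weak descent.\<close>
    have Pne: "P \<noteq> []"
    proof
      assume "P = []"
      then have "\<sigma> m = b" using L P cycle_list_snoc_iff[of \<sigma> L m] by simp
      then have "h = m" using inj h(2) by (metis injD)
      then show False using h(3) lt m(3) by simp
    qed
    then have hP: "h = last P"
    proof -
      obtain us u where us: "P = us @ [u]" using Pne by (metis rev_exhaust)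
      let ?L = "us @ [u] @ [b] @ ws @ [m]"
      have L': "cycle_list \<sigma> ?L" using L us P by simp
      have "\<sigma> (?L ! length us) = ?L ! (Suc (length us) mod length ?L)"
        by (rule cycle_list_nth[OF L']) simp
      then have "\<sigma> u = b" by (simp add: nth_append)
      then show ?thesis using inj h(2) us by (metis injD last_snoc)
    qed
    have dist: "distinct (P @ b # ws @ [m])" using L P by (simp add: cycle_list_def)
    have PB: "set P \<subseteq> B" using LB P by auto
    have "h \<in> set P" using hP Pne by simp
    then have "pos \<sigma> h \<noteq> pos \<sigma> b" using bB PB dist by (intro pne) auto
    then have hlt: "pos \<sigma> b < pos \<sigma> h" using h(3) by simp
    \<comment> \<open>The candidates for \<open>a2\<close>; the preimage \<open>h\<close> of
      \<open>b\<close> is one of them.\<close>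
    let ?S = "{x \<in> set P. pos \<sigma> b < pos \<sigma> x}"
    have "h \<in> ?S" using hlt hP Pne by simp
    then obtain a where a: "a \<in> ?S" "\<And>x. x \<in> ?S \<Longrightarrow> pos \<sigma> a \<le> pos \<sigma> x"
      using ex_has_least_nat[of "\<lambda>x. x \<in> ?S" h "pos \<sigma>"] by blast
    obtain ys zs where yz: "P = ys @ a # zs" using a(1)
      by (metis (no_types, lifting) mem_Collect_eq split_list)
    have eqL: "L @ [m] = ys @ [a] @ zs @ [b] @ ws @ [m]" using P yz by simp
    have d1: "\<forall>x \<in> set ys \<union> set zs \<union> set ws. pos \<sigma> m < pos \<sigma> x"
    proof
      fix x assume x: "x \<in> set ys \<union> set zs \<union> set ws"
      then have xo: "x \<in> set (L @ [m])" unfolding eqL by auto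
      then have "pos \<sigma> m \<le> pos \<sigma> x" using first_pos_le[OF \<sigma> xo[unfolded orb]] m(3) by simp
      moreover have "x \<noteq> m" using x dist yz by auto
      then have "pos \<sigma> m \<noteq> pos \<sigma> x" using xo LB by (intro pne) auto
      ultimately show "pos \<sigma> m < pos \<sigma> x" by simp
    qed
    have d2: "\<forall>x \<in> set ys \<union> set zs. pos \<sigma> x < pos \<sigma> b \<or> pos \<sigma> a < pos \<sigma> x"
    proof
      fix x assume x: "x \<in> set ys \<union> set zs"
      then have xP: "x \<in> set P" "a \<in> set P" "x \<noteq> b" "x \<noteq> a" using yz dist by auto
      then have "pos \<sigma> x \<noteq> pos \<sigma> b" "pos \<sigma> x \<noteq> pos \<sigma> a" using PB bB pne[of x b] pne[of x a] by auto
      then show "pos \<sigma> x < pos \<sigma> b \<or> pos \<sigma> a < pos \<sigma> x" using a(2)[of x] xP(1) by fastforce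
    qed
    have d3: "zs \<noteq> [] \<longrightarrow> pos \<sigma> b < pos \<sigma> (last zs)" using hlt hP yz by auto
    have d4: "\<forall>x \<in> B - set (ys @ [a] @ zs @ [b] @ ws @ [m]). \<exists>y \<in> orbit \<sigma> x. pos \<sigma> y < pos \<sigma> m"
    proof
      fix x assume x: "x \<in> B - set (ys @ [a] @ zs @ [b] @ ws @ [m])"
      then have "x \<notin> orbit \<sigma> b" unfolding orb[symmetric] eqL by blast
      then have "orbit \<sigma> x \<noteq> orbit \<sigma> b" using rotationsD(4)[OF \<sigma>, of x] by auto
      then have "first_pos \<sigma> x \<noteq> first_pos \<sigma> b" using first_pos_eq_iff[OF \<sigma>, of x b] x bB B by blast
      then have "first_pos \<sigma> x < pos \<sigma> m" using mx[of x] x m(3) by simp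
      then show "\<exists>y \<in> orbit \<sigma> x. pos \<sigma> y < pos \<sigma> m" using first_pos_lt_iff[OF \<sigma>] by blast
    qed
    have "(\<sigma>, m, b, a) \<in> slice_data B Q j" unfolding slice_data_def mem_Collect_eq prod.case
      using fam lt m(3) a(1) L LB d1 d2 d3 d4 unfolding eqL
      by (intro conjI exI[of _ ys] exI[of _ zs] exI[of _ ws]) simp_all
    then show "x \<in> ?p ` slice_data B Q j" unfolding xe by (rule rev_image_eqI) simp
  qed
qed

text \<open>Slicing keeps the mark and frees it from its restriction: a trisection with
  \<open>j\<close> cycles in \<open>B\<close> becomes an arbitrary mark with \<open>j + 2\<close>
  cycles.\<close>

lemma card_trisected: "B \<subseteq> H \<Longrightarrow> 0 < j \<Longrightarrow> card (trisected B Q j) = card (marked B Q (j + 2))"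
  using bij_betw_same_card[OF glue_data_marked] bij_betw_same_card[OF glue_data_bij]
    bij_betw_same_card[OF slice_data_trisected] by metis

end

section \<open>Iterated slicing and the sum over odd splittings\<close>

context rooted_matching
begin

lemma finite_marked: "B \<subseteq> H \<Longrightarrow> finite (marked B Q j)"
  by (rule finite_subset[of _ "family B Q j \<times> B"])
    (auto simp: marked_def finite_family intro: finite_subset[OF _ finite_H])

text \<open>Each permutation has exactly one trivial mark, at the first half-edge of the cycle that
  begins last; it is a weak descent target because its preimage lies in the same cycle. All other
  marks are trisections.\<close>

lemma card_marked_eq:
  assumes B: "B \<subseteq> H" and j: "0 < j"
  shows "card (marked B Q j) = card (family B Q j) + card (trisected B Q j)"
proof -
  let ?N = "{(\<sigma>, b) \<in> marked B Q j. first_pos \<sigma> b = pos \<sigma> b}"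
  have rot: "\<sigma> \<in> rotations" if "(\<sigma>, b) \<in> marked B Q j" for \<sigma> b
    using that by (auto simp: marked_def family_def)
  have u: "marked B Q j = ?N \<union> trisected B Q j"
  proof -
    have "first_pos \<sigma> b = pos \<sigma> b \<or> first_pos \<sigma> b < pos \<sigma> b" if "(\<sigma>, b) \<in> marked B Q j" for \<sigma> b
      using first_pos_le[OF rot[OF that] rotationsD(4)[OF rot[OF that]], of b] by linarith
    then have "x \<in> marked B Q j \<longleftrightarrow> x \<in> ?N \<union> trisected B Q j" for x
      unfolding trisected_def by (cases x) blast
    then show ?thesis by (rule set_eqI)
  qed
  have d: "?N \<inter> trisected B Q j = {}" by (auto simp: trisected_def)
  have f: "finite ?N" "finite (trisected B Q j)"
    using finite_marked[OF B, of Q j] by (auto simp: trisected_def intro: finite_subset[rotated])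
  have "card (marked B Q j) = card ?N + card (trisected B Q j)"
    using card_Un_disjoint[OF f d] by (simp only: u[symmetric])
  moreover have "bij_betw fst ?N (family B Q j)"
    unfolding bij_betw_def
  proof
    show "inj_on fst ?N"
    proof (rule inj_onI)
      fix x y assume x: "x \<in> ?N" and y: "y \<in> ?N" and e: "fst x = fst y"
      obtain \<sigma> b c where xe: "x = (\<sigma>, b)" and ye: "y = (\<sigma>, c)" using e by (cases x; cases y) simp
      have m: "(\<sigma>, b) \<in> marked B Q j" "(\<sigma>, c) \<in> marked B Q j"
        and f: "first_pos \<sigma> b = pos \<sigma> b" "first_pos \<sigma> c = pos \<sigma> c"
        using x y by (simp_all add: xe ye)
      then have bc: "b \<in> B" "c \<in> B" "first_pos \<sigma> c \<le> first_pos \<sigma> b" "first_pos \<sigma> b \<le> first_pos \<sigma> c"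
        unfolding marked_def by blast+
      have "b = c" using pos_inj[OF rot[OF m(1)]] bc f B by (intro inj_onD[of "pos \<sigma>" H]) auto
      then show "x = y" by (simp add: xe ye)
    qed
    show "fst ` ?N = family B Q j"
    proof (intro subset_antisym subsetI)
      fix \<sigma> assume "\<sigma> \<in> fst ` ?N" then show "\<sigma> \<in> family B Q j" by (auto simp: marked_def)
    next
      fix \<sigma> assume fam: "\<sigma> \<in> family B Q j"
      note \<sigma> = familyD(1)[OF B fam]
      have "B \<noteq> {}" using familyD(4)[OF B fam] j by auto
      moreover have "finite B" using B finite_H finite_subset by blast
      ultimately have "Max (first_pos \<sigma> ` B) \<in> first_pos \<sigma> ` B" by simp
      then obtain x where "x \<in> B" "first_pos \<sigma> x = Max (first_pos \<sigma> ` B)" by auto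
      then have x: "x \<in> B" "\<And>y. y \<in> B \<Longrightarrow> first_pos \<sigma> y \<le> first_pos \<sigma> x"
        using \<open>finite B\<close> by simp_all
      obtain b where b: "b \<in> orbit \<sigma> x" "first_pos \<sigma> b = pos \<sigma> b" "first_pos \<sigma> x = pos \<sigma> b"
        using obtain_first[OF \<sigma>] by metis
      have bB: "b \<in> B" using familyD(5)[OF B fam x(1)] b(1) by blast
      let ?h = "inv \<sigma> b"
      have p: "\<sigma> permutes H" by (rule rotationsD(1)[OF \<sigma>])
      have sh: "\<sigma> ?h = b" using permutes_inverses(1)[OF p] .
      have hH: "?h \<in> H" using bB B permutes_inv[OF p] by (meson permutes_in_image subsetD)
      have "b \<in> orbit \<sigma> ?h" by (metis orbit.base sh)
      then have "?h \<in> orbit \<sigma> b" using orbit_eq[OF \<sigma>] rotationsD(4)[OF \<sigma>, of ?h] by metis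
      then have "pos \<sigma> b \<le> pos \<sigma> ?h" using first_pos_le[OF \<sigma>] b(2) by metis
      then have "b \<in> descent_targets \<sigma>" unfolding descent_targets_def using sh hH
        by (metis (mono_tags, lifting) mem_Collect_eq)
      then have "(\<sigma>, b) \<in> ?N" using fam bB x(2) b by (simp add: marked_def)
      then show "\<sigma> \<in> fst ` ?N" by (rule rev_image_eqI) simp
    qed
  qed
  then have "card ?N = card (family B Q j)" by (rule bij_betw_same_card)
  ultimately show ?thesis by simp
qed

text \<open>Trivial marks are set aside and trisections are sliced, alternately. Every round leaves
  one \<open>family\<close> behind and raises the number of cycles by two.\<close>

lemma card_marked_odd:
  assumes B: "B \<subseteq> H"
  shows "card (marked B Q 1) = card {\<sigma>. \<exists>j. odd j \<and> \<sigma> \<in> family B Q j}"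
proof -
  have fB: "finite B" using B finite_H finite_subset by blast
  have step: "card (marked B Q 1) = (\<Sum>i<k. card (family B Q (2 * i + 1))) + card (marked B Q (2 * k + 1))" for k
  proof (induction k)
    case (Suc k)
    have "card (marked B Q (2 * k + 1)) = card (family B Q (2 * k + 1)) + card (marked B Q (2 * k + 1 + 2))"
      using card_marked_eq[OF B, of "2 * k + 1" Q] card_trisected[OF B, of "2 * k + 1" Q] by simp
    then show ?case using Suc by simp
  qed simp
  have le: "j \<le> card B" if "\<sigma> \<in> family B Q j" for \<sigma> j
    using familyD(4)[OF B that] card_image_le[OF fB, of "orbit \<sigma>"] by simp
  \<comment> \<open>A set of \<open>card B\<close> elements has no more than \<open>card B\<close>
    cycles, so nothing is left after \<open>card B\<close> rounds.\<close>
  have "marked B Q (2 * card B + 1) = {}" using le by (fastforce simp: marked_def)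
  then have "card (marked B Q 1) = (\<Sum>i<card B. card (family B Q (2 * i + 1)))" using step[of "card B"]
    by simp
  also have "\<dots> = card (\<Union>i<card B. family B Q (2 * i + 1))"
    by (subst card_UN_disjoint) (auto simp: finite_family, auto simp: family_def)
  also have "(\<Union>i<card B. family B Q (2 * i + 1)) = {\<sigma>. \<exists>j. odd j \<and> \<sigma> \<in> family B Q j}"
  proof (intro subset_antisym subsetI)
    fix \<sigma> assume "\<sigma> \<in> {\<sigma>. \<exists>j. odd j \<and> \<sigma> \<in> family B Q j}"
    then obtain i where i: "\<sigma> \<in> family B Q (2 * i + 1)" by (auto elim: oddE)
    then have "i < card B" using le[OF i] by simp
    then show "\<sigma> \<in> (\<Union>i<card B. family B Q (2 * i + 1))" using i by blast
  next
    fix \<sigma> assume "\<sigma> \<in> (\<Union>i<card B. family B Q (2 * i + 1))"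
    then obtain i where i: "\<sigma> \<in> family B Q (2 * i + 1)" by blast
    have "odd (2 * i + 1)" by simp
    then show "\<sigma> \<in> {\<sigma>. \<exists>j. odd j \<and> \<sigma> \<in> family B Q j}" using i by blast
  qed
  finally show ?thesis .
qed

definition num_rotations :: "'a set set \<Rightarrow> nat" where
  "num_rotations \<pi> = card {\<sigma> \<in> rotations. orbit \<sigma> ` H = \<pi>}"

lemma partition_on_orbits:
  assumes "\<sigma> \<in> rotations" "B \<subseteq> H" "\<And>x. x \<in> B \<Longrightarrow> \<sigma> x \<in> B"
  shows "partition_on B (orbit \<sigma> ` B)"
proof (rule partition_onI)
  have "orbit \<sigma> x \<subseteq> B" if "x \<in> B" for x by (rule orbit_closed[OF assms(3) that])
  then show "\<Union> (orbit \<sigma> ` B) = B" using rotationsD(4)[OF assms(1)] by auto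
  show "disjnt p q" if "p \<in> orbit \<sigma> ` B" "q \<in> orbit \<sigma> ` B" "p \<noteq> q" for p q
    using that orbit_eq[OF assms(1)] by (metis disjnt_iff imageE)
  show "{} \<notin> orbit \<sigma> ` B" using orbit_nonempty by (metis imageE)
qed

text \<open>The other blocks of \<open>\<pi>\<close> are disjoint from \<open>B\<close>, so a cycle
  belongs to \<open>S\<close> exactly when it starts in \<open>B\<close>. This passes from the data
  used for slicing to the full cycle partition.\<close>

lemma family_iff_orbits:
  assumes \<pi>: "partition_on H \<pi>" and B: "B \<in> \<pi>"
  shows "\<sigma> \<in> family B (\<pi> - {B}) j \<longleftrightarrow>
    \<sigma> \<in> rotations \<and> (\<exists>S. partition_on B S \<and> card S = j \<and> orbit \<sigma> ` H = \<pi> - {B} \<union> S)"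
proof -
  have BH: "B \<subseteq> H" using \<pi> B by (auto simp: partition_on_def)
  show ?thesis
  proof
    assume fam: "\<sigma> \<in> family B (\<pi> - {B}) j"
    note f = familyD[OF BH fam]
    have "orbit \<sigma> ` H = orbit \<sigma> ` (H - B) \<union> orbit \<sigma> ` B" using BH
      by (metis image_Un Un_Diff_cancel2 Un_absorb2)
    then show "\<sigma> \<in> rotations \<and> (\<exists>S. partition_on B S \<and> card S = j \<and> orbit \<sigma> ` H = \<pi> - {B} \<union> S)"
      using f partition_on_orbits[OF f(1) BH f(2)] by metis
  next
    assume "\<sigma> \<in> rotations \<and> (\<exists>S. partition_on B S \<and> card S = j \<and> orbit \<sigma> ` H = \<pi> - {B} \<union> S)"
    then obtain S where \<sigma>: "\<sigma> \<in> rotations" and S: "partition_on B S" "card S = j"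
      and o: "orbit \<sigma> ` H = \<pi> - {B} \<union> S" by blast
    have US: "\<Union> S = B" using S by (simp add: partition_on_def)
    have dj: "X \<inter> B = {}" if "X \<in> \<pi> - {B}" for X
      using \<pi> B that by (auto simp: partition_on_def disjoint_def)
    have inB: "orbit \<sigma> x \<in> S" if x: "x \<in> B" for x
    proof -
      have "orbit \<sigma> x \<in> \<pi> - {B} \<union> S" using o x BH by blast
      moreover have "orbit \<sigma> x \<notin> \<pi> - {B}" using dj rotationsD(4)[OF \<sigma>, of x] x by blast
      ultimately show ?thesis by blast
    qed
    have outB: "orbit \<sigma> x \<in> \<pi> - {B}" if x: "x \<in> H - B" for x
    proof -
      have "orbit \<sigma> x \<in> \<pi> - {B} \<union> S" using o x by blast
      moreover have "orbit \<sigma> x \<notin> S" using US rotationsD(4)[OF \<sigma>, of x] x by blast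
      ultimately show ?thesis by blast
    qed
    have notS: "X \<notin> S" if "X \<in> \<pi> - {B}" for X
    proof
      assume "X \<in> S"
      then have "X \<subseteq> B" using US by blast
      then have "X = {}" using dj[OF that] by blast
      then show False using that \<pi> by (auto simp: partition_on_def)
    qed
    have "\<sigma> x \<in> B" if "x \<in> B" for x using inB[OF that] US orbit.base[of \<sigma> x] by blast
    moreover have "orbit \<sigma> ` (H - B) = \<pi> - {B}"
    proof
      show "\<pi> - {B} \<subseteq> orbit \<sigma> ` (H - B)"
      proof
        fix X assume X: "X \<in> \<pi> - {B}"
        then obtain x where x: "x \<in> H" "X = orbit \<sigma> x" using o by blast
        have "x \<notin> B" using inB[of x] notS[OF X] x by blast
        then show "X \<in> orbit \<sigma> ` (H - B)" using x by blast
      qed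
    qed (use outB in blast)
    moreover have "orbit \<sigma> ` B = S"
    proof
      show "S \<subseteq> orbit \<sigma> ` B"
      proof
        fix X assume X: "X \<in> S"
        then obtain x where x: "x \<in> H" "X = orbit \<sigma> x" using o by blast
        have "x \<in> B" using outB[of x] notS[of X] X x by blast
        then show "X \<in> orbit \<sigma> ` B" using x by blast
      qed
    qed (use inB in blast)
    ultimately show "\<sigma> \<in> family B (\<pi> - {B}) j" using \<sigma> S by (simp add: family_def)
  qed
qed

lemma family_1:
  assumes \<pi>: "partition_on H \<pi>" and B: "B \<in> \<pi>"
  shows "family B (\<pi> - {B}) 1 = {\<sigma> \<in> rotations. orbit \<sigma> ` H = \<pi>}"
proof -
  have ne: "B \<noteq> {}" using \<pi> B by (auto simp: partition_on_def)
  have "partition_on B S \<and> card S = 1 \<longleftrightarrow> S = {B}" for S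
  proof
    assume "partition_on B S \<and> card S = 1"
    then show "S = {B}" unfolding partition_on_def by (metis card_1_singletonE ccpo_Sup_singleton)
  qed (simp add: partition_on_space[OF ne])
  moreover have "\<pi> - {B} \<union> {B} = \<pi>" using B by blast
  ultimately have "\<sigma> \<in> family B (\<pi> - {B}) 1 \<longleftrightarrow> \<sigma> \<in> rotations \<and> orbit \<sigma> ` H = \<pi>" for \<sigma>
    using family_iff_orbits[OF assms, of \<sigma> 1] by metis
  then show ?thesis by blast
qed

text \<open>The partition \<open>S\<close> can be read off as the set of cycles contained in
  \<open>B\<close>, so different \<open>S\<close> account for different permutations.\<close>

lemma card_odd_family:
  assumes \<pi>: "partition_on H \<pi>" and B: "B \<in> \<pi>"
  shows "card {\<sigma>. \<exists>j. odd j \<and> \<sigma> \<in> family B (\<pi> - {B}) j} =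
    (\<Sum>S | partition_on B S \<and> odd (card S). num_rotations (\<pi> - {B} \<union> S))"
proof -
  have BH: "B \<subseteq> H" using \<pi> B by (auto simp: partition_on_def)
  have "{\<sigma>. \<exists>j. odd j \<and> \<sigma> \<in> family B (\<pi> - {B}) j} =
      (\<Union>S\<in>{S. partition_on B S \<and> odd (card S)}. {\<sigma> \<in> rotations. orbit \<sigma> ` H = \<pi> - {B} \<union> S})"
    unfolding family_iff_orbits[OF assms] by blast
  also have "card \<dots> = (\<Sum>S | partition_on B S \<and> odd (card S). num_rotations (\<pi> - {B} \<union> S))"
    unfolding num_rotations_def
  proof (rule card_UN_disjoint)
    have "finite B" using BH finite_H finite_subset by blast
    then show "finite {S. partition_on B S \<and> odd (card S)}"
      by (rule finite_subset[rotated, OF finitely_many_partition_on]) auto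
    show "\<forall>S\<in>{S. partition_on B S \<and> odd (card S)}. finite {\<sigma> \<in> rotations. orbit \<sigma> ` H = \<pi> - {B} \<union> S}"
      using finite_rotations by simp
    have *: "{X \<in> \<pi> - {B} \<union> S. X \<subseteq> B} = S" if "partition_on B S" for S
    proof -
      have "\<not> X \<subseteq> B" if X: "X \<in> \<pi> - {B}" for X
      proof -
        have "X \<inter> B = {}" using partition_onD2[OF \<pi>] X B by (auto simp: disjoint_def)
        moreover have "X \<noteq> {}" using partition_onD3[OF \<pi>] X by blast
        ultimately show ?thesis by blast
      qed
      then show ?thesis using \<open>partition_on B S\<close> by (auto simp: partition_on_def)
    qed
    show "\<forall>S\<in>{S. partition_on B S \<and> odd (card S)}. \<forall>S'\<in>{S. partition_on B S \<and> odd (card S)}. S \<noteq> S' \<longrightarrow>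
        {\<sigma> \<in> rotations. orbit \<sigma> ` H = \<pi> - {B} \<union> S} \<inter> {\<sigma> \<in> rotations. orbit \<sigma> ` H = \<pi> - {B} \<union> S'} = {}"
    proof (intro ballI impI)
      fix S S' assume S: "S \<in> {S. partition_on B S \<and> odd (card S)}" "S' \<in> {S. partition_on B S \<and> odd (card S)}"
        and ne: "S \<noteq> S'"
      have "\<pi> - {B} \<union> S \<noteq> \<pi> - {B} \<union> S'"
      proof
        assume e: "\<pi> - {B} \<union> S = \<pi> - {B} \<union> S'"
        have "S = {X \<in> \<pi> - {B} \<union> S. X \<subseteq> B}" using S(1) *[of S] by simp
        also have "\<dots> = {X \<in> \<pi> - {B} \<union> S'. X \<subseteq> B}" unfolding e ..
        also have "\<dots> = S'" using S(2) *[of S'] by simp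
        finally show False using ne by simp
      qed
      then show "{\<sigma> \<in> rotations. orbit \<sigma> ` H = \<pi> - {B} \<union> S} \<inter> {\<sigma> \<in> rotations. orbit \<sigma> ` H = \<pi> - {B} \<union> S'} = {}"
        by (intro equals0I, elim IntE CollectE conjE) metis
    qed
  qed
  finally show ?thesis .
qed

end

section \<open>Counting weak descents\<close>

locale rooted_involution = rooted_matching +
  assumes alpha_neq: "h \<in> H \<Longrightarrow> \<alpha> h \<noteq> h" and alpha_alpha: "h \<in> H \<Longrightarrow> \<alpha> (\<alpha> h) = h"
begin

text \<open>Put \<open>y = \<alpha> (\<sigma> h)\<close>. Unless the walk wraps around,
  \<open>y\<close> comes directly after \<open>h\<close>, and
  \<open>\<alpha> y = \<sigma> h\<close>; so \<open>h\<close> is a weak descent exactly when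
  \<open>\<alpha> y\<close> precedes \<open>y\<close>. Each edge has one such end, and the step back
  to the root contributes one more.\<close>

lemma card_descent_targets:
  assumes \<sigma>: "\<sigma> \<in> rotations"
  shows "2 * card (descent_targets \<sigma>) = card H + 2"
proof -
  have aH: "\<alpha> h \<in> H \<longleftrightarrow> h \<in> H" for h using alpha_permutes by (rule permutes_in_image)
  have sH: "\<sigma> h \<in> H \<longleftrightarrow> h \<in> H" for h using rotationsD(1)[OF \<sigma>] by (rule permutes_in_image)
  let ?D = "{h \<in> H. pos \<sigma> (\<sigma> h) \<le> pos \<sigma> h}" and ?E = "{y \<in> H. pos \<sigma> (\<alpha> y) < pos \<sigma> y}"
  have "descent_targets \<sigma> = \<sigma> ` ?D" unfolding descent_targets_def by blast
  then have 1: "card (descent_targets \<sigma>) = card ?D"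
    using permutes_inj_on[OF rotationsD(1)[OF \<sigma>]] by (simp add: card_image)
  have eq: "h \<in> ?D \<longleftrightarrow> \<alpha> (\<sigma> h) \<in> insert r ?E" if h: "h \<in> H" for h
  proof (cases "Suc (pos \<sigma> h) < card H")
    case True
    then have "pos \<sigma> (\<alpha> (\<sigma> h)) = Suc (pos \<sigma> h)" using pos_step[OF \<sigma> h] by simp
    moreover from this have "\<alpha> (\<sigma> h) \<noteq> r" by (metis nat.distinct(1) pos_root)
    moreover have "\<alpha> (\<alpha> (\<sigma> h)) = \<sigma> h" "\<alpha> (\<sigma> h) \<in> H" using h alpha_alpha sH aH by simp_all
    ultimately show ?thesis using h by (simp add: less_Suc_eq_le)
  next
    case False
    then have e: "Suc (pos \<sigma> h) = card H" using pos_lt[OF \<sigma> h] by simp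
    have "pos \<sigma> (\<sigma> h) \<le> pos \<sigma> h" using pos_lt[OF \<sigma>, of "\<sigma> h"] sH h e by simp
    then show ?thesis using pos_wrap[OF \<sigma> h e] h by simp
  qed
  have img: "(\<alpha> \<circ> \<sigma>) ` H = H"
    using rotationsD(1)[OF \<sigma>] alpha_permutes by (meson permutes_compose permutes_image)
  have "(\<alpha> \<circ> \<sigma>) ` ?D = insert r ?E"
  proof (intro subset_antisym subsetI)
    fix y assume y: "y \<in> insert r ?E"
    then have "y \<in> (\<alpha> \<circ> \<sigma>) ` H" using root_in unfolding img by blast
    then obtain h where h: "h \<in> H" "y = (\<alpha> \<circ> \<sigma>) h" by blast
    then have "h \<in> ?D" using eq[OF h(1)] y by simp
    then show "y \<in> (\<alpha> \<circ> \<sigma>) ` ?D" unfolding h(2) by (rule imageI)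
  next
    fix y assume "y \<in> (\<alpha> \<circ> \<sigma>) ` ?D"
    then obtain h where h: "h \<in> ?D" "y = \<alpha> (\<sigma> h)" by auto
    then have "h \<in> H" by simp
    then show "y \<in> insert r ?E" using eq[of h] h by blast
  qed
  then have "card ?D = card (insert r ?E)"
    using card_image[of "\<alpha> \<circ> \<sigma>" ?D] inj_on_subset[of "\<alpha> \<circ> \<sigma>" UNIV ?D]
      permutes_inj[OF permutes_compose[OF rotationsD(1)[OF \<sigma>] alpha_permutes]] by simp
  also have "\<dots> = Suc (card ?E)" using finite_H by (subst card_insert_disjoint) auto
  finally have 2: "card ?D = Suc (card ?E)" .
  have ne: "pos \<sigma> (\<alpha> y) \<noteq> pos \<sigma> y" if "y \<in> H" for y
    using alpha_neq[OF that] pos_inj[OF \<sigma>] aH that by (meson inj_onD)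
  \<comment> \<open>The involution exchanges the later ends of the edges with the earlier
    ones.\<close>
  have "\<alpha> ` ?E = H - ?E"
  proof
    show "\<alpha> ` ?E \<subseteq> H - ?E"
    proof
      fix z assume "z \<in> \<alpha> ` ?E"
      then obtain y where y: "y \<in> ?E" "z = \<alpha> y" by blast
      then have "\<alpha> z = y" "z \<in> H" using alpha_alpha[of y] aH by simp_all
      then show "z \<in> H - ?E" using y by simp
    qed
    show "H - ?E \<subseteq> \<alpha> ` ?E"
    proof
      fix y assume y: "y \<in> H - ?E"
      then have "\<alpha> y \<in> ?E" using ne[of y] aH alpha_alpha by auto
      then show "y \<in> \<alpha> ` ?E" using alpha_alpha[of y] y by (intro image_eqI[of _ _ "\<alpha> y"]) simp_all
    qed
  qed
  then have "card ?E = card (H - ?E)"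
    using card_image[OF permutes_inj_on[OF alpha_permutes], of ?E] by simp
  also have "card (H - ?E) = card H - card ?E" using finite_H by (intro card_Diff_subset) auto
  finally have "card H = 2 * card ?E" using card_mono[OF finite_H, of ?E] by auto
  then show ?thesis using 1 2 by simp
qed

text \<open>Double counting of the pairs of a permutation with partition \<open>\<pi>\<close> and
  one of its weak descents: over permutations the number per permutation is constant, over blocks
  the sliced families appear. The doubling avoids a division.\<close>

theorem num_rotations_recurrence:
  assumes \<pi>: "partition_on H \<pi>"
  shows "(card H + 2) * num_rotations \<pi> =
    2 * (\<Sum>B\<in>\<pi>. \<Sum>S | partition_on B S \<and> odd (card S). num_rotations (\<pi> - {B} \<union> S))"
proof -
  let ?R = "{\<sigma> \<in> rotations. orbit \<sigma> ` H = \<pi>}"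
  have finR: "finite ?R" using finite_rotations by simp
  have fin\<pi>: "finite \<pi>" using finite_H \<pi> by (rule finite_elements)
  have BH: "B \<subseteq> H" "finite B" if "B \<in> \<pi>" for B
    using \<pi> that finite_H by (auto simp: partition_on_def intro: finite_subset)
  have m: "card (marked B (\<pi> - {B}) 1) = (\<Sum>\<sigma>\<in>?R. card (B \<inter> descent_targets \<sigma>))" if B: "B \<in> \<pi>" for B
  proof -
    have "marked B (\<pi> - {B}) 1 = Sigma ?R (\<lambda>\<sigma>. B \<inter> descent_targets \<sigma>)"
    proof -
      \<comment> \<open>\<open>B\<close> is a single cycle here, so its half-edges share one first
        position and the ordering condition in \<open>marked\<close> holds.\<close>
      have first_pos_const: "first_pos \<sigma> x = first_pos \<sigma> b" if \<sigma>: "\<sigma> \<in> ?R" and xb: "x \<in> B" "b \<in> B"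
        for \<sigma> x b
      proof -
        have fam: "\<sigma> \<in> family B (\<pi> - {B}) 1" using family_1[OF \<pi> B] \<sigma> by simp
        obtain X where "orbit \<sigma> ` B = {X}" using familyD(4)[OF BH(1)[OF B] fam]
          by (metis card_1_singletonE)
        then have "orbit \<sigma> x = orbit \<sigma> b" using xb by (metis image_eqI singletonD)
        then show ?thesis by (simp add: first_pos_def)
      qed
      have "\<forall>x\<in>B. first_pos \<sigma> x \<le> first_pos \<sigma> b" if "\<sigma> \<in> ?R" "b \<in> B" for \<sigma> b
      proof
        fix x assume "x \<in> B"
        then show "first_pos \<sigma> x \<le> first_pos \<sigma> b" using first_pos_const[OF that(1) _ that(2), of x]
          by simp
      qed
      then show ?thesis unfolding marked_def family_1[OF \<pi> B] by auto
    qed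
    then show ?thesis using finR BH(2)[OF B] by (simp add: card_SigmaI)
  qed
  have "(\<Sum>B\<in>\<pi>. \<Sum>S | partition_on B S \<and> odd (card S). num_rotations (\<pi> - {B} \<union> S)) =
      (\<Sum>B\<in>\<pi>. card (marked B (\<pi> - {B}) 1))"
    using card_odd_family[OF \<pi>] card_marked_odd BH by (intro sum.cong) auto
  also have "\<dots> = (\<Sum>B\<in>\<pi>. \<Sum>\<sigma>\<in>?R. card (B \<inter> descent_targets \<sigma>))" using m by simp
  also have "\<dots> = (\<Sum>\<sigma>\<in>?R. \<Sum>B\<in>\<pi>. card (B \<inter> descent_targets \<sigma>))" by (rule sum.swap)
  also have "\<dots> = (\<Sum>\<sigma>\<in>?R. card (descent_targets \<sigma>))"
  proof (rule sum.cong[OF refl])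
    fix \<sigma> assume \<sigma>: "\<sigma> \<in> ?R"
    have "descent_targets \<sigma> \<subseteq> H" using rotationsD(5)[of \<sigma>] \<sigma> by (auto simp: descent_targets_def)
    then have "descent_targets \<sigma> = (\<Union>B\<in>\<pi>. B \<inter> descent_targets \<sigma>)" using \<pi>
      by (auto simp: partition_on_def)
    then have "card (descent_targets \<sigma>) = card (\<Union>B\<in>\<pi>. B \<inter> descent_targets \<sigma>)" by simp
    also have "\<dots> = (\<Sum>B\<in>\<pi>. card (B \<inter> descent_targets \<sigma>))"
      using fin\<pi> BH(2) \<pi> by (intro card_UN_disjoint) (auto simp: partition_on_def disjoint_def)
    finally show "(\<Sum>B\<in>\<pi>. card (B \<inter> descent_targets \<sigma>)) = card (descent_targets \<sigma>)" by simp
  qed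
  finally have "2 * (\<Sum>B\<in>\<pi>. \<Sum>S | partition_on B S \<and> odd (card S). num_rotations (\<pi> - {B} \<union> S)) =
      (\<Sum>\<sigma>\<in>?R. 2 * card (descent_targets \<sigma>))" by (simp add: sum_distrib_left)
  also have "\<dots> = (\<Sum>\<sigma>\<in>?R. card H + 2)" using card_descent_targets by (intro sum.cong) auto
  also have "\<dots> = (card H + 2) * num_rotations \<pi>" by (simp add: num_rotations_def)
  finally show ?thesis by simp
qed

end

section \<open>Weighted set partitions\<close>

text \<open>The number of C-permutations of \<open>c\<close> elements with exactly one cycle.\<close>

definition block_weight :: "nat \<Rightarrow> nat" where
  "block_weight c = (if odd c then 2 * fact (c - 1) else 0)"

text \<open>The number of C-permutations whose cycles are the blocks of \<open>P\<close>; see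
  \<open>card_cperms_with_cycles\<close>.\<close>

definition partition_weight :: "'a set set \<Rightarrow> nat" where
  "partition_weight P = (\<Prod>b\<in>P. block_weight (card b))"

lemma partition_on_insert_block:
  assumes "B \<subseteq> A" "B \<noteq> {}" "partition_on (A - B) P"
  shows "partition_on A (insert B P)" "B \<notin> P"
proof -
  have U: "\<Union>P = A - B" using partition_onD1[OF assms(3)] by simp
  show "B \<notin> P" using U assms(2) by blast
  show "partition_on A (insert B P)"
  proof (rule partition_onI)
    show "\<Union> (insert B P) = A" using U assms(1) by auto
    show "{} \<notin> insert B P" using partition_onD3[OF assms(3)] assms(2) by auto
    show "disjnt p q" if "p \<in> insert B P" "q \<in> insert B P" "p \<noteq> q" for p q
      using that U partition_onD2[OF assms(3)] by (auto simp: disjnt_def disjoint_def)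
  qed
qed

lemma partition_on_remove_block:
  assumes "partition_on A P" "B \<in> P"
  shows "partition_on (A - B) (P - {B})" "B \<subseteq> A" "B \<noteq> {}"
proof -
  show "B \<subseteq> A" "B \<noteq> {}" using assms by (auto simp: partition_on_def)
  have dj: "X \<inter> B = {}" if "X \<in> P - {B}" for X
    using partition_onD2[OF assms(1)] that assms(2) by (auto simp: disjoint_def)
  show "partition_on (A - B) (P - {B})"
  proof (rule partition_onI)
    show "\<Union> (P - {B}) = A - B"
      using dj partition_onD1[OF assms(1)] by blast
    show "{} \<notin> P - {B}" using partition_onD3[OF assms(1)] by blast
    show "disjnt p q" if "p \<in> P - {B}" "q \<in> P - {B}" "p \<noteq> q" for p q
      using that partition_onD2[OF assms(1)] by (auto simp: disjnt_def disjoint_def)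
  qed
qed

text \<open>The partitions are sorted by the block that contains \<open>a\<close>; the remaining
  blocks partition its complement.\<close>

lemma sum_partition_weight_rec:
  assumes A: "finite A" "a \<in> A"
  shows "(\<Sum>P | partition_on A P. partition_weight P) =
    (\<Sum>B | a \<in> B \<and> B \<subseteq> A. block_weight (card B) * (\<Sum>P | partition_on (A - B) P. partition_weight P))"
proof -
  let ?D = "Sigma {B. a \<in> B \<and> B \<subseteq> A} (\<lambda>B. {P. partition_on (A - B) P})"
  have fin: "finite {B. a \<in> B \<and> B \<subseteq> A}" using A(1) by simp
  have "bij_betw (\<lambda>(B, P). insert B P) ?D {P. partition_on A P}"
    unfolding bij_betw_def
  proof
    show "inj_on (\<lambda>(B, P). insert B P) ?D"
    proof (rule inj_onI)
      fix x y assume x: "x \<in> ?D" and y: "y \<in> ?D"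
        and e: "(\<lambda>(B, P). insert B P) x = (\<lambda>(B, P). insert B P) y"
      obtain B P where xe: "x = (B, P)" by fastforce
      obtain C R where ye: "y = (C, R)" by fastforce
      have B: "a \<in> B" "B \<subseteq> A" "partition_on (A - B) P" using x xe by auto
      have C: "a \<in> C" "C \<subseteq> A" "partition_on (A - C) R" using y ye by auto
      have eq: "insert B P = insert C R" using e xe ye by simp
      have "B \<notin> R \<or> B = C" using partition_onD1[OF C(3)] C(1) B(1) by blast
      then have BC: "B = C" using eq by blast
      have "B \<notin> P" "C \<notin> R" using partition_on_insert_block(2) B C by blast+
      then have "P = R" using eq BC by (metis insert_ident)
      then show "x = y" using BC xe ye by simp
    qed
    show "(\<lambda>(B, P). insert B P) ` ?D = {P. partition_on A P}"
    proof (intro subset_antisym subsetI)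
      fix P assume "P \<in> (\<lambda>(B, P). insert B P) ` ?D"
      then obtain B R where "P = insert B R" "a \<in> B" "B \<subseteq> A" "partition_on (A - B) R" by auto
      then show "P \<in> {P. partition_on A P}" using partition_on_insert_block(1)[of B A R] by blast
    next
      fix P assume "P \<in> {P. partition_on A P}"
      then have P: "partition_on A P" by simp
      then obtain B where B: "B \<in> P" "a \<in> B" using A(2) by (auto simp: partition_on_def)
      have "(B, P - {B}) \<in> ?D" using partition_on_remove_block[OF P B(1)] B(2) by simp
      moreover have "P = (\<lambda>(B, P). insert B P) (B, P - {B})" using B(1) by auto
      ultimately show "P \<in> (\<lambda>(B, P). insert B P) ` ?D" by (rule rev_image_eqI)
    qed
  qed
  then have "(\<Sum>P | partition_on A P. partition_weight P) = (\<Sum>x\<in>?D. partition_weight ((\<lambda>(B, P). insert B P) x))"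
    by (metis (no_types, lifting) sum.cong sum.reindex_bij_betw)
  also have "\<dots> = (\<Sum>(B, P)\<in>?D. block_weight (card B) * partition_weight P)"
  proof (rule sum.cong[OF refl])
    fix x assume x: "x \<in> ?D"
    obtain B P where xe: "x = (B, P)" by fastforce
    have B: "a \<in> B" "B \<subseteq> A" "partition_on (A - B) P" using x xe by auto
    have "finite P" using finite_elements[OF _ B(3)] A(1) by simp
    moreover have "B \<notin> P" using partition_on_insert_block(2) B by blast
    ultimately show "partition_weight ((\<lambda>(B, P). insert B P) x) = (case x of (B, P) \<Rightarrow> block_weight (card B) * partition_weight P)"
      by (simp add: xe partition_weight_def)
  qed
  also have "\<dots> = (\<Sum>B | a \<in> B \<and> B \<subseteq> A. \<Sum>P | partition_on (A - B) P. block_weight (card B) * partition_weight P)"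
    using fin A(1) by (subst sum.Sigma) (auto intro: finitely_many_partition_on)
  finally show ?thesis by (simp add: sum_distrib_left)
qed

lemma sum_Pow_card:
  assumes "finite A"
  shows "(\<Sum>C\<in>Pow A. f (card C)) = (\<Sum>k\<le>card A. (card A choose k) * f k :: nat)"
proof -
  have "(\<Sum>C\<in>Pow A. f (card C)) = (\<Sum>k\<le>card A. \<Sum>C | C \<in> Pow A \<and> card C = k. f (card C))"
    using assms by (intro sum.group[symmetric]) (auto intro: card_mono)
  also have "\<dots> = (\<Sum>k\<le>card A. (card A choose k) * f k)"
  proof (rule sum.cong[OF refl])
    fix k
    have "(\<Sum>C | C \<in> Pow A \<and> card C = k. f (card C)) = (\<Sum>C | C \<subseteq> A \<and> card C = k. f k)"
      by (rule sum.cong) auto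
    then show "(\<Sum>C | C \<in> Pow A \<and> card C = k. f (card C)) = (card A choose k) * f k"
      using n_subsets[OF assms, of k] by simp
  qed
  finally show ?thesis .
qed

text \<open>Up to the factor \<open>2 * fact m\<close>, the summand is the contribution of the
  cycles of length \<open>k + 1\<close> through a fixed one of \<open>m + 1\<close> elements. It
  drops to 1 at \<open>k = m\<close> because the empty rest has one C-permutation, not
  \<open>2 * fact 0\<close>.\<close>

lemma sum_even_upto: "(\<Sum>k\<le>m. if even k then (if k = m then 1 else 2) else 0) = Suc m"
proof -
  have "(\<Sum>k<m. if even k then (if k = m then 1 else 2) else 0) = (\<Sum>k<m. if even k then 2 else 0 :: nat)"
    by (rule sum.cong) auto
  also have "\<dots> = (if even m then m else Suc m)"
    by (induction m) auto
  finally show ?thesis by (simp add: lessThan_Suc_atMost[symmetric])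
qed

text \<open>After removing the cycle through \<open>a\<close>, the binomial coefficient and the two
  factorials collapse to \<open>fact ?m\<close>, and only the parity of \<open>k\<close> is left to
  be summed.\<close>

lemma sum_partition_weight:
  assumes "finite A"
  shows "(\<Sum>P | partition_on A P. partition_weight P) = (if A = {} then 1 else 2 * fact (card A))"
  using assms
proof (induction "card A" arbitrary: A rule: less_induct)
  case (less A)
  show ?case
  proof (cases "A = {}")
    case True
    moreover have "{P :: 'a set set. partition_on {} P} = {{}}" by (auto simp: partition_on_empty)
    ultimately show ?thesis by (simp add: partition_weight_def)
  next
    case False
    then obtain a where a: "a \<in> A" by blast
    let ?A = "A - {a}" and ?m = "card (A - {a})"
    have m: "card A = Suc ?m" using a less.prems by (metis card_Suc_Diff1)
    let ?g = "\<lambda>k. if k = ?m then 1 else 2 * fact (?m - k)"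
    have "(\<Sum>P | partition_on A P. partition_weight P) =
        (\<Sum>B | a \<in> B \<and> B \<subseteq> A. block_weight (card B) * (\<Sum>P | partition_on (A - B) P. partition_weight P))"
      by (rule sum_partition_weight_rec[OF less.prems a])
    also have "\<dots> = (\<Sum>C\<in>Pow ?A. block_weight (Suc (card C)) * ?g (card C))"
    proof (rule sum.reindex_bij_witness[where i = "insert a" and j = "\<lambda>B. B - {a}"])
      fix B assume B: "B \<in> {B. a \<in> B \<and> B \<subseteq> A}"
      then have fB: "finite B" using less.prems finite_subset by blast
      have cB: "card B = Suc (card (B - {a}))" using B fB by (metis card_Suc_Diff1 mem_Collect_eq)
      have cAB: "card (A - B) = ?m - card (B - {a})" using B m cB fB by (simp add: card_Diff_subset)
      have le: "card (B - {a}) \<le> ?m" using B less.prems by (intro card_mono) auto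
      have "card (A - B) < card A" using m cAB by simp
      then have "(\<Sum>P | partition_on (A - B) P. partition_weight P) = (if A - B = {} then 1 else 2 * fact (card (A - B)))"
        using less.hyps less.prems by blast
      moreover have "A - B = {} \<longleftrightarrow> card (B - {a}) = ?m" using cAB le less.prems
        by (metis card_0_eq diff_is_0_eq finite_Diff le_antisym order_refl)
      ultimately show "block_weight (Suc (card (B - {a}))) * ?g (card (B - {a})) =
          block_weight (card B) * (\<Sum>P | partition_on (A - B) P. partition_weight P)"
        using cB cAB by simp
    qed (use a in auto)
    also have "\<dots> = (\<Sum>k\<le>?m. (?m choose k) * (block_weight (Suc k) * ?g k))"
      using sum_Pow_card[of ?A "\<lambda>k. block_weight (Suc k) * ?g k"] less.prems by simp
    also have "\<dots> = (\<Sum>k\<le>?m. 2 * fact ?m * (if even k then (if k = ?m then 1 else 2) else 0))"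
    proof (rule sum.cong[OF refl])
      fix k assume "k \<in> {..?m}"
      then have "(?m choose k) * fact k * fact (?m - k) = fact ?m"
        by (metis atMost_iff binomial_fact_lemma mult.assoc mult.commute)
      then show "(?m choose k) * (block_weight (Suc k) * ?g k) =
          2 * fact ?m * (if even k then (if k = ?m then 1 else 2) else 0)"
        by (auto simp: block_weight_def algebra_simps)
    qed
    also have "\<dots> = 2 * fact ?m * Suc ?m" unfolding sum_distrib_left[symmetric] sum_even_upto ..
    also have "\<dots> = 2 * fact (card A)" unfolding m by (simp add: algebra_simps)
    finally show ?thesis using False by simp
  qed
qed

text \<open>If all blocks are odd, their number has the parity of \<open>card A\<close>.\<close>

lemma sum_odd_partition_weight:
  assumes "finite A" "A \<noteq> {}"
  shows "(\<Sum>P | partition_on A P \<and> odd (card P). partition_weight P) = card A * block_weight (card A)"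
proof -
  have par: "odd (card P) \<longleftrightarrow> odd (card A)" if P: "partition_on A P" and w: "partition_weight P \<noteq> 0" for P
  proof -
    have fP: "finite P" using finite_elements[OF assms(1) P] .
    have fb: "finite b" if "b \<in> P" for b using P that assms(1)
      by (auto simp: partition_on_def intro: finite_subset)
    have o: "odd (card b)" if "b \<in> P" for b
    proof (rule ccontr)
      assume "\<not> odd (card b)"
      then have "block_weight (card b) = 0" by (simp add: block_weight_def)
      then show False using w that fP by (auto simp: partition_weight_def)
    qed
    have "card A = (\<Sum>b\<in>P. card b)" using product_partition[OF P] fb by blast
    then have "even (card A) \<longleftrightarrow> even (card {b \<in> P. odd (card b)})" using even_sum_iff[OF fP, of card]
      by simp
    moreover have "{b \<in> P. odd (card b)} = P" using o by blast
    ultimately show ?thesis by simp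
  qed
  have fin: "finite {P. partition_on A P}" by (rule finitely_many_partition_on[OF assms(1)])
  show ?thesis
  proof (cases "odd (card A)")
    case True
    have "(\<Sum>P | partition_on A P \<and> odd (card P). partition_weight P) = (\<Sum>P | partition_on A P. partition_weight P)"
      using par True fin by (intro sum.mono_neutral_left) auto
    also have "\<dots> = 2 * fact (card A)" using sum_partition_weight[OF assms(1)] assms(2) by simp
    \<comment> \<open>The total is \<open>card A\<close> times the weight of a single cycle; these
      factors later add up to the coefficient of the recurrence.\<close>
    also have "\<dots> = card A * block_weight (card A)"
      using True assms by (cases "card A") (auto simp: block_weight_def)
    finally show ?thesis .
  next
    case False
    have "(\<Sum>P | partition_on A P \<and> odd (card P). partition_weight P) = 0"
      using par False by (intro sum.neutral) auto
    then show ?thesis using False by (simp add: block_weight_def)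
  qed
qed

section \<open>Partitions pulled back along a surjection\<close>

definition pull :: "('h \<Rightarrow> 'a) \<Rightarrow> 'h set \<Rightarrow> 'a set set \<Rightarrow> 'h set set" where
  "pull \<nu> H Q = (\<lambda>b. \<nu> -` b \<inter> H) ` Q"

lemma pull_partition:
  assumes "\<nu> ` H = A" "partition_on A Q"
  shows "partition_on H (pull \<nu> H Q)"
proof (rule partition_onI)
  have U: "\<Union>Q = A" using partition_onD1[OF assms(2)] by simp
  show "\<Union> (pull \<nu> H Q) = H" using U assms(1) unfolding pull_def by blast
  show "{} \<notin> pull \<nu> H Q"
  proof
    assume "{} \<in> pull \<nu> H Q"
    then obtain b where b: "b \<in> Q" "\<nu> -` b \<inter> H = {}" unfolding pull_def by blast
    have "b \<noteq> {}" using partition_onD3[OF assms(2)] b(1) by blast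
    then obtain x where "x \<in> b" by blast
    then have "x \<in> \<nu> ` H" using U b(1) assms(1) by blast
    then show False using b(2) \<open>x \<in> b\<close> by blast
  qed
  show "disjnt p q" if pq: "p \<in> pull \<nu> H Q" "q \<in> pull \<nu> H Q" "p \<noteq> q" for p q
  proof -
    obtain b where "b \<in> Q" "p = \<nu> -` b \<inter> H" using pq(1) unfolding pull_def by blast
    moreover obtain c where "c \<in> Q" "q = \<nu> -` c \<inter> H" using pq(2) unfolding pull_def by blast
    moreover from calculation have "b \<inter> c = {}" using pq(3) partition_onD2[OF assms(2)]
      by (auto simp: disjoint_def)
    ultimately show ?thesis unfolding disjnt_def by blast
  qed
qed

lemma inj_on_preimage: "\<nu> ` H = A \<Longrightarrow> inj_on (\<lambda>b. \<nu> -` b \<inter> H) (Pow A)"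
  by (rule inj_onI) blast

lemma card_pull:
  assumes "\<nu> ` H = A" "partition_on A Q"
  shows "card (pull \<nu> H Q) = card Q"
proof -
  have "Q \<subseteq> Pow A" using assms(2) by (auto simp: partition_on_def)
  then show ?thesis unfolding pull_def using inj_on_subset[OF inj_on_preimage[OF assms(1)]]
    by (simp add: card_image)
qed

text \<open>A partition refined by the fibres of \<open>\<nu>\<close> has saturated blocks and is
  therefore pulled back from its image. This exchanges partitions of the vertices of a tree with
  coarsenings of its partition of the half-edges.\<close>

lemma pull_bij:
  assumes A: "\<nu> ` H = A"
  shows "bij_betw (pull \<nu> H) {Q. partition_on A Q} {\<pi>. refines H (pull \<nu> H ((\<lambda>a. {a}) ` A)) \<pi>}"
  unfolding bij_betw_def
proof
  have sing: "partition_on A ((\<lambda>a. {a}) ` A)" by (rule partition_on_singletons)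
  show "inj_on (pull \<nu> H) {Q. partition_on A Q}"
  proof (rule inj_onI)
    fix Q R assume "Q \<in> {Q. partition_on A Q}" "R \<in> {Q. partition_on A Q}"
      and e: "pull \<nu> H Q = pull \<nu> H R"
    then have "Q \<subseteq> Pow A" "R \<subseteq> Pow A" by (auto simp: partition_on_def)
    then show "Q = R" using e inj_on_image_eq_iff[OF inj_on_preimage[OF A], of Q R] unfolding pull_def
      by simp
  qed
  show "pull \<nu> H ` {Q. partition_on A Q} = {\<pi>. refines H (pull \<nu> H ((\<lambda>a. {a}) ` A)) \<pi>}"
  proof (intro subset_antisym subsetI)
    fix \<pi> assume "\<pi> \<in> pull \<nu> H ` {Q. partition_on A Q}"
    then obtain Q where Q: "partition_on A Q" "\<pi> = pull \<nu> H Q" by blast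
    have "\<exists>Y\<in>pull \<nu> H Q. X \<subseteq> Y" if X: "X \<in> pull \<nu> H ((\<lambda>a. {a}) ` A)" for X
    proof -
      obtain a where a: "a \<in> A" "X = \<nu> -` {a} \<inter> H" using X unfolding pull_def by blast
      then obtain b where b: "b \<in> Q" "a \<in> b" using partition_onD1[OF Q(1)] by blast
      have "\<nu> -` b \<inter> H \<in> pull \<nu> H Q" using b(1) by (simp add: pull_def)
      moreover have "X \<subseteq> \<nu> -` b \<inter> H" using a b(2) by blast
      ultimately show ?thesis by blast
    qed
    then show "\<pi> \<in> {\<pi>. refines H (pull \<nu> H ((\<lambda>a. {a}) ` A)) \<pi>}"
      using pull_partition[OF A sing] pull_partition[OF A Q(1)] Q(2) by (simp add: refines_def)
  next
    fix \<pi> assume "\<pi> \<in> {\<pi>. refines H (pull \<nu> H ((\<lambda>a. {a}) ` A)) \<pi>}"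
    then have r: "partition_on H \<pi>" "\<And>X. X \<in> pull \<nu> H ((\<lambda>a. {a}) ` A) \<Longrightarrow> \<exists>Y\<in>\<pi>. X \<subseteq> Y"
      by (auto simp: refines_def)
    have sat: "\<nu> -` (\<nu> ` Y) \<inter> H = Y" if Y: "Y \<in> \<pi>" for Y
    proof
      show "Y \<subseteq> \<nu> -` (\<nu> ` Y) \<inter> H" using r(1) Y by (auto simp: partition_on_def)
      show "\<nu> -` (\<nu> ` Y) \<inter> H \<subseteq> Y"
      proof
        fix h assume h: "h \<in> \<nu> -` (\<nu> ` Y) \<inter> H"
        then obtain y where y: "y \<in> Y" "\<nu> h = \<nu> y" by blast
        have yH: "y \<in> H" using r(1) Y y(1) by (auto simp: partition_on_def)
        have "\<nu> -` {\<nu> y} \<inter> H \<in> pull \<nu> H ((\<lambda>a. {a}) ` A)" using A yH by (auto simp: pull_def)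
        then obtain Z where Z: "Z \<in> \<pi>" "\<nu> -` {\<nu> y} \<inter> H \<subseteq> Z" using r(2) by blast
        have "y \<in> Z" "h \<in> Z" using Z yH h y by auto
        moreover have "Z = Y" using partition_onD2[OF r(1)] Z(1) Y \<open>y \<in> Z\<close> y(1)
          by (auto simp: disjoint_def)
        ultimately show "h \<in> Y" by simp
      qed
    qed
    let ?Q = "(`) \<nu> ` \<pi>"
    have "partition_on A ?Q"
    proof (rule partition_onI)
      show "\<Union> ?Q = A" using partition_onD1[OF r(1)] A by blast
      show "{} \<notin> ?Q" using partition_onD3[OF r(1)] by auto
      show "disjnt p q" if pq: "p \<in> ?Q" "q \<in> ?Q" "p \<noteq> q" for p q
      proof -
        obtain Y where Y: "Y \<in> \<pi>" "p = \<nu> ` Y" using pq(1) by blast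
        obtain Z where Z: "Z \<in> \<pi>" "q = \<nu> ` Z" using pq(2) by blast
        have "Y \<inter> Z = {}" using pq(3) Y Z partition_onD2[OF r(1)] by (auto simp: disjoint_def)
        then show ?thesis using sat[OF Y(1)] sat[OF Z(1)] Y(2) Z(2) unfolding disjnt_def by blast
      qed
    qed
    moreover have "pull \<nu> H ?Q = \<pi>"
      using sat unfolding pull_def image_image by simp
    ultimately show "\<pi> \<in> pull \<nu> H ` {Q. partition_on A Q}"
      by (metis (mono_tags, lifting) image_eqI mem_Collect_eq)
  qed
qed

text \<open>This is \<open>partition_weight\<close> with the blocks of \<open>\<rho>\<close> as
  elements: for \<open>\<rho>\<close> refining \<open>\<pi>\<close> it counts the C-permutations of
  the set \<open>\<rho>\<close> whose cycles unite its blocks to those of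
  \<open>\<pi>\<close>.\<close>

definition refinement_weight :: "'h set set \<Rightarrow> 'h set set \<Rightarrow> nat" where
  "refinement_weight \<rho> \<pi> = (\<Prod>b\<in>\<pi>. block_weight (card {c \<in> \<rho>. c \<subseteq> b}))"

lemma refinement_weight_pull:
  assumes A: "\<nu> ` H = A" and Q: "partition_on A Q"
  shows "refinement_weight (pull \<nu> H ((\<lambda>a. {a}) ` A)) (pull \<nu> H Q) = partition_weight Q"
proof -
  have QA: "Q \<subseteq> Pow A" using Q by (auto simp: partition_on_def)
  have inj: "inj_on (\<lambda>b. \<nu> -` b \<inter> H) Q" using inj_on_subset[OF inj_on_preimage[OF A] QA] .
  have c: "card {c \<in> pull \<nu> H ((\<lambda>a. {a}) ` A). c \<subseteq> \<nu> -` b \<inter> H} = card b" if b: "b \<in> Q" for b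
  proof -
    have bA: "b \<subseteq> A" using QA b by blast
    have "{c \<in> pull \<nu> H ((\<lambda>a. {a}) ` A). c \<subseteq> \<nu> -` b \<inter> H} = (\<lambda>a. \<nu> -` {a} \<inter> H) ` b"
    proof (intro subset_antisym subsetI)
      fix c assume c: "c \<in> {c \<in> pull \<nu> H ((\<lambda>a. {a}) ` A). c \<subseteq> \<nu> -` b \<inter> H}"
      then obtain a where a: "a \<in> A" "c = \<nu> -` {a} \<inter> H" unfolding pull_def by blast
      then obtain h where "h \<in> H" "\<nu> h = a" using A by blast
      then have "a \<in> b" using a c by blast
      then show "c \<in> (\<lambda>a. \<nu> -` {a} \<inter> H) ` b" using a by blast
    next
      fix c assume "c \<in> (\<lambda>a. \<nu> -` {a} \<inter> H) ` b"
      then obtain a where a: "a \<in> b" "c = \<nu> -` {a} \<inter> H" by blast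
      then have "c \<in> pull \<nu> H ((\<lambda>a. {a}) ` A)" using bA by (auto simp: pull_def)
      then show "c \<in> {c \<in> pull \<nu> H ((\<lambda>a. {a}) ` A). c \<subseteq> \<nu> -` b \<inter> H}" using a by blast
    qed
    moreover have "inj_on (\<lambda>a. \<nu> -` {a} \<inter> H) b"
    proof (rule inj_onI)
      fix x y assume "x \<in> b" and e: "\<nu> -` {x} \<inter> H = \<nu> -` {y} \<inter> H"
      then obtain h where "h \<in> H" "\<nu> h = x" using A bA by blast
      then show "x = y" using e by blast
    qed
    ultimately show ?thesis by (simp add: card_image)
  qed
  show ?thesis
    unfolding refinement_weight_def partition_weight_def pull_def[of \<nu> H Q] prod.reindex[OF inj] comp_def
    using c by (intro prod.cong) auto
qed

text \<open>The unrefined count is applied to the set \<open>\<sigma>\<close> itself. The map that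
  sends a point to its block has \<open>\<sigma>\<close> as its partition into fibres.\<close>

lemma sum_odd_refinement_weight:
  assumes B: "finite B" "B \<noteq> {}" and \<sigma>: "partition_on B \<sigma>"
  shows "(\<Sum>S | refines B \<sigma> S \<and> odd (card S). refinement_weight \<sigma> S) = card \<sigma> * block_weight (card \<sigma>)"
proof -
  define \<nu> where "\<nu> x = (THE c. c \<in> \<sigma> \<and> x \<in> c)" for x
  have \<nu>: "\<nu> x = c" if "c \<in> \<sigma>" "x \<in> c" for x c
    unfolding \<nu>_def using that partition_onD2[OF \<sigma>] by (intro the_equality) (auto simp: disjoint_def)
  have U: "\<Union>\<sigma> = B" using partition_onD1[OF \<sigma>] by simp
  have img: "\<nu> ` B = \<sigma>"
  proof
    show "\<nu> ` B \<subseteq> \<sigma>" using U \<nu> by auto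
    show "\<sigma> \<subseteq> \<nu> ` B"
    proof
      fix c assume c: "c \<in> \<sigma>"
      then obtain x where "x \<in> c" using partition_onD3[OF \<sigma>] by (metis ex_in_conv)
      then show "c \<in> \<nu> ` B" using \<nu>[OF c] U c by (metis UnionI imageI)
    qed
  qed
  have "\<nu> -` {c} \<inter> B = c" if "c \<in> \<sigma>" for c
    using \<nu> that U by auto
  then have fib: "pull \<nu> B ((\<lambda>a. {a}) ` \<sigma>) = \<sigma>" unfolding pull_def image_image by simp
  have ne: "\<sigma> \<noteq> {}" using U B(2) by blast
  have "bij_betw (pull \<nu> B) {Q. partition_on \<sigma> Q \<and> odd (card Q)} {S. refines B \<sigma> S \<and> odd (card S)}"
  proof -
    have b: "bij_betw (pull \<nu> B) {Q. partition_on \<sigma> Q} {S. refines B \<sigma> S}"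
      using pull_bij[OF img] fib by simp
    have "pull \<nu> B ` {Q. partition_on \<sigma> Q \<and> odd (card Q)} = {S. refines B \<sigma> S \<and> odd (card S)}"
    proof (intro subset_antisym subsetI)
      fix S assume "S \<in> pull \<nu> B ` {Q. partition_on \<sigma> Q \<and> odd (card Q)}"
      then obtain Q where Q: "partition_on \<sigma> Q" "odd (card Q)" "S = pull \<nu> B Q" by blast
      then show "S \<in> {S. refines B \<sigma> S \<and> odd (card S)}"
        using bij_betwE[OF b] card_pull[OF img Q(1)] by simp
    next
      fix S assume S: "S \<in> {S. refines B \<sigma> S \<and> odd (card S)}"
      then have "S \<in> pull \<nu> B ` {Q. partition_on \<sigma> Q}" using b by (simp add: bij_betw_def)
      then obtain Q where Q: "partition_on \<sigma> Q" "S = pull \<nu> B Q" by blast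
      then have "odd (card Q)" using S card_pull[OF img Q(1)] by simp
      then show "S \<in> pull \<nu> B ` {Q. partition_on \<sigma> Q \<and> odd (card Q)}" using Q by blast
    qed
    moreover have "inj_on (pull \<nu> B) {Q. partition_on \<sigma> Q \<and> odd (card Q)}"
      by (rule inj_on_subset[OF bij_betw_imp_inj_on[OF b]]) blast
    ultimately show ?thesis by (simp add: bij_betw_def)
  qed
  then have "(\<Sum>S | refines B \<sigma> S \<and> odd (card S). refinement_weight \<sigma> S) =
      (\<Sum>Q | partition_on \<sigma> Q \<and> odd (card Q). refinement_weight \<sigma> (pull \<nu> B Q))"
    by (rule sum.reindex_bij_betw[symmetric])
  also have "\<dots> = (\<Sum>Q | partition_on \<sigma> Q \<and> odd (card Q). partition_weight Q)"
    using refinement_weight_pull[OF img] fib by (intro sum.cong) auto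
  also have "\<dots> = card \<sigma> * block_weight (card \<sigma>)"
    by (rule sum_odd_partition_weight[OF finite_elements[OF B(1) \<sigma>] ne])
  finally show ?thesis .
qed

section \<open>The recurrence for decorated trees\<close>

lemma partition_on_replace_block:
  assumes \<pi>: "partition_on H \<pi>" and B: "B \<in> \<pi>" and S: "partition_on B S"
  shows "partition_on H (\<pi> - {B} \<union> S)" "(\<pi> - {B}) \<inter> S = {}"
proof -
  note r = partition_on_remove_block[OF \<pi> B]
  have U: "\<Union>S = B" "\<Union>(\<pi> - {B}) = H - B" using partition_onD1[OF S] partition_onD1[OF r(1)] by auto
  show "(\<pi> - {B}) \<inter> S = {}"
  proof (rule equals0I)
    fix X assume X: "X \<in> (\<pi> - {B}) \<inter> S"
    then have "X \<subseteq> B \<inter> (H - B)" using U by blast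
    then have "X = {}" by blast
    then show False using partition_onD3[OF S] X by blast
  qed
  show "partition_on H (\<pi> - {B} \<union> S)"
  proof (rule partition_onI)
    show "\<Union> (\<pi> - {B} \<union> S) = H" unfolding Union_Un_distrib U using r(2) by blast
    show "{} \<notin> \<pi> - {B} \<union> S" using partition_onD3[OF S] partition_onD3[OF \<pi>] by blast
    have dj: "disjnt p q" if "p \<in> \<pi> - {B}" "q \<in> S" for p q
    proof -
      have "p \<subseteq> H - B" "q \<subseteq> B" using that U by blast+
      then show ?thesis unfolding disjnt_def by blast
    qed
    show "disjnt p q" if pq: "p \<in> \<pi> - {B} \<union> S" "q \<in> \<pi> - {B} \<union> S" "p \<noteq> q" for p q
    proof -
      consider "p \<in> \<pi> - {B}" "q \<in> \<pi> - {B}" | "p \<in> S" "q \<in> S" | "p \<in> \<pi> - {B}" "q \<in> S" | "p \<in> S" "q \<in> \<pi> - {B}"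
        using pq by blast
      then show ?thesis
      proof cases
        case 1 then show ?thesis using partition_onD2[OF \<pi>] pq(3) by (simp add: disjoint_def disjnt_def)
      next
        case 2 then show ?thesis using partition_onD2[OF S] pq(3) by (simp add: disjoint_def disjnt_def)
      next
        case 3 then show ?thesis by (rule dj)
      next
        case 4 then show ?thesis using dj disjnt_sym by blast
      qed
    qed
  qed
qed

lemma refines_block_partition:
  assumes r: "refines H \<rho> \<pi>" and B: "B \<in> \<pi>"
  shows "partition_on B {c \<in> \<rho>. c \<subseteq> B}"
proof (rule partition_onI)
  have \<rho>: "partition_on H \<rho>" and \<pi>: "partition_on H \<pi>" and s: "\<And>X. X \<in> \<rho> \<Longrightarrow> \<exists>Y\<in>\<pi>. X \<subseteq> Y"
    using r by (auto simp: refines_def)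
  show "\<Union> {c \<in> \<rho>. c \<subseteq> B} = B"
  proof
    show "B \<subseteq> \<Union> {c \<in> \<rho>. c \<subseteq> B}"
    proof
      fix x assume x: "x \<in> B"
      then have "x \<in> H" using \<pi> B by (auto simp: partition_on_def)
      then obtain c where c: "c \<in> \<rho>" "x \<in> c" using \<rho> by (auto simp: partition_on_def)
      then obtain Y where Y: "Y \<in> \<pi>" "c \<subseteq> Y" using s by blast
      then have "x \<in> Y \<inter> B" using c x by blast
      then have "Y = B" using partition_onD2[OF \<pi>] Y(1) B unfolding disjoint_def by blast
      then show "x \<in> \<Union> {c \<in> \<rho>. c \<subseteq> B}" using c Y by blast
    qed
  qed blast
  show "{} \<notin> {c \<in> \<rho>. c \<subseteq> B}" using partition_onD3[OF \<rho>] by blast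
  show "disjnt p q" if "p \<in> {c \<in> \<rho>. c \<subseteq> B}" "q \<in> {c \<in> \<rho>. c \<subseteq> B}" "p \<noteq> q" for p q
    using that partition_onD2[OF \<rho>] by (simp add: disjoint_def disjnt_def)
qed

text \<open>Splitting \<open>B\<close> leaves the other blocks alone, so the only new requirement
  concerns the parts of \<open>\<rho>\<close> inside \<open>B\<close>.\<close>

lemma refines_replace_block:
  assumes \<pi>: "partition_on H \<pi>" and B: "B \<in> \<pi>" and S: "partition_on B S"
  shows "refines H \<rho> (\<pi> - {B} \<union> S) \<longleftrightarrow> refines H \<rho> \<pi> \<and> refines B {c \<in> \<rho>. c \<subseteq> B} S"
proof
  have SB: "X \<subseteq> B" if "X \<in> S" for X using S that by (auto simp: partition_on_def)
  note p = partition_on_replace_block[OF \<pi> B S]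
  {
    assume r: "refines H \<rho> (\<pi> - {B} \<union> S)"
    then have \<rho>: "partition_on H \<rho>" and s: "\<And>X. X \<in> \<rho> \<Longrightarrow> \<exists>Y\<in>\<pi> - {B} \<union> S. X \<subseteq> Y"
      by (auto simp: refines_def)
    have "\<exists>Y\<in>\<pi>. X \<subseteq> Y" if X: "X \<in> \<rho>" for X
    proof -
      obtain Y where Y: "Y \<in> \<pi> - {B} \<union> S" "X \<subseteq> Y" using s[OF X] by blast
      then show ?thesis using SB[of Y] B by blast
    qed
    then have 1: "refines H \<rho> \<pi>" using \<rho> \<pi> by (simp add: refines_def)
    have "\<exists>Y\<in>S. X \<subseteq> Y" if X: "X \<in> {c \<in> \<rho>. c \<subseteq> B}" for X
    proof -
      have X': "X \<in> \<rho>" "X \<subseteq> B" using X by simp_all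
      obtain Y where Y: "Y \<in> \<pi> - {B} \<union> S" "X \<subseteq> Y" using s[OF X'(1)] by blast
      have "X \<noteq> {}" using partition_onD3[OF \<rho>] X' by blast
      then obtain x where "x \<in> X" by blast
      then have "x \<in> Y \<inter> B" using X' Y by blast
      moreover have "Y \<inter> B = {}" if "Y \<in> \<pi> - {B}" using partition_onD2[OF \<pi>] that B
        by (simp add: disjoint_def)
      ultimately have "Y \<in> S" using Y(1) by blast
      then show ?thesis using Y(2) by blast
    qed
    then show "refines H \<rho> \<pi> \<and> refines B {c \<in> \<rho>. c \<subseteq> B} S"
      using 1 refines_block_partition[OF 1 B] S by (simp add: refines_def)
  }
  assume r: "refines H \<rho> \<pi> \<and> refines B {c \<in> \<rho>. c \<subseteq> B} S"
  have "\<exists>Y\<in>\<pi> - {B} \<union> S. X \<subseteq> Y" if X: "X \<in> \<rho>" for X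
  proof -
    obtain Y where Y: "Y \<in> \<pi>" "X \<subseteq> Y" using r X by (auto simp: refines_def)
    show ?thesis
    proof (cases "Y = B")
      case True
      then have "X \<in> {c \<in> \<rho>. c \<subseteq> B}" using X Y by simp
      then obtain Z where "Z \<in> S" "X \<subseteq> Z" using r unfolding refines_def by blast
      then show ?thesis by blast
    next
      case False
      then show ?thesis using Y by blast
    qed
  qed
  then show "refines H \<rho> (\<pi> - {B} \<union> S)" using r p(1) by (simp add: refines_def)
qed

lemma sum_card_blocks:
  assumes "finite H" "refines H \<rho> \<pi>"
  shows "(\<Sum>B\<in>\<pi>. card {c \<in> \<rho>. c \<subseteq> B}) = card \<rho>"
proof -
  have \<rho>: "partition_on H \<rho>" and \<pi>: "partition_on H \<pi>" and s: "\<And>X. X \<in> \<rho> \<Longrightarrow> \<exists>Y\<in>\<pi>. X \<subseteq> Y"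
    using assms(2) by (auto simp: refines_def)
  have f: "finite \<rho>" "finite \<pi>" using finite_elements assms(1) \<rho> \<pi> by blast+
  have "\<rho> = (\<Union>B\<in>\<pi>. {c \<in> \<rho>. c \<subseteq> B})" using s by blast
  then have "card \<rho> = card (\<Union>B\<in>\<pi>. {c \<in> \<rho>. c \<subseteq> B})" by simp
  also have "\<dots> = (\<Sum>B\<in>\<pi>. card {c \<in> \<rho>. c \<subseteq> B})"
  proof (rule card_UN_disjoint)
    show "\<forall>B\<in>\<pi>. \<forall>C\<in>\<pi>. B \<noteq> C \<longrightarrow> {c \<in> \<rho>. c \<subseteq> B} \<inter> {c \<in> \<rho>. c \<subseteq> C} = {}"
    proof (intro ballI impI equals0I)
      fix B C X assume "B \<in> \<pi>" "C \<in> \<pi>" "B \<noteq> C" and X: "X \<in> {c \<in> \<rho>. c \<subseteq> B} \<inter> {c \<in> \<rho>. c \<subseteq> C}"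
      then have "B \<inter> C = {}" using partition_onD2[OF \<pi>] by (simp add: disjoint_def)
      then have "X = {}" using X by blast
      then show False using partition_onD3[OF \<rho>] X by blast
    qed
  qed (use f in auto)
  finally show ?thesis by simp
qed

lemma card_replace_block:
  assumes "finite H" and \<pi>: "partition_on H \<pi>" and B: "B \<in> \<pi>" and S: "partition_on B S"
  shows "card (\<pi> - {B} \<union> S) = card \<pi> - 1 + card S"
proof -
  have "finite \<pi>" "finite S"
    using finite_elements assms partition_on_remove_block(2)[OF \<pi> B] finite_subset by blast+
  then show ?thesis using partition_on_replace_block(2)[OF \<pi> B S] B by (simp add: card_Un_disjoint)
qed

lemma card_fixpoint_free_involution:
  assumes "finite H" "\<And>h. h \<in> H \<Longrightarrow> \<alpha> h \<in> H" "\<And>h. h \<in> H \<Longrightarrow> \<alpha> h \<noteq> h" "\<And>h. h \<in> H \<Longrightarrow> \<alpha> (\<alpha> h) = h"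
  shows "card H = 2 * card ((\<lambda>h. {h, \<alpha> h}) ` H)"
proof -
  have "card (\<Union> ((\<lambda>h. {h, \<alpha> h}) ` H)) = (\<Sum>e\<in>(\<lambda>h. {h, \<alpha> h}) ` H. card e)"
  proof (rule card_Union_disjoint)
    show "disjoint ((\<lambda>h. {h, \<alpha> h}) ` H)"
    proof (rule disjointI)
      fix a b assume a: "a \<in> (\<lambda>h. {h, \<alpha> h}) ` H" and b: "b \<in> (\<lambda>h. {h, \<alpha> h}) ` H" and "a \<noteq> b"
      obtain h where h: "h \<in> H" "a = {h, \<alpha> h}" using a by blast
      obtain k where k: "k \<in> H" "b = {k, \<alpha> k}" using b by blast
      have "a = {x, \<alpha> x}" if "x \<in> a" for x using that h(2) assms(4)[OF h(1)] by auto
      moreover have "b = {x, \<alpha> x}" if "x \<in> b" for x using that k(2) assms(4)[OF k(1)] by auto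
      ultimately show "a \<inter> b = {}" using \<open>a \<noteq> b\<close> by (metis disjoint_iff)
    qed
  qed auto
  also have "(\<Sum>e\<in>(\<lambda>h. {h, \<alpha> h}) ` H. card e) = (\<Sum>e\<in>(\<lambda>h. {h, \<alpha> h}) ` H. 2)"
  proof (intro sum.cong refl)
    fix e assume "e \<in> (\<lambda>h. {h, \<alpha> h}) ` H"
    then obtain h where h: "h \<in> H" "e = {h, \<alpha> h}" by blast
    then show "card e = 2" using assms(3)[OF h(1)] by (metis card_2_iff)
  qed
  also have "\<Union> ((\<lambda>h. {h, \<alpha> h}) ` H) = H"
    using assms(2) by auto
  finally show ?thesis by simp
qed

section \<open>Plane trees with merged vertices\<close>

context rooted_involution
begin

text \<open>The tree side of the count: with one face and \<open>n\<close> edges,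
  \<open>n + 1\<close> vertices mean genus 0, so \<open>\<rho>\<close> runs over vertex partitions
  of plane trees. The weight counts the C-permutations that merge the vertices into the blocks of
  \<open>\<pi>\<close>.\<close>

definition num_tree_rotations :: "'a set set \<Rightarrow> nat" where
  "num_tree_rotations \<pi> = (\<Sum>\<rho> | refines H \<rho> \<pi> \<and> card \<rho> = card H div 2 + 1.
     num_rotations \<rho> * refinement_weight \<rho> \<pi>)"

lemma finite_refines: "finite {\<rho>. refines H \<rho> \<pi> \<and> P \<rho>}"
  by (rule finite_subset[OF _ finitely_many_partition_on[OF finite_H]]) (auto simp: refines_def)

lemma finite_odd_partitions: "B \<subseteq> H \<Longrightarrow> finite {S. partition_on B S \<and> odd (card S)}"
  by (rule finite_subset[OF _ finitely_many_partition_on[of B]]) (auto intro: finite_subset[OF _ finite_H])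

text \<open>The sums are exchanged so that the tree partition \<open>\<rho>\<close> is fixed. If
  \<open>B\<close> holds \<open>m\<close> blocks of \<open>\<rho>\<close>, its odd splittings have
  total weight \<open>m * block_weight m\<close>, which is \<open>m\<close> times the factor of
  \<open>B\<close> in the weight of \<open>\<pi>\<close>. Over all \<open>B\<close> the numbers
  \<open>m\<close> sum to \<open>n + 1\<close>.\<close>

lemma num_tree_rotations_recurrence:
  assumes \<pi>: "partition_on H \<pi>"
  shows "(card H div 2 + 1) * num_tree_rotations \<pi> =
    (\<Sum>B\<in>\<pi>. \<Sum>S | partition_on B S \<and> odd (card S). num_tree_rotations (\<pi> - {B} \<union> S))"
proof -
  let ?N = "card H div 2 + 1"
  let ?R = "{\<rho>. refines H \<rho> \<pi> \<and> card \<rho> = ?N}"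
  let ?w = "\<lambda>\<rho> b. block_weight (card {c \<in> \<rho>. c \<subseteq> b})"
  have fin\<pi>: "finite \<pi>" using finite_H \<pi> by (rule finite_elements)
  have BH: "B \<subseteq> H" "finite B" "B \<noteq> {}" if "B \<in> \<pi>" for B
    using \<pi> that finite_H by (auto simp: partition_on_def intro: finite_subset)
  have block: "(\<Sum>S | partition_on B S \<and> odd (card S). num_tree_rotations (\<pi> - {B} \<union> S)) =
      (\<Sum>\<rho>\<in>?R. num_rotations \<rho> * (card {c \<in> \<rho>. c \<subseteq> B} * refinement_weight \<rho> \<pi>))" if B: "B \<in> \<pi>" for B
  proof -
    let ?S = "{S. partition_on B S \<and> odd (card S)}"
    have finS: "finite ?S" by (rule finite_odd_partitions[OF BH(1)[OF B]])
    have "(\<Sum>S\<in>?S. num_tree_rotations (\<pi> - {B} \<union> S)) =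
        (\<Sum>S\<in>?S. \<Sum>\<rho> | \<rho> \<in> ?R \<and> refines B {c \<in> \<rho>. c \<subseteq> B} S.
          num_rotations \<rho> * ((\<Prod>b\<in>\<pi> - {B}. ?w \<rho> b) * refinement_weight {c \<in> \<rho>. c \<subseteq> B} S))"
    proof (rule sum.cong[OF refl])
      fix S assume "S \<in> ?S"
      then have S: "partition_on B S" by simp
      have finS: "finite S" using finite_elements[OF BH(2)[OF B] S] .
      have "{\<rho>. refines H \<rho> (\<pi> - {B} \<union> S) \<and> card \<rho> = ?N} = {\<rho> \<in> ?R. refines B {c \<in> \<rho>. c \<subseteq> B} S}"
        using refines_replace_block[OF \<pi> B S] by blast
      \<comment> \<open>The weight is a product over blocks, and the factors of \<open>S\<close> see
        only the part of \<open>\<rho>\<close> inside \<open>B\<close>.\<close>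
      moreover have "refinement_weight \<rho> (\<pi> - {B} \<union> S) =
          (\<Prod>b\<in>\<pi> - {B}. ?w \<rho> b) * refinement_weight {c \<in> \<rho>. c \<subseteq> B} S" for \<rho>
      proof -
        have "refinement_weight \<rho> (\<pi> - {B} \<union> S) = (\<Prod>b\<in>\<pi> - {B}. ?w \<rho> b) * (\<Prod>b\<in>S. ?w \<rho> b)"
          unfolding refinement_weight_def
          using fin\<pi> finS partition_on_replace_block(2)[OF \<pi> B S] by (intro prod.union_disjoint) auto
        also have "(\<Prod>b\<in>S. ?w \<rho> b) = refinement_weight {c \<in> \<rho>. c \<subseteq> B} S"
          unfolding refinement_weight_def
        proof (rule prod.cong[OF refl])
          fix b assume "b \<in> S"
          then have "b \<subseteq> B" using partition_onD1[OF S] by blast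
          then have "{c \<in> \<rho>. c \<subseteq> b} = {c \<in> {c \<in> \<rho>. c \<subseteq> B}. c \<subseteq> b}" by blast
          then show "?w \<rho> b = ?w {c \<in> \<rho>. c \<subseteq> B} b" by simp
        qed
        finally show ?thesis .
      qed
      ultimately show "num_tree_rotations (\<pi> - {B} \<union> S) =
          (\<Sum>\<rho> | \<rho> \<in> ?R \<and> refines B {c \<in> \<rho>. c \<subseteq> B} S.
            num_rotations \<rho> * ((\<Prod>b\<in>\<pi> - {B}. ?w \<rho> b) * refinement_weight {c \<in> \<rho>. c \<subseteq> B} S))"
        unfolding num_tree_rotations_def by simp
    qed
    also have "\<dots> = (\<Sum>\<rho>\<in>?R. \<Sum>S | S \<in> ?S \<and> refines B {c \<in> \<rho>. c \<subseteq> B} S.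
          num_rotations \<rho> * ((\<Prod>b\<in>\<pi> - {B}. ?w \<rho> b) * refinement_weight {c \<in> \<rho>. c \<subseteq> B} S))"
      by (rule sum.swap_restrict[OF finS finite_refines])
    also have "\<dots> = (\<Sum>\<rho>\<in>?R. num_rotations \<rho> * (card {c \<in> \<rho>. c \<subseteq> B} * refinement_weight \<rho> \<pi>))"
    proof (rule sum.cong[OF refl])
      fix \<rho> assume "\<rho> \<in> ?R"
      then have r: "refines H \<rho> \<pi>" by simp
      let ?\<sigma> = "{c \<in> \<rho>. c \<subseteq> B}"
      have \<sigma>: "partition_on B ?\<sigma>" by (rule refines_block_partition[OF r B])
      have e: "{S. S \<in> ?S \<and> refines B ?\<sigma> S} = {S. refines B ?\<sigma> S \<and> odd (card S)}"
        by (auto simp: refines_def)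
      have "(\<Sum>S | S \<in> ?S \<and> refines B ?\<sigma> S. num_rotations \<rho> * ((\<Prod>b\<in>\<pi> - {B}. ?w \<rho> b) * refinement_weight ?\<sigma> S))
          = num_rotations \<rho> * ((\<Prod>b\<in>\<pi> - {B}. ?w \<rho> b) * (\<Sum>S | refines B ?\<sigma> S \<and> odd (card S). refinement_weight ?\<sigma> S))"
        unfolding e by (simp add: sum_distrib_left)
      also have "\<dots> = num_rotations \<rho> * ((\<Prod>b\<in>\<pi> - {B}. ?w \<rho> b) * (card ?\<sigma> * ?w \<rho> B))"
        using sum_odd_refinement_weight[OF BH(2,3)[OF B] \<sigma>] by simp
      \<comment> \<open>The factor \<open>?w \<rho> B\<close> completes the product to the weight of
        the unsplit partition.\<close>
      also have "(\<Prod>b\<in>\<pi> - {B}. ?w \<rho> b) * (card ?\<sigma> * ?w \<rho> B) = card ?\<sigma> * refinement_weight \<rho> \<pi>"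
        unfolding refinement_weight_def using prod.remove[OF fin\<pi> B, of "?w \<rho>"] by simp
      finally show "(\<Sum>S | S \<in> ?S \<and> refines B ?\<sigma> S. num_rotations \<rho> * ((\<Prod>b\<in>\<pi> - {B}. ?w \<rho> b) * refinement_weight ?\<sigma> S))
          = num_rotations \<rho> * (card ?\<sigma> * refinement_weight \<rho> \<pi>)" .
    qed
    finally show ?thesis .
  qed
  have "(\<Sum>B\<in>\<pi>. \<Sum>S | partition_on B S \<and> odd (card S). num_tree_rotations (\<pi> - {B} \<union> S)) =
      (\<Sum>B\<in>\<pi>. \<Sum>\<rho>\<in>?R. num_rotations \<rho> * (card {c \<in> \<rho>. c \<subseteq> B} * refinement_weight \<rho> \<pi>))"
    using block by (rule sum.cong[OF refl])
  also have "\<dots> = (\<Sum>\<rho>\<in>?R. \<Sum>B\<in>\<pi>. num_rotations \<rho> * (card {c \<in> \<rho>. c \<subseteq> B} * refinement_weight \<rho> \<pi>))"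
    by (rule sum.swap)
  also have "\<dots> = (\<Sum>\<rho>\<in>?R. ?N * (num_rotations \<rho> * refinement_weight \<rho> \<pi>))"
  proof (rule sum.cong[OF refl])
    fix \<rho> assume "\<rho> \<in> ?R"
    then have "(\<Sum>B\<in>\<pi>. card {c \<in> \<rho>. c \<subseteq> B}) = ?N" using sum_card_blocks[OF finite_H] by simp
    then show "(\<Sum>B\<in>\<pi>. num_rotations \<rho> * (card {c \<in> \<rho>. c \<subseteq> B} * refinement_weight \<rho> \<pi>)) =
        ?N * (num_rotations \<rho> * refinement_weight \<rho> \<pi>)"
      unfolding sum_distrib_left[symmetric] sum_distrib_right[symmetric] by (simp add: algebra_simps)
  qed
  also have "\<dots> = ?N * num_tree_rotations \<pi>"
    unfolding num_tree_rotations_def sum_distrib_left[symmetric] ..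
  finally show ?thesis by simp
qed

lemma even_card_H: "even (card H)"
  using card_fixpoint_free_involution[of H \<alpha>] finite_H alpha_neq alpha_alpha
  by (simp add: permutes_in_image[OF alpha_permutes])

lemma num_rotations_recurrence_half:
  assumes "partition_on H \<pi>"
  shows "(card H div 2 + 1) * num_rotations \<pi> =
    (\<Sum>B\<in>\<pi>. \<Sum>S | partition_on B S \<and> odd (card S). num_rotations (\<pi> - {B} \<union> S))"
proof -
  have "card H + 2 = 2 * (card H div 2 + 1)" using even_card_H by simp
  then show ?thesis using num_rotations_recurrence[OF assms]
    by (simp add: mult.assoc del: mult_Suc_right)
qed

text \<open>The summands with \<open>S = {B}\<close> contribute \<open>card \<pi>\<close> copies of the left-hand side.\<close>

lemma recurrence_split:
  assumes \<pi>: "partition_on H \<pi>"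
    and rec: "(card H div 2 + 1) * f \<pi> = (\<Sum>B\<in>\<pi>. \<Sum>S | partition_on B S \<and> odd (card S). f (\<pi> - {B} \<union> S) :: nat)"
  shows "(card H div 2 + 1) * f \<pi> =
    card \<pi> * f \<pi> + (\<Sum>B\<in>\<pi>. \<Sum>S | partition_on B S \<and> odd (card S) \<and> card S \<noteq> 1. f (\<pi> - {B} \<union> S))"
proof -
  have "(\<Sum>S | partition_on B S \<and> odd (card S). f (\<pi> - {B} \<union> S)) =
      f \<pi> + (\<Sum>S | partition_on B S \<and> odd (card S) \<and> card S \<noteq> 1. f (\<pi> - {B} \<union> S))" if B: "B \<in> \<pi>" for B
  proof -
    note r = partition_on_remove_block[OF \<pi> B]
    let ?S = "{S. partition_on B S \<and> odd (card S)}"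
    have "{B} \<in> ?S" using partition_on_space[OF r(3)] by simp
    then have "(\<Sum>S\<in>?S. f (\<pi> - {B} \<union> S)) = f (\<pi> - {B} \<union> {B}) + (\<Sum>S\<in>?S - {{B}}. f (\<pi> - {B} \<union> S))"
      by (rule sum.remove[OF finite_odd_partitions[OF r(2)]])
    moreover have "?S - {{B}} = {S. partition_on B S \<and> odd (card S) \<and> card S \<noteq> 1}"
    proof -
      have "S = {B}" if S: "partition_on B S" "card S = 1" for S
      proof -
        obtain X where X: "S = {X}" using S(2) by (meson card_1_singletonE)
        then show ?thesis using partition_onD1[OF S(1)] by simp
      qed
      moreover have "card {B} = 1" by simp
      ultimately show ?thesis by blast
    qed
    moreover have "\<pi> - {B} \<union> {B} = \<pi>" using B by blast
    ultimately show ?thesis by simp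
  qed
  then show ?thesis unfolding rec by (simp add: sum.distrib)
qed

text \<open>The trivial splittings alone would already exceed the left-hand side if
  \<open>f \<pi>\<close> were positive.\<close>

lemma recurrence_vanish:
  assumes \<pi>: "partition_on H \<pi>" and big: "card H div 2 + 1 < card \<pi>"
    and rec: "(card H div 2 + 1) * f \<pi> = (\<Sum>B\<in>\<pi>. \<Sum>S | partition_on B S \<and> odd (card S). f (\<pi> - {B} \<union> S) :: nat)"
  shows "f \<pi> = 0"
proof (rule ccontr)
  assume "f \<pi> \<noteq> 0"
  then have "(card H div 2 + 1) * f \<pi> < card \<pi> * f \<pi>" by (intro mult_less_mono1[OF big]) simp
  then show False using recurrence_split[OF \<pi> rec] by linarith
qed

text \<open>Induction on the genus; refinements with more than \<open>card H div 2 + 1\<close> blocks contribute 0 on both sides.\<close>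

theorem num_tree_rotations_eq:
  assumes "partition_on H \<pi>"
  shows "2 ^ (card H div 2 + 1) * num_rotations \<pi> = num_tree_rotations \<pi>"
  using assms
proof (induction "card H div 2 + 1 - card \<pi>" arbitrary: \<pi> rule: less_induct)
  case (less \<pi>)
  let ?N = "card H div 2 + 1"
  note rE = num_rotations_recurrence_half[OF less.prems]
  note rT = num_tree_rotations_recurrence[OF less.prems]
  have fin\<pi>: "finite \<pi>" using finite_H less.prems by (rule finite_elements)
  consider "?N < card \<pi>" | "card \<pi> = ?N" | "card \<pi> < ?N" by linarith
  then show ?case
  proof cases
    case 1
    then show ?thesis using recurrence_vanish[where f = num_rotations, OF less.prems 1 rE]
        recurrence_vanish[where f = num_tree_rotations, OF less.prems 1 rT] by simp
  next
    case 2
    \<comment> \<open>Each block of \<open>\<pi>\<close> holds at least one block of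
      \<open>\<rho>\<close>, and both partitions have \<open>?N\<close> blocks; so each holds
      exactly one, and it fills the block.\<close>
    have "\<rho> = \<pi>" if r: "refines H \<rho> \<pi>" and c: "card \<rho> = ?N" and w: "refinement_weight \<rho> \<pi> \<noteq> 0" for \<rho>
    proof -
      have pos: "1 \<le> card {c \<in> \<rho>. c \<subseteq> b}" if "b \<in> \<pi>" for b
      proof (rule ccontr)
        assume "\<not> 1 \<le> card {c \<in> \<rho>. c \<subseteq> b}"
        then have "card {c \<in> \<rho>. c \<subseteq> b} = 0" by linarith
        then have "block_weight (card {c \<in> \<rho>. c \<subseteq> b}) = 0"
          by (simp only: block_weight_def even_zero simp_thms if_False)
        then show False using w that fin\<pi> by (auto simp: refinement_weight_def)
      qed
      have s: "(\<Sum>b\<in>\<pi>. card {c \<in> \<rho>. c \<subseteq> b}) = (\<Sum>b\<in>\<pi>. 1)"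
        using sum_card_blocks[OF finite_H r] c 2 by simp
      have one: "card {c \<in> \<rho>. c \<subseteq> b} = 1" if b: "b \<in> \<pi>" for b
        using sum_mono_inv[OF s[symmetric], of b] pos b fin\<pi> by simp
      have "\<pi> \<subseteq> \<rho>"
      proof
        fix b assume b: "b \<in> \<pi>"
        obtain c where c: "{c \<in> \<rho>. c \<subseteq> b} = {c}" using one[OF b] by (meson card_1_singletonE)
        have "b = c" using partition_onD1[OF refines_block_partition[OF r b]] unfolding c by simp
        then show "b \<in> \<rho>" using c by blast
      qed
      moreover have "finite \<rho>" using finite_elements[OF finite_H] r by (simp add: refines_def)
      ultimately show ?thesis using c 2 by (metis card_subset_eq)
    qed
    then have "num_tree_rotations \<pi> = (\<Sum>\<rho> | \<rho> = \<pi>. num_rotations \<rho> * refinement_weight \<rho> \<pi>)"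
      unfolding num_tree_rotations_def
      using 2 refines_refl[OF less.prems] finite_refines[of \<pi> "\<lambda>\<rho>. card \<rho> = ?N"]
      by (intro sum.mono_neutral_right) auto
    \<comment> \<open>Every vertex is a fixed point with a free sign, as
      \<open>block_weight 1 = 2\<close>. This is the origin of the power of two.\<close>
    moreover have "refinement_weight \<pi> \<pi> = 2 ^ ?N"
    proof -
      have "card {c \<in> \<pi>. c \<subseteq> b} = 1" if b: "b \<in> \<pi>" for b
      proof -
        have "c = b" if "c \<in> \<pi>" "c \<subseteq> b" for c
        proof (rule ccontr)
          assume "c \<noteq> b"
          then have "c \<inter> b = {}" using partition_onD2[OF less.prems] that b by (simp add: disjoint_def)
          then show False using that partition_onD3[OF less.prems] by (metis Int_absorb2)
        qed
        then have "{c \<in> \<pi>. c \<subseteq> b} = {b}" using b by blast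
        then show ?thesis by simp
      qed
      then show ?thesis unfolding refinement_weight_def 2[symmetric] by (simp add: block_weight_def)
    qed
    ultimately show ?thesis by simp
  next
    case 3
    have "(\<Sum>B\<in>\<pi>. \<Sum>S | partition_on B S \<and> odd (card S) \<and> card S \<noteq> 1. num_tree_rotations (\<pi> - {B} \<union> S)) =
        (\<Sum>B\<in>\<pi>. \<Sum>S | partition_on B S \<and> odd (card S) \<and> card S \<noteq> 1. 2 ^ ?N * num_rotations (\<pi> - {B} \<union> S))"
    proof (intro sum.cong refl)
      fix B S assume B: "B \<in> \<pi>" and "S \<in> {S. partition_on B S \<and> odd (card S) \<and> card S \<noteq> 1}"
      then have S: "partition_on B S" "odd (card S)" "card S \<noteq> 1" by simp_all
      have "1 \<le> card \<pi>" using B fin\<pi> by (metis One_nat_def Suc_leI card_gt_0_iff empty_iff)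
      \<comment> \<open>An odd number other than 1 is at least 3, so the new partition has more
        blocks and is covered by the induction hypothesis.\<close>
      moreover have "2 < card S" using S(2,3) by presburger
      ultimately have "card \<pi> < card (\<pi> - {B} \<union> S)"
        using card_replace_block[OF finite_H less.prems B S(1)] by simp
      then have "?N - card (\<pi> - {B} \<union> S) < ?N - card \<pi>" using 3 by linarith
      then show "num_tree_rotations (\<pi> - {B} \<union> S) = 2 ^ ?N * num_rotations (\<pi> - {B} \<union> S)"
        using less.hyps[of "\<pi> - {B} \<union> S"] partition_on_replace_block(1)[OF less.prems B S(1)] by simp
    qed
    then have "?N * num_tree_rotations \<pi> = card \<pi> * num_tree_rotations \<pi> + 2 ^ ?N *
        (\<Sum>B\<in>\<pi>. \<Sum>S | partition_on B S \<and> odd (card S) \<and> card S \<noteq> 1. num_rotations (\<pi> - {B} \<union> S))"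
      using recurrence_split[where f = num_tree_rotations, OF less.prems rT]
      by (simp only: sum_distrib_left)
    moreover
    have "2 ^ ?N * (?N * num_rotations \<pi>) = 2 ^ ?N * (card \<pi> * num_rotations \<pi>) + 2 ^ ?N *
        (\<Sum>B\<in>\<pi>. \<Sum>S | partition_on B S \<and> odd (card S) \<and> card S \<noteq> 1. num_rotations (\<pi> - {B} \<union> S))"
      using arg_cong[OF recurrence_split[where f = num_rotations, OF less.prems rE], of "\<lambda>x. 2 ^ ?N * x"]
      by (simp only: distrib_left)
    then have "?N * (2 ^ ?N * num_rotations \<pi>) = card \<pi> * (2 ^ ?N * num_rotations \<pi>) + 2 ^ ?N *
        (\<Sum>B\<in>\<pi>. \<Sum>S | partition_on B S \<and> odd (card S) \<and> card S \<noteq> 1. num_rotations (\<pi> - {B} \<union> S))"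
      by (simp only: mult.left_commute)
    \<comment> \<open>Both counts satisfy the same equation; moving the trivial splittings to the
      left leaves a coefficient that is positive in this case.\<close>
    ultimately have "(?N - card \<pi>) * num_tree_rotations \<pi> = (?N - card \<pi>) * (2 ^ ?N * num_rotations \<pi>)"
      by (simp only: diff_mult_distrib diff_add_inverse)
    then show ?thesis using 3 by simp
  qed
qed

end

section \<open>Counting C-permutations\<close>

lemma cycle_list_cycle_of_list: "distinct xs \<Longrightarrow> xs \<noteq> [] \<Longrightarrow> cycle_list (cycle_of_list xs) xs"
  using cyclic_rotation[of xs 1] by (simp add: cycle_list_def)

lemma cycle_list_eqI:
  assumes "cycle_list f xs" "cycle_list g xs" "f permutes set xs" "g permutes set xs"
  shows "f = g"
proof
  fix x
  have "map f xs = map g xs" using assms(1,2) by (simp add: cycle_list_def)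
  then show "f x = g x" using assms(3,4) by (cases "x \<in> set xs") (auto simp: permutes_def)
qed

text \<open>A cycle through all of \<open>B\<close> is determined by its listing that ends at a
  fixed \<open>a\<close>, that is, by an arrangement of the other elements.\<close>

lemma card_cyclic_permutations:
  assumes "finite B" "B \<noteq> {}"
  shows "card {p. p permutes B \<and> cyclic_on p B} = fact (card B - 1)"
proof -
  obtain a where a: "a \<in> B" using assms(2) by blast
  let ?f = "\<lambda>xs. cycle_of_list (xs @ [a])"
  have L: "distinct (xs @ [a])" "set (xs @ [a]) = B" if "xs \<in> permutations_of_set (B - {a})" for xs
    using that a by (auto simp: permutations_of_set_def)
  have c: "cycle_list (?f xs) (xs @ [a])" if "xs \<in> permutations_of_set (B - {a})" for xs
    using L(1)[OF that] by (intro cycle_list_cycle_of_list) auto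
  have "bij_betw ?f (permutations_of_set (B - {a})) {p. p permutes B \<and> cyclic_on p B}"
    unfolding bij_betw_def
  proof
    show "inj_on ?f (permutations_of_set (B - {a}))"
      using c cycle_list_unique by (metis (no_types, lifting) inj_onI)
    show "?f ` permutations_of_set (B - {a}) = {p. p permutes B \<and> cyclic_on p B}"
    proof (intro subset_antisym subsetI)
      fix p assume "p \<in> ?f ` permutations_of_set (B - {a})"
      then obtain xs where xs: "xs \<in> permutations_of_set (B - {a})" "p = ?f xs" by blast
      have "p permutes B" using cycle_permutes[of "xs @ [a]"] L(2)[OF xs(1)] xs(2) by simp
      moreover have "orbit p a = B" using orbit_cycle_list[OF c[OF xs(1)], of a] L(2)[OF xs(1)] xs(2)
        by simp
      ultimately show "p \<in> {p. p permutes B \<and> cyclic_on p B}" using a by (auto simp: cyclic_on_def)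
    next
      fix p assume "p \<in> {p. p permutes B \<and> cyclic_on p B}"
      then have p: "p permutes B" "orbit p a = B" using a by (auto simp: cyclic_on_alldef)
      obtain xs where xs: "cycle_list p (xs @ [a])" using cycle_list_exists[of a p] p(2) a by blast
      have s: "set (xs @ [a]) = B" using orbit_cycle_list[OF xs, of a] p(2) by simp
      have d: "distinct (xs @ [a])" using xs by (simp add: cycle_list_def)
      have "set xs = B - {a}" using s d by auto
      then have m: "xs \<in> permutations_of_set (B - {a})" using d by (simp add: permutations_of_set_def)
      have "p = ?f xs"
        using cycle_list_eqI[OF xs c[OF m]] p(1) cycle_permutes[of "xs @ [a]"] by (simp only: s)
      then show "p \<in> ?f ` permutations_of_set (B - {a})" using m by blast
    qed
  qed
  then have "card {p. p permutes B \<and> cyclic_on p B} = card (permutations_of_set (B - {a}))"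
    using bij_betw_same_card by fastforce
  then show ?thesis using assms(1) a by (simp add: card_permutations_of_set)
qed

text \<open>Restriction to the blocks turns such a permutation into an independent choice of a
  cyclic permutation on each block.\<close>

lemma card_permutations_with_orbits:
  assumes A: "finite A" and Q: "partition_on A Q"
  shows "card {p. p permutes A \<and> orbit p ` A = Q} = (\<Prod>b\<in>Q. fact (card b - 1))"
proof -
  have QA: "b \<subseteq> A" "finite b" "b \<noteq> {}" if "b \<in> Q" for b
    using Q A that by (auto simp: partition_on_def intro: finite_subset)
  define blk where "blk x = (THE b. b \<in> Q \<and> x \<in> b)" for x
  have blk: "blk x = b" if "b \<in> Q" "x \<in> b" for x b
    unfolding blk_def using that partition_onD2[OF Q] by (intro the_equality) (auto simp: disjoint_def)
  have blkA: "blk x \<in> Q" "x \<in> blk x" if x: "x \<in> A" for x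
  proof -
    obtain b where "b \<in> Q" "x \<in> b" using partition_onD1[OF Q] x by blast
    then show "blk x \<in> Q" "x \<in> blk x" using blk by auto
  qed
  let ?C = "\<lambda>b. {p. p permutes b \<and> cyclic_on p b}"
  let ?f = "\<lambda>p. restrict (perm_restrict p) Q"
  have "bij_betw ?f {p. p permutes A \<and> orbit p ` A = Q} (Pi\<^sub>E Q ?C)"
    unfolding bij_betw_def
  proof
    show "inj_on ?f {p. p permutes A \<and> orbit p ` A = Q}"
    proof (rule inj_onI)
      fix p q assume p: "p \<in> {p. p permutes A \<and> orbit p ` A = Q}"
        and q: "q \<in> {p. p permutes A \<and> orbit p ` A = Q}"
        and e: "?f p = ?f q"
      show "p = q"
      proof
        fix x
        show "p x = q x"
        proof (cases "x \<in> A")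
          case True
          then have "perm_restrict p (blk x) = perm_restrict q (blk x)"
            using fun_cong[OF e, of "blk x"] blkA(1)[OF True] by simp
          then have "perm_restrict p (blk x) x = perm_restrict q (blk x) x" by simp
          then show ?thesis using blkA(2)[OF True] by (simp add: perm_restrict_def)
        next
          case False
          then show ?thesis using p q by (simp add: permutes_def)
        qed
      qed
    qed
    show "?f ` {p. p permutes A \<and> orbit p ` A = Q} = Pi\<^sub>E Q ?C"
    proof (intro subset_antisym subsetI)
      fix g assume "g \<in> ?f ` {p. p permutes A \<and> orbit p ` A = Q}"
      then obtain p where p: "p permutes A" "orbit p ` A = Q" "g = ?f p" by blast
      have "perm_restrict p b \<in> ?C b" if b: "b \<in> Q" for b
      proof -
        obtain x where x: "x \<in> A" "b = orbit p x" using p(2) b by blast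
        have c: "cyclic_on p b" using cyclic_on_orbit[OF p(1) A] x by simp
        have "perm_restrict p b permutes b"
        proof (rule bij_imp_permutes)
          have "p ` b \<subseteq> b" using cyclic_on_inI[OF c] by blast
          then have "p ` b = b"
            using QA(2)[OF b] permutes_inj_on[OF p(1), of b] by (simp add: endo_inj_surj)
          then have "bij_betw p b b" using permutes_inj_on[OF p(1), of b] by (simp add: bij_betw_def)
          then show "bij_betw (perm_restrict p b) b b"
            by (rule bij_betw_cong[THEN iffD1, rotated]) (simp add: perm_restrict_def)
        qed (simp add: perm_restrict_def)
        then show ?thesis using c cyclic_on_perm_restrict by blast
      qed
      then show "g \<in> Pi\<^sub>E Q ?C" unfolding p(3) by auto
    next
      fix g assume g: "g \<in> Pi\<^sub>E Q ?C"
      then have gb: "g b permutes b" "cyclic_on (g b) b" if "b \<in> Q" for b using that by auto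
      define p where "p x = (if x \<in> A then g (blk x) x else x)" for x
      have px: "p x = g b x" "p x \<in> b" if "b \<in> Q" "x \<in> b" for x b
      proof -
        have "x \<in> A" using QA(1) that by blast
        then show "p x = g b x" using blk[OF that] by (simp add: p_def)
        then show "p x \<in> b" using permutes_in_image[OF gb(1)[OF that(1)]] that(2) by simp
      qed
      have "p permutes A"
      proof (rule bij_imp_permutes)
        have "inj_on p A"
        proof (rule inj_onI)
          fix x y assume x: "x \<in> A" and y: "y \<in> A" and e: "p x = p y"
          have "p x \<in> blk x" "p y \<in> blk y" using px(2) blkA x y by blast+
          then have b: "blk x = blk y" using blk blkA(1) x y e by metis
          have "g (blk x) x = g (blk x) y" using e px(1)[OF blkA[OF x]] px(1)[OF blkA[OF y]] b by simp
          then show "x = y" using permutes_inj[OF gb(1)[OF blkA(1)[OF x]]] by (simp add: inj_eq)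
        qed
        moreover have "p ` A \<subseteq> A"
        proof
          fix z assume "z \<in> p ` A"
          then obtain x where "x \<in> A" "z = p x" by blast
          then show "z \<in> A" using px(2)[OF blkA, of x] QA(1)[OF blkA(1)] by blast
        qed
        ultimately show "bij_betw p A A" using A by (simp add: bij_betw_def endo_inj_surj)
      qed (simp add: p_def)
      moreover have orb: "orbit p x = blk x" if x: "x \<in> A" for x
      proof -
        have "orbit (g (blk x)) x = orbit p x"
          by (rule orbit_cong0[of _ "blk x"])
            (use blkA[OF x] px permutes_in_image[OF gb(1)[OF blkA(1)[OF x]]] in auto)
        then show ?thesis using orbit_cyclic_eq3[OF gb(2)[OF blkA(1)[OF x]] blkA(2)[OF x]] by simp
      qed
      have "orbit p ` A = Q"
      proof (intro subset_antisym subsetI)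
        fix b assume "b \<in> orbit p ` A"
        then show "b \<in> Q" using orb blkA(1) by auto
      next
        fix b assume b: "b \<in> Q"
        then obtain x where "x \<in> b" using QA(3) by blast
        then have "x \<in> A" "b = orbit p x" using QA(1)[OF b] orb[of x] blk[OF b] by auto
        then show "b \<in> orbit p ` A" by blast
      qed
      moreover have "g = ?f p"
      proof
        fix b
        show "g b = ?f p b"
        proof (cases "b \<in> Q")
          case True
          have "g b x = perm_restrict p b x" for x
            using px(1)[OF True, of x] gb(1)[OF True] by (simp add: perm_restrict_def permutes_def)
          then show ?thesis using True by auto
        next
          case False
          then show ?thesis using g by (auto simp: PiE_def extensional_def)
        qed
      qed
      ultimately show "g \<in> ?f ` {p. p permutes A \<and> orbit p ` A = Q}"
        by (intro image_eqI[of g ?f p]) simp_all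
    qed
  qed
  then have "card {p. p permutes A \<and> orbit p ` A = Q} = card (Pi\<^sub>E Q ?C)" by (rule bij_betw_same_card)
  also have "\<dots> = (\<Prod>b\<in>Q. card (?C b))" by (rule card_PiE[OF finite_elements[OF A Q]])
  also have "\<dots> = (\<Prod>b\<in>Q. fact (card b - 1))"
    by (rule prod.cong[OF refl]) (rule card_cyclic_permutations[OF QA(2,3)])
  finally show ?thesis .
qed

lemma UNIV_sign: "(UNIV :: sign set) = {Positive, Negative}"
  using sign.exhaust by auto

text \<open>The signs contribute a factor 2 per block. A block of even size excludes C-permutations
  and has weight 0.\<close>

lemma card_cperms_with_cycles:
  assumes A: "finite A" and Q: "partition_on A Q"
  shows "card {\<sigma> \<in> cperms A. perm_cycles (fst \<sigma>) A = Q} = partition_weight Q"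
proof -
  have fQ: "finite Q" by (rule finite_elements[OF A Q])
  show ?thesis
  proof (cases "\<forall>c\<in>Q. odd (card c)")
    case True
    have "{\<sigma> \<in> cperms A. perm_cycles (fst \<sigma>) A = Q} = {p. p permutes A \<and> orbit p ` A = Q} \<times> (Q \<rightarrow>\<^sub>E (UNIV :: sign set))"
      using True by (auto simp: cperms_def perm_cycles_def PiE_def extensional_def)
    moreover have "card (Q \<rightarrow>\<^sub>E (UNIV :: sign set)) = 2 ^ card Q"
      using card_PiE[OF fQ, of "\<lambda>_. UNIV :: sign set"] by (simp add: UNIV_sign numeral_2_eq_2)
    ultimately have "card {\<sigma> \<in> cperms A. perm_cycles (fst \<sigma>) A = Q} = (\<Prod>b\<in>Q. fact (card b - 1)) * 2 ^ card Q"
      using card_permutations_with_orbits[OF A Q] by (simp add: card_cartesian_product)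
    also have "\<dots> = (\<Prod>b\<in>Q. fact (card b - 1) * 2)" by (simp add: prod.distrib)
    also have "\<dots> = partition_weight Q"
      unfolding partition_weight_def using True by (intro prod.cong) (auto simp: block_weight_def)
    finally show ?thesis .
  next
    case False
    then have "{\<sigma> \<in> cperms A. perm_cycles (fst \<sigma>) A = Q} = {}" by (auto simp: cperms_def)
    moreover have "partition_weight Q = 0"
      unfolding partition_weight_def using False fQ by (auto simp: block_weight_def)
    ultimately show ?thesis by (simp only: card.empty)
  qed
qed

lemma partition_on_perm_cycles:
  assumes "finite A" "p permutes A"
  shows "partition_on A (perm_cycles p A)"
  unfolding perm_cycles_def
proof (rule partition_onI)
  have self: "x \<in> orbit p x" for x
    using assms permutation_self_in_orbit permutation_permutes by metis
  show "\<Union> (orbit p ` A) = A" using self permutes_orbit_subset[OF assms(2)] by blast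
  show "{} \<notin> orbit p ` A" using orbit_nonempty by (metis imageE)
  show "disjnt b c" if "b \<in> orbit p ` A" "c \<in> orbit p ` A" "b \<noteq> c" for b c
    using that orbit_sym_permutes[OF assms(2,1)] by (metis disjnt_iff imageE)
qed

lemma finite_cperms: "finite A \<Longrightarrow> finite (cperms A)"
proof -
  assume A: "finite A"
  have "cperms A \<subseteq> (\<Union>p\<in>{p. p permutes A}. {p} \<times> (perm_cycles p A \<rightarrow>\<^sub>E UNIV))"
    by (auto simp: cperms_def)
  moreover have "finite (perm_cycles p A \<rightarrow>\<^sub>E (UNIV :: sign set))" for p :: "'a \<Rightarrow> 'a"
    using A by (intro finite_PiE) (auto simp: perm_cycles_def UNIV_sign)
  ultimately show ?thesis
    using A finite_permutations[OF A]
    by (meson finite_SigmaI finite_UN_I finite.emptyI finite.insertI finite_subset)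
qed

text \<open>Removes the truncated subtraction and the halving in \<open>cperm_genus\<close>.\<close>

lemma half_diff_eq_iff:
  fixes a c g :: nat
  assumes "c \<le> a" "even a \<longleftrightarrow> even c"
  shows "(a - c) div 2 = g \<longleftrightarrow> c + 2 * g = a"
  using assms by presburger

text \<open>The predicate \<open>K\<close> sees only the cycle partition; later it prescribes the
  isomorphism type of the merged graph. Since all cycles are odd, their number has the parity of
  \<open>card A\<close>, so the halving in the genus is exact.\<close>

lemma card_cperms_genus:
  assumes A: "finite A"
  shows "card {\<sigma> \<in> cperms A. cperm_genus A \<sigma> = g \<and> K (perm_cycles (fst \<sigma>) A)} =
    (\<Sum>Q | partition_on A Q \<and> card Q + 2 * g = card A \<and> K Q. partition_weight Q)"
proof -
  let ?X = "{\<sigma> \<in> cperms A. cperm_genus A \<sigma> = g \<and> K (perm_cycles (fst \<sigma>) A)}"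
  let ?Y = "{Q. partition_on A Q \<and> card Q + 2 * g = card A \<and> K Q}"
  have par: "partition_on A (perm_cycles (fst \<sigma>) A) \<and>
      (cperm_genus A \<sigma> = g \<longleftrightarrow> card (perm_cycles (fst \<sigma>) A) + 2 * g = card A)" if \<sigma>: "\<sigma> \<in> cperms A" for \<sigma>
  proof -
    let ?Q = "perm_cycles (fst \<sigma>) A"
    have o: "odd (card c)" if "c \<in> ?Q" for c using \<sigma> that by (auto simp: cperms_def)
    have Q: "partition_on A ?Q" using \<sigma> A by (intro partition_on_perm_cycles) (auto simp: cperms_def)
    have fQ: "finite ?Q" by (rule finite_elements[OF A Q])
    have fb: "finite b" if "b \<in> ?Q" for b using Q that A
      by (auto simp: partition_on_def intro: finite_subset)
    have "card A = (\<Sum>b\<in>?Q. card b)" using product_partition[OF Q] fb by blast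
    then have "even (card A) \<longleftrightarrow> even (card {b \<in> ?Q. odd (card b)})" using even_sum_iff[OF fQ, of card]
      by simp
    moreover have "{b \<in> ?Q. odd (card b)} = ?Q" using o by blast
    ultimately have e: "even (card A) \<longleftrightarrow> even (card ?Q)" by simp
    have "card ?Q \<le> card A" unfolding perm_cycles_def by (rule card_image_le[OF A])
    then have "(card A - card ?Q) div 2 = g \<longleftrightarrow> card ?Q + 2 * g = card A"
      using e by (intro half_diff_eq_iff)
    then show ?thesis using Q by (simp add: cperm_genus_def)
  qed
  have finX: "finite ?X" using finite_cperms[OF A] by simp
  have finY: "finite ?Y" by (rule finite_subset[OF _ finitely_many_partition_on[OF A]]) auto
  have "card ?X = (\<Sum>\<sigma>\<in>?X. 1)" by simp
  also have "\<dots> = (\<Sum>Q\<in>?Y. \<Sum>\<sigma> | \<sigma> \<in> ?X \<and> perm_cycles (fst \<sigma>) A = Q. 1)"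
    using par by (intro sum.group[OF finX finY, symmetric]) blast
  also have "\<dots> = (\<Sum>Q\<in>?Y. partition_weight Q)"
  proof (rule sum.cong[OF refl])
    fix Q assume Q: "Q \<in> ?Y"
    then have "{\<sigma>. \<sigma> \<in> ?X \<and> perm_cycles (fst \<sigma>) A = Q} = {\<sigma> \<in> cperms A. perm_cycles (fst \<sigma>) A = Q}"
      using par by blast
    then show "(\<Sum>\<sigma> | \<sigma> \<in> ?X \<and> perm_cycles (fst \<sigma>) A = Q. 1) = partition_weight Q"
      using card_cperms_with_cycles[OF A, of Q] Q by simp
  qed
  finally show ?thesis .
qed

section \<open>Isomorphisms of graphs and maps\<close>

lemma rgraph_iso_refl: "rgraph_iso G G"
  unfolding rgraph_iso_def by (intro exI[of _ id]) auto

text \<open>The vertex bijection can be undone on endpoints only if these are vertices, and the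
  record type does not enforce that.\<close>

lemma rgraph_iso_sym:
  assumes "rgraph_iso G G'" and ends: "\<And>e. e \<in> rg_edges G \<Longrightarrow> rg_ends G e \<subseteq> rg_verts G"
    and r: "rg_root G \<in> rg_verts G"
  shows "rgraph_iso G' G"
proof -
  obtain f k where f: "bij_betw f (rg_verts G) (rg_verts G')"
    and k: "bij_betw k (rg_edges G) (rg_edges G')"
    and e: "\<And>e. e \<in> rg_edges G \<Longrightarrow> rg_ends G' (k e) = f ` rg_ends G e"
    and rt: "rg_root G' = f (rg_root G)"
    using assms(1) unfolding rgraph_iso_def by blast
  let ?f = "inv_into (rg_verts G) f" and ?k = "inv_into (rg_edges G) k"
  have inj: "inj_on f (rg_verts G)" using f by (simp add: bij_betw_def)
  have "rg_ends G (?k d) = ?f ` rg_ends G' d" if d: "d \<in> rg_edges G'" for d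
  proof -
    have c: "?k d \<in> rg_edges G" "k (?k d) = d"
      using d k by (auto simp: bij_betw_def inv_into_into f_inv_into_f)
    have "?f ` rg_ends G' d = ?f ` f ` rg_ends G (?k d)" using e[OF c(1)] c(2) by simp
    also have "\<dots> = rg_ends G (?k d)" using inv_into_image_cancel[OF inj ends[OF c(1)]] .
    finally show ?thesis by simp
  qed
  moreover have "rg_root G = ?f (rg_root G')" using rt r inj by simp
  ultimately show ?thesis
    unfolding rgraph_iso_def using bij_betw_inv_into[OF f] bij_betw_inv_into[OF k] by blast
qed

lemma rgraph_iso_trans:
  assumes "rgraph_iso G G'" "rgraph_iso G' G''"
  shows "rgraph_iso G G''"
proof -
  obtain f k where f: "bij_betw f (rg_verts G) (rg_verts G')"
    and k: "bij_betw k (rg_edges G) (rg_edges G')"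
    and e: "\<And>e. e \<in> rg_edges G \<Longrightarrow> rg_ends G' (k e) = f ` rg_ends G e"
    and rt: "rg_root G' = f (rg_root G)"
    using assms(1) unfolding rgraph_iso_def by blast
  obtain f' k' where f': "bij_betw f' (rg_verts G') (rg_verts G'')"
    and k': "bij_betw k' (rg_edges G') (rg_edges G'')"
    and e': "\<And>e. e \<in> rg_edges G' \<Longrightarrow> rg_ends G'' (k' e) = f' ` rg_ends G' e"
    and rt': "rg_root G'' = f' (rg_root G')"
    using assms(2) unfolding rgraph_iso_def by blast
  have "rg_ends G'' ((k' \<circ> k) d) = (f' \<circ> f) ` rg_ends G d" if d: "d \<in> rg_edges G" for d
    using e[OF d] e'[of "k d"] bij_betwE[OF k] d by (simp add: image_comp)
  then show ?thesis
    unfolding rgraph_iso_def using bij_betw_trans[OF f f'] bij_betw_trans[OF k k'] rt rt'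
      by (metis comp_apply)
qed

section \<open>Isomorphisms of rooted maps\<close>

lemma rooted_mapD:
  assumes "rooted_map M"
  shows "finite (verts M)" "verts M \<noteq> {}" "finite (halfedges M)" "h \<in> halfedges M \<Longrightarrow> vert M h \<in> verts M"
    "opp M permutes halfedges M" "h \<in> halfedges M \<Longrightarrow> opp M h \<noteq> h" "h \<in> halfedges M \<Longrightarrow> opp M (opp M h) = h"
    "rot M permutes halfedges M"
    "h \<in> halfedges M \<Longrightarrow> orbit (rot M) h = {h' \<in> halfedges M. vert M h' = vert M h}"
    "u \<in> verts M \<Longrightarrow> v \<in> verts M \<Longrightarrow> (u, v) \<in> {(vert M h, vert M (opp M h)) |h. h \<in> halfedges M}\<^sup>*"
    "root M \<in> corners M"
    "h \<in> halfedges M \<Longrightarrow> opp M h \<in> halfedges M" "h \<in> halfedges M \<Longrightarrow> rot M h \<in> halfedges M"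
  using assms by (auto simp: rooted_map_def permutes_in_image)

lemma corner_vertex_in: "rooted_map M \<Longrightarrow> c \<in> corners M \<Longrightarrow> corner_vertex M c \<in> verts M"
  by (auto simp: corners_def rooted_mapD)

lemma next_corner_in: "rooted_map M \<Longrightarrow> c \<in> corners M \<Longrightarrow> next_corner M c \<in> corners M"
  by (auto simp: corners_def rooted_mapD)

lemma funpow_next_corner_in: "rooted_map M \<Longrightarrow> (next_corner M ^^ i) (root M) \<in> corners M"
  by (induction i) (auto simp: rooted_mapD next_corner_in)

lemma rmap_iso_refl: "rmap_iso M M"
  unfolding rmap_iso_def by (intro exI[of _ id]) (auto simp: corner.map_id)

lemma rmap_iso_trans:
  assumes "rmap_iso M N" "rmap_iso N P"
  shows "rmap_iso M P"
proof -
  obtain f k where f: "bij_betw f (verts M) (verts N)" and k: "bij_betw k (halfedges M) (halfedges N)"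
    and h: "\<And>h. h \<in> halfedges M \<Longrightarrow> vert N (k h) = f (vert M h) \<and> opp N (k h) = k (opp M h) \<and> rot N (k h) = k (rot M h)"
    and r: "root N = map_corner f k (root M)"
    using assms(1) unfolding rmap_iso_def by blast
  obtain f' k' where f': "bij_betw f' (verts N) (verts P)"
    and k': "bij_betw k' (halfedges N) (halfedges P)"
    and h': "\<And>h. h \<in> halfedges N \<Longrightarrow> vert P (k' h) = f' (vert N h) \<and> opp P (k' h) = k' (opp N h) \<and> rot P (k' h) = k' (rot N h)"
    and r': "root P = map_corner f' k' (root N)"
    using assms(2) unfolding rmap_iso_def by blast
  have "vert P ((k' \<circ> k) x) = (f' \<circ> f) (vert M x) \<and> opp P ((k' \<circ> k) x) = (k' \<circ> k) (opp M x) \<and> rot P ((k' \<circ> k) x) = (k' \<circ> k) (rot M x)"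
    if x: "x \<in> halfedges M" for x
    using h[OF x] h'[of "k x"] bij_betwE[OF k] x by simp
  moreover have "root P = map_corner (f' \<circ> f) (k' \<circ> k) (root M)" using r r'
    by (simp add: corner.map_comp)
  ultimately show ?thesis
    unfolding rmap_iso_def using bij_betw_trans[OF f f'] bij_betw_trans[OF k k'] by blast
qed

lemma rmap_iso_sym:
  assumes M: "rooted_map M" and "rmap_iso M N"
  shows "rmap_iso N M"
proof -
  obtain f k where f: "bij_betw f (verts M) (verts N)" and k: "bij_betw k (halfedges M) (halfedges N)"
    and h: "\<And>h. h \<in> halfedges M \<Longrightarrow> vert N (k h) = f (vert M h) \<and> opp N (k h) = k (opp M h) \<and> rot N (k h) = k (rot M h)"
    and r: "root N = map_corner f k (root M)"
    using assms(2) unfolding rmap_iso_def by blast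
  let ?f = "inv_into (verts M) f" and ?k = "inv_into (halfedges M) k"
  have fi: "?f (f v) = v" if "v \<in> verts M" for v using f that by (simp add: bij_betw_def)
  have ki: "?k (k x) = x" if "x \<in> halfedges M" for x using k that by (simp add: bij_betw_def)
  have "vert M (?k y) = ?f (vert N y) \<and> opp M (?k y) = ?k (opp N y) \<and> rot M (?k y) = ?k (rot N y)"
    if y: "y \<in> halfedges N" for y
  proof -
    obtain x where x: "x \<in> halfedges M" "y = k x" using k y by (auto simp: bij_betw_def)
    show ?thesis using h[OF x(1)] x fi ki rooted_mapD(4,12,13)[OF M x(1)] by simp
  qed
  moreover have "root M = map_corner ?f ?k (root N)"
    using rooted_mapD(11)[OF M] fi ki unfolding r by (auto simp: corners_def)
  ultimately show ?thesis
    unfolding rmap_iso_def using bij_betw_inv_into[OF f] bij_betw_inv_into[OF k] by blast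
qed

lemma rgraph_iso_underlying_graph:
  assumes M: "rooted_map M" and "rmap_iso M N"
  shows "rgraph_iso (underlying_graph M) (underlying_graph N)"
proof -
  obtain f k where f: "bij_betw f (verts M) (verts N)" and k: "bij_betw k (halfedges M) (halfedges N)"
    and h: "\<And>h. h \<in> halfedges M \<Longrightarrow> vert N (k h) = f (vert M h) \<and> opp N (k h) = k (opp M h) \<and> rot N (k h) = k (rot M h)"
    and r: "root N = map_corner f k (root M)"
    using assms(2) unfolding rmap_iso_def by blast
  have sub: "e \<subseteq> halfedges M" if "e \<in> edges M" for e using that rooted_mapD(12)[OF M]
    by (auto simp: edges_def)
  have "edges N = (\<lambda>h. {h, opp N h}) ` k ` halfedges M" using k by (simp add: edges_def bij_betw_def)
  also have "\<dots> = (`) k ` edges M" unfolding edges_def image_image using h by (intro image_cong) auto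
  finally have eN: "edges N = (`) k ` edges M" .
  have "inj_on ((`) k) (edges M)"
    by (rule inj_on_subset[OF inj_on_image_Pow[OF bij_betw_imp_inj_on[OF k]]]) (use sub in blast)
  then have "bij_betw ((`) k) (edges M) (edges N)" unfolding bij_betw_def eN by simp
  moreover have "vert N ` (k ` e) = f ` (vert M ` e)" if e: "e \<in> edges M" for e
    unfolding image_image using sub[OF e] h by (intro image_cong) auto
  moreover have "root_vertex N = f (root_vertex M)"
    using rooted_mapD(11)[OF M] h unfolding root_vertex_def r by (auto simp: corners_def)
  ultimately show ?thesis
    unfolding rgraph_iso_def underlying_graph_def using f by (intro exI[of _ f] exI[of _ "(`) k"]) simp
qed

text \<open>An isomorphism that respects the root corner carries one walk around the face to the
  other, step by step.\<close>

lemma first_visit_iso: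
  assumes M: "rooted_map M" and f: "bij_betw f (verts M) (verts N)"
    and h: "\<And>h. h \<in> halfedges M \<Longrightarrow> vert N (k h) = f (vert M h) \<and> opp N (k h) = k (opp M h) \<and> rot N (k h) = k (rot M h)"
    and r: "root N = map_corner f k (root M)" and v: "v \<in> verts M"
  shows "first_visit N (f v) = first_visit M v"
proof -
  have next_iso: "next_corner N (map_corner f k c) = map_corner f k (next_corner M c)"
    if "c \<in> corners M" for c
  proof (cases c)
    case (Sector x)
    then have "x \<in> halfedges M" using that by (auto simp: corners_def)
    then show ?thesis using Sector h[of x] h[of "opp M x"] rooted_mapD(12)[OF M] by simp
  qed simp
  have it: "(next_corner N ^^ i) (root N) = map_corner f k ((next_corner M ^^ i) (root M))" for i
    by (induction i) (simp_all add: r next_iso[OF funpow_next_corner_in[OF M]])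
  have cv: "corner_vertex N (map_corner f k c) = f (corner_vertex M c)" if "c \<in> corners M" for c
    using that h by (cases c) (auto simp: corners_def)
  have "corner_vertex N ((next_corner N ^^ i) (root N)) = f v \<longleftrightarrow> corner_vertex M ((next_corner M ^^ i) (root M)) = v" for i
    unfolding it cv[OF funpow_next_corner_in[OF M]]
    using f v corner_vertex_in[OF M funpow_next_corner_in[OF M]]
    by (auto simp: bij_betw_def inj_on_eq_iff)
  then show ?thesis unfolding first_visit_def by simp
qed

text \<open>Depth-first numbers are invariant under isomorphism, so the same \<open>\<kappa>\<close>
  merges corresponding vertices, and the merged graphs have literally the same vertices.\<close>

lemma rgraph_iso_decorated_graph:
  assumes M: "rooted_map M" and "rmap_iso M N"
  shows "rgraph_iso (decorated_graph M \<kappa>) (decorated_graph N \<kappa>)"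
proof -
  obtain f k where f: "bij_betw f (verts M) (verts N)" and k: "bij_betw k (halfedges M) (halfedges N)"
    and h: "\<And>h. h \<in> halfedges M \<Longrightarrow> vert N (k h) = f (vert M h) \<and> opp N (k h) = k (opp M h) \<and> rot N (k h) = k (rot M h)"
    and r: "root N = map_corner f k (root M)"
    using assms(2) unfolding rmap_iso_def by blast
  have fv: "first_visit N (f v) = first_visit M v" if "v \<in> verts M" for v
    by (rule first_visit_iso[OF M f h r that])
  have dfs: "dfs_number N (f v) = dfs_number M v" if v: "v \<in> verts M" for v
  proof -
    have "{w \<in> verts N. first_visit N w \<le> first_visit N (f v)} = f ` {w \<in> verts M. first_visit M w \<le> first_visit M v}"
    proof (intro subset_antisym subsetI)
      fix w assume w: "w \<in> {w \<in> verts N. first_visit N w \<le> first_visit N (f v)}"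
      then obtain u where "u \<in> verts M" "w = f u" using f by (auto simp: bij_betw_def)
      then show "w \<in> f ` {w \<in> verts M. first_visit M w \<le> first_visit M v}" using w fv v by auto
    next
      fix w assume "w \<in> f ` {w \<in> verts M. first_visit M w \<le> first_visit M v}"
      then show "w \<in> {w \<in> verts N. first_visit N w \<le> first_visit N (f v)}" using fv v bij_betwE[OF f]
        by auto
    qed
    moreover have "inj_on f {w \<in> verts M. first_visit M w \<le> first_visit M v}"
      using f by (auto simp: bij_betw_def intro: inj_on_subset)
    ultimately show ?thesis unfolding dfs_number_def by (simp add: card_image)
  qed
  have sub: "e \<subseteq> halfedges M" if "e \<in> edges M" for e using that rooted_mapD(12)[OF M]
    by (auto simp: edges_def)
  have "edges N = (\<lambda>h. {h, opp N h}) ` k ` halfedges M" using k by (simp add: edges_def bij_betw_def)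
  also have "\<dots> = (`) k ` edges M" unfolding edges_def image_image using h by (intro image_cong) auto
  finally have eN: "edges N = (`) k ` edges M" .
  have "inj_on ((`) k) (edges M)"
    by (rule inj_on_subset[OF inj_on_image_Pow[OF bij_betw_imp_inj_on[OF k]]]) (use sub in blast)
  then have kk: "bij_betw ((`) k) (edges M) (edges N)" unfolding bij_betw_def eN by simp
  have c: "card (verts N) = card (verts M)" using bij_betw_same_card[OF f] by simp
  have en: "(\<lambda>v. orbit (fst \<kappa>) (dfs_number N v)) ` vert N ` k ` e = (\<lambda>v. orbit (fst \<kappa>) (dfs_number M v)) ` vert M ` e"
    if e: "e \<in> edges M" for e
    unfolding image_image
  proof (rule image_cong[OF refl])
    fix x assume "x \<in> e"
    then have "x \<in> halfedges M" using sub[OF e] by blast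
    then show "orbit (fst \<kappa>) (dfs_number N (vert N (k x))) = orbit (fst \<kappa>) (dfs_number M (vert M x))"
      using h dfs rooted_mapD(4)[OF M] by simp
  qed
  have "root_vertex N = f (root_vertex M)" "root_vertex M \<in> verts M"
    using rooted_mapD(11)[OF M] h rooted_mapD(4)[OF M] unfolding root_vertex_def r
    by (auto simp: corners_def)
  then have rt: "dfs_number N (root_vertex N) = dfs_number M (root_vertex M)" using dfs by simp
  show ?thesis
    unfolding rgraph_iso_def
    by (intro exI[of _ id] exI[of _ "(`) k"]) (use kk c en rt in \<open>auto simp: decorated_graph_def Let_def\<close>)
qed

section \<open>The face walk and the depth-first numbering\<close>

lemma next_corner_permutation:
  assumes M: "rooted_map M"
  shows "permutation (next_corner M)"
proof -
  let ?S = "Sector ` halfedges M :: ('a, 'b) corner set"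
  have p: "rot M \<circ> opp M permutes halfedges M" using rooted_mapD(5,8)[OF M] by (rule permutes_compose)
  have "next_corner M permutes ?S"
  proof (rule bij_imp_permutes)
    have "inj_on (next_corner M) ?S"
    proof (rule inj_onI)
      fix x y assume "x \<in> ?S" "y \<in> ?S" and e: "next_corner M x = next_corner M y"
      then obtain a b where "x = Sector a" "y = Sector b" by blast
      then show "x = y" using e permutes_inj[OF p] by (auto dest!: injD[of "rot M \<circ> opp M" a b])
    qed
    moreover have "next_corner M ` ?S \<subseteq> ?S" using rooted_mapD(12,13)[OF M] by auto
    ultimately show "bij_betw (next_corner M) ?S ?S"
      using rooted_mapD(3)[OF M] by (simp add: bij_betw_def endo_inj_surj)
    fix x assume x: "x \<notin> ?S"
    show "next_corner M x = x"
    proof (cases x)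
      case (Sector a)
      then have "a \<notin> halfedges M" using x by blast
      then show ?thesis using Sector rooted_mapD(5,8)[OF M] by (simp add: permutes_def)
    qed simp
  qed
  then show ?thesis using rooted_mapD(3)[OF M] by (auto simp: permutation_permutes)
qed

text \<open>With one face the orbit of \<open>c\<close> is that of the root, and \<open>c\<close>
  lies in its own orbit.\<close>

lemma unicellular_visits_all:
  assumes M: "rooted_map M" and one: "card (faces M) = 1" and c: "c \<in> corners M"
  shows "\<exists>i. (next_corner M ^^ i) (root M) = c"
proof -
  obtain F where F: "faces M = {F}" using one by (meson card_1_singletonE)
  have "orbit (next_corner M) c = F" "orbit (next_corner M) (root M) = F"
    using F c rooted_mapD(11)[OF M] unfolding faces_def by blast+
  then have "c \<in> orbit (next_corner M) (root M)"
    using permutation_self_in_orbit[OF next_corner_permutation[OF M], of c] by simp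
  then show ?thesis unfolding orbit_altdef by blast
qed

lemma vertex_has_corner:
  assumes "v \<in> verts M"
  shows "\<exists>c \<in> corners M. corner_vertex M c = v"
proof (cases "v \<in> vert M ` halfedges M")
  case True
  then obtain h where "h \<in> halfedges M" "v = vert M h" by blast
  then show ?thesis by (intro bexI[of _ "Sector h"]) (auto simp: corners_def)
next
  case False
  then show ?thesis using assms by (intro bexI[of _ "Around v"]) (auto simp: corners_def)
qed

lemma bij_betw_rank:
  fixes f :: "'a \<Rightarrow> 'b :: linorder"
  assumes V: "finite V" and f: "inj_on f V"
  shows "bij_betw (\<lambda>v. card {w \<in> V. f w \<le> f v}) V {1..card V}"
proof -
  let ?r = "\<lambda>v. card {w \<in> V. f w \<le> f v}"
  have lt: "?r u < ?r v" if "u \<in> V" "v \<in> V" "f u < f v" for u v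
  proof (rule psubset_card_mono)
    have "{w \<in> V. f w \<le> f u} \<subseteq> {w \<in> V. f w \<le> f v}" using that by auto
    moreover have "v \<in> {w \<in> V. f w \<le> f v}" "v \<notin> {w \<in> V. f w \<le> f u}" using that by auto
    ultimately show "{w \<in> V. f w \<le> f u} \<subset> {w \<in> V. f w \<le> f v}" by blast
  qed (use V in simp)
  have inj: "inj_on ?r V"
  proof (rule inj_onI)
    fix u v assume u: "u \<in> V" and v: "v \<in> V" and e: "?r u = ?r v"
    have "\<not> f u < f v" "\<not> f v < f u" using lt[OF u v] lt[OF v u] e by auto
    then show "u = v" using f u v by (meson inj_onD linorder_neqE)
  qed
  have "?r v \<in> {1..card V}" if v: "v \<in> V" for v
  proof -
    have "?r v \<le> card V" using V by (intro card_mono) auto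
    moreover have "0 < ?r v" using V v by (auto simp: card_gt_0_iff)
    ultimately show ?thesis by simp
  qed
  then have "?r ` V = {1..card V}" using inj by (intro card_subset_eq) (auto simp: card_image)
  then show ?thesis using inj by (simp add: bij_betw_def)
qed

text \<open>Every vertex has a corner and is therefore visited, so the minimum in
  \<open>first_visit\<close> is attained. Different vertices then have different first visits, and
  the numbering is their rank.\<close>

lemma dfs_number_bij:
  assumes M: "rooted_map M" and one: "card (faces M) = 1"
  shows "bij_betw (dfs_number M) (verts M) {1..card (verts M)}"
proof -
  have at: "corner_vertex M ((next_corner M ^^ first_visit M v) (root M)) = v" if v: "v \<in> verts M" for v
  proof -
    obtain c where c: "c \<in> corners M" "corner_vertex M c = v" using vertex_has_corner[OF v] by blast
    obtain i where "(next_corner M ^^ i) (root M) = c" using unicellular_visits_all[OF M one c(1)]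
      by blast
    then have "corner_vertex M ((next_corner M ^^ i) (root M)) = v" using c(2) by simp
    then show ?thesis unfolding first_visit_def by (rule LeastI)
  qed
  have "inj_on (first_visit M) (verts M)" using at by (metis inj_onI)
  then show ?thesis unfolding dfs_number_def using bij_betw_rank[OF rooted_mapD(1)[OF M]] by blast
qed

lemma equiv_rmap_iso:
  "equiv (labelled_unicellular_maps g n)
     {(M, N). M \<in> labelled_unicellular_maps g n \<and> N \<in> labelled_unicellular_maps g n \<and> rmap_iso M N}"
proof (rule equivI)
  show "sym {(M, N). M \<in> labelled_unicellular_maps g n \<and> N \<in> labelled_unicellular_maps g n \<and> rmap_iso M N}"
    using rmap_iso_sym by (auto simp: sym_def labelled_unicellular_maps_def)
  show "trans {(M, N). M \<in> labelled_unicellular_maps g n \<and> N \<in> labelled_unicellular_maps g n \<and> rmap_iso M N}"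
    unfolding trans_def using rmap_iso_trans by blast
qed (auto simp: refl_on_def rmap_iso_refl)

section \<open>Labelled maps and isomorphism classes\<close>

definition matchings :: "nat \<Rightarrow> (nat \<Rightarrow> nat) set" where
  "matchings n = {\<alpha>. \<alpha> permutes {..<2 * n} \<and> (\<forall>h<2 * n. \<alpha> h \<noteq> h \<and> \<alpha> (\<alpha> h) = h)}"

text \<open>Half-edge 0 serves as the root. The last condition is Euler's relation for one face and
  \<open>n\<close> edges, with the vertices as cycles and free of subtraction.\<close>

definition labelled_pairs :: "nat \<Rightarrow> nat \<Rightarrow> ((nat \<Rightarrow> nat) \<times> (nat \<Rightarrow> nat)) set" where
  "labelled_pairs g n = {(\<alpha>, \<sigma>). \<alpha> \<in> matchings n \<and> \<sigma> \<in> rooted_matching.rotations {..<2 * n} \<alpha> \<and>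
     card (orbit \<sigma> ` {..<2 * n}) + 2 * g = n + 1}"

text \<open>Each vertex is named by its smallest half-edge.\<close>

definition std_map :: "nat \<Rightarrow> (nat \<Rightarrow> nat) \<Rightarrow> (nat \<Rightarrow> nat) \<Rightarrow> nmap" where
  "std_map n \<alpha> \<sigma> = \<lparr>verts = (\<lambda>h. Min (orbit \<sigma> h)) ` {..<2 * n}, halfedges = {..<2 * n},
     vert = (\<lambda>h. Min (orbit \<sigma> h)), opp = \<alpha>, rot = \<sigma>, root = Sector 0\<rparr>"

lemma std_map_simps [simp]:
  "verts (std_map n \<alpha> \<sigma>) = (\<lambda>h. Min (orbit \<sigma> h)) ` {..<2 * n}"
  "halfedges (std_map n \<alpha> \<sigma>) = {..<2 * n}" "vert (std_map n \<alpha> \<sigma>) h = Min (orbit \<sigma> h)"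
  "opp (std_map n \<alpha> \<sigma>) = \<alpha>" "rot (std_map n \<alpha> \<sigma>) = \<sigma>" "root (std_map n \<alpha> \<sigma>) = Sector 0"
  by (simp_all add: std_map_def)

lemma matchings_involution: "0 < n \<Longrightarrow> \<alpha> \<in> matchings n \<Longrightarrow> rooted_involution {..<2 * n} \<alpha> 0"
  by unfold_locales (auto simp: matchings_def)

lemma labelled_pairsD:
  assumes n: "0 < n" and x: "(\<alpha>, \<sigma>) \<in> labelled_pairs g n"
  shows "rooted_involution {..<2 * n} \<alpha> 0" "\<sigma> \<in> rooted_matching.rotations {..<2 * n} \<alpha>"
    "\<alpha> permutes {..<2 * n}" "\<sigma> permutes {..<2 * n}" "cyclic_on (\<alpha> \<circ> \<sigma>) {..<2 * n}"
    "\<And>h. h < 2 * n \<Longrightarrow> \<alpha> h \<noteq> h" "\<And>h. h < 2 * n \<Longrightarrow> \<alpha> (\<alpha> h) = h"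
    "\<And>h. \<alpha> h < 2 * n \<longleftrightarrow> h < 2 * n" "\<And>h. \<sigma> h < 2 * n \<longleftrightarrow> h < 2 * n"
    "card (orbit \<sigma> ` {..<2 * n}) + 2 * g = n + 1"
proof -
  show 1: "rooted_involution {..<2 * n} \<alpha> 0" using assms matchings_involution
    by (simp add: labelled_pairs_def)
  then interpret rooted_involution "{..<2 * n}" \<alpha> 0 .
  show s: "\<sigma> \<in> rotations" using x by (simp add: labelled_pairs_def)
  show p: "\<alpha> permutes {..<2 * n}" "\<sigma> permutes {..<2 * n}" "cyclic_on (\<alpha> \<circ> \<sigma>) {..<2 * n}"
    using alpha_permutes rotationsD(1,2)[OF s] by auto
  show "\<And>h. \<alpha> h < 2 * n \<longleftrightarrow> h < 2 * n" "\<And>h. \<sigma> h < 2 * n \<longleftrightarrow> h < 2 * n"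
    using permutes_in_image[OF p(1)] permutes_in_image[OF p(2)] by auto
qed (use x in \<open>auto simp: labelled_pairs_def matchings_def\<close>)

lemma Min_orbit_in:
  assumes "\<sigma> permutes H" "finite H"
  shows "Min (orbit \<sigma> h) \<in> orbit \<sigma> (h :: nat)"
  using assms
  by (intro Min_in finite_orbit permutation_self_in_orbit orbit_nonempty) (auto simp: permutation_permutes)

lemma Min_orbit_eq_iff:
  assumes "\<sigma> permutes H" "finite H"
  shows "Min (orbit \<sigma> h) = Min (orbit \<sigma> h') \<longleftrightarrow> orbit \<sigma> h = orbit \<sigma> (h' :: nat)"
  using orbit_sym_permutes[OF assms] Min_orbit_in[OF assms] by metis

lemma card_Min_orbit:
  assumes "\<sigma> permutes H" "finite H"
  shows "card ((\<lambda>h :: nat. Min (orbit \<sigma> h)) ` H) = card (orbit \<sigma> ` H)"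
proof -
  have "(\<lambda>h. Min (orbit \<sigma> h)) ` H = Min ` orbit \<sigma> ` H" by (simp add: image_image)
  moreover have "inj_on Min (orbit \<sigma> ` H)" using Min_orbit_eq_iff[OF assms] by (auto intro!: inj_onI)
  ultimately show ?thesis by (simp add: card_image)
qed

text \<open>Reconciles the two face permutations, \<open>rot \<circ> opp\<close> for maps and
  \<open>\<alpha> \<circ> \<sigma>\<close> for rotations: they are conjugate.\<close>

lemma cyclic_on_comp_commute:
  assumes "cyclic_on (f \<circ> g) S" "g ` S = S"
  shows "cyclic_on (g \<circ> f) S"
proof -
  have "cyclic_on (g \<circ> f) (g ` S)" by (rule cyclic_on_image[OF assms(1)]) simp
  then show ?thesis using assms(2) by simp
qed

lemma orbit_Sector:
  assumes "permutation (rot M \<circ> opp M)"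
  shows "orbit (next_corner M) (Sector h) = Sector ` orbit (rot M \<circ> opp M) h"
  by (intro orbit_inverse[symmetric] permutation_self_in_orbit assms) simp

lemma std_map_labelled:
  assumes n: "0 < n" and x: "(\<alpha>, \<sigma>) \<in> labelled_pairs g n"
  shows "std_map n \<alpha> \<sigma> \<in> labelled_unicellular_maps g n"
proof -
  let ?H = "{..<2 * n}" and ?M = "std_map n \<alpha> \<sigma>"
  note D = labelled_pairsD[OF n x]
  have finH: "finite ?H" by simp
  have ps: "permutation \<sigma>" "permutation (\<sigma> \<circ> \<alpha>)"
    using D(3,4) permutes_compose[OF D(3,4)] by (auto simp: permutation_permutes)
  have cyc: "cyclic_on (\<sigma> \<circ> \<alpha>) ?H"
    by (rule cyclic_on_comp_commute[OF D(5)]) (rule permutes_image[OF D(4)])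
  have self: "h \<in> orbit \<sigma> h" for h by (rule permutation_self_in_orbit[OF ps(1)])
  have orb: "orbit \<sigma> h = {h' \<in> ?H. Min (orbit \<sigma> h') = Min (orbit \<sigma> h)}" if h: "h \<in> ?H" for h
  proof (intro subset_antisym subsetI)
    fix y assume y: "y \<in> orbit \<sigma> h"
    then have "y \<in> ?H" "orbit \<sigma> y = orbit \<sigma> h"
      using permutes_orbit_subset[OF D(4) h] orbit_sym_permutes[OF D(4) finH y] by auto
    then show "y \<in> {h' \<in> ?H. Min (orbit \<sigma> h') = Min (orbit \<sigma> h)}" by simp
  next
    fix y assume "y \<in> {h' \<in> ?H. Min (orbit \<sigma> h') = Min (orbit \<sigma> h)}"
    then have "orbit \<sigma> y = orbit \<sigma> h" using Min_orbit_eq_iff[OF D(4) finH] by simp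
    then show "y \<in> orbit \<sigma> h" using self[of y] by simp
  qed
  let ?R = "{(Min (orbit \<sigma> h), Min (orbit \<sigma> (\<alpha> h))) |h. h \<in> ?H}"
  define \<gamma> where "\<gamma> = \<alpha> \<circ> \<sigma>"
  have \<gamma>: "\<gamma> y = \<alpha> (\<sigma> y)" for y by (simp add: \<gamma>_def)
  \<comment> \<open>Connectedness comes from the single face. A step of its walk turns around a
    vertex by \<open>\<sigma>\<close> and then crosses an edge by \<open>\<alpha>\<close>, and the
    walk meets all half-edges.\<close>
  have reach: "(Min (orbit \<sigma> a), Min (orbit \<sigma> ((\<gamma> ^^ i) a))) \<in> ?R\<^sup>* \<and> (\<gamma> ^^ i) a \<in> ?H" if a: "a \<in> ?H"
    for a i
  proof (induction i)
    case (Suc i)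
    let ?y = "(\<gamma> ^^ i) a"
    have y: "?y \<in> ?H" using Suc by simp
    have "Min (orbit \<sigma> (\<sigma> ?y)) = Min (orbit \<sigma> ?y)" using permutation_orbit_step[OF ps(1)] by simp
    moreover have "(Min (orbit \<sigma> (\<sigma> ?y)), Min (orbit \<sigma> (\<alpha> (\<sigma> ?y)))) \<in> ?R" using y D(9) by auto
    ultimately have "(Min (orbit \<sigma> ?y), Min (orbit \<sigma> (\<gamma> ?y))) \<in> ?R" by (simp add: \<gamma>)
    then have "(Min (orbit \<sigma> a), Min (orbit \<sigma> (\<gamma> ?y))) \<in> ?R\<^sup>*"
      by (rule rtrancl_into_rtrancl[OF conjunct1[OF Suc]])
    moreover have "\<gamma> ?y \<in> ?H" using y D(8,9) by (simp add: \<gamma>)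
    ultimately show ?case by simp
  qed (use a in simp)
  have conn: "(u, v) \<in> ?R\<^sup>*" if u: "u \<in> (\<lambda>h. Min (orbit \<sigma> h)) ` ?H"
    and v: "v \<in> (\<lambda>h. Min (orbit \<sigma> h)) ` ?H" for u v
  proof -
    obtain a where a: "a \<in> ?H" "u = Min (orbit \<sigma> a)" using u by blast
    obtain b where b: "b \<in> ?H" "v = Min (orbit \<sigma> b)" using v by blast
    have "b \<in> orbit \<gamma> a" using D(5) a(1) b(1) by (simp add: cyclic_on_alldef \<gamma>_def)
    then obtain i where "b = (\<gamma> ^^ i) a" unfolding orbit_altdef by blast
    then show ?thesis using reach[OF a(1), of i] a b by simp
  qed
  have cor: "corners ?M = Sector ` ?H" by (simp add: corners_def)
  have rm: "rooted_map ?M"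
    unfolding rooted_map_def
  proof (intro conjI ballI)
    show "verts ?M \<noteq> {}" using n by (auto simp: lessThan_empty_iff)
    show "orbit (rot ?M) h = {h' \<in> halfedges ?M. vert ?M h' = vert ?M h}" if "h \<in> halfedges ?M" for h
      using orb that by simp
    show "(u, v) \<in> {(vert ?M h, vert ?M (opp ?M h)) |h. h \<in> halfedges ?M}\<^sup>*"
      if "u \<in> verts ?M" "v \<in> verts ?M" for u v
      using conn that by simp
    show "root ?M \<in> corners ?M" unfolding cor using n by simp
  qed (use D(3,4,6,7) in auto)
  have faces: "faces ?M = {Sector ` ?H}"
  proof -
    have "orbit (next_corner ?M) (Sector h) = Sector ` ?H" if "h \<in> ?H" for h
      using orbit_Sector[of ?M h] ps(2) cyc that by (simp add: cyclic_on_alldef)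
    then have "faces ?M = (\<lambda>h. Sector ` ?H) ` ?H"
      unfolding faces_def cor image_image by (intro image_cong) auto
    moreover have "0 \<in> ?H" using n by simp
    ultimately show ?thesis unfolding image_constant_conv by (metis empty_iff)
  qed
  have "card ?H = 2 * card (edges ?M)"
    unfolding edges_def std_map_simps using D(6,7,8) by (intro card_fixpoint_free_involution) auto
  then have ce: "card (edges ?M) = n" by simp
  have "int (card (verts ?M)) = int n + 1 - 2 * int g"
    using D(10) card_Min_orbit[OF D(4) finH] by simp
  then show ?thesis using rm faces ce
    by (simp add: labelled_unicellular_maps_def has_genus_def del: std_map_simps)
qed

text \<open>By connectedness every vertex is joined to the ends of some edge and so carries a
  half-edge; hence no corner is of the form \<open>Around v\<close>.\<close>

lemma unicellular_root:
  assumes M: "M \<in> labelled_unicellular_maps g n" and n: "0 < n"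
  obtains h0 where "h0 \<in> halfedges M" "root M = Sector h0"
    and "verts M = vert M ` halfedges M" "corners M = Sector ` halfedges M"
proof -
  have rm: "rooted_map M" and ce: "card (edges M) = n" using M
    by (auto simp: labelled_unicellular_maps_def)
  have "edges M \<noteq> {}" using ce n by auto
  then obtain h1 where h1: "h1 \<in> halfedges M" by (auto simp: edges_def)
  have vs: "verts M = vert M ` halfedges M"
  proof (intro subset_antisym subsetI)
    fix v assume v: "v \<in> verts M"
    show "v \<in> vert M ` halfedges M"
    proof (cases "v = vert M h1")
      case True then show ?thesis using h1 by blast
    next
      case False
      have "(v, vert M h1) \<in> {(vert M h, vert M (opp M h)) |h. h \<in> halfedges M}\<^sup>*"
        by (rule rooted_mapD(10)[OF rm v rooted_mapD(4)[OF rm h1]])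
      then obtain w where "(v, w) \<in> {(vert M h, vert M (opp M h)) |h. h \<in> halfedges M}"
        using False by (meson converse_rtranclE)
      then show ?thesis by blast
    qed
  qed (use rooted_mapD(4)[OF rm] in blast)
  then have c: "corners M = Sector ` halfedges M" by (auto simp: corners_def)
  then obtain h0 where "h0 \<in> halfedges M" "root M = Sector h0" using rooted_mapD(11)[OF rm] by blast
  then show thesis using that vs c by blast
qed

text \<open>Relabelling along \<open>k\<close> carries over the whole structure, each vertex being
  renamed to its least new half-edge. It yields standard representatives of maps as well as the
  action of relabellings on labelled pairs.\<close>

lemma transport_labelled_pair:
  fixes M :: nmap
  assumes M: "M \<in> labelled_unicellular_maps g n" and n: "0 < n"
    and k: "bij_betw k (halfedges M) {..<2 * n}" and root: "root M = Sector h0" "k h0 = 0"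
    and p: "\<alpha> permutes {..<2 * n}" "\<sigma> permutes {..<2 * n}"
    and h: "\<And>h. h \<in> halfedges M \<Longrightarrow> \<alpha> (k h) = k (opp M h) \<and> \<sigma> (k h) = k (rot M h)"
  shows "(\<alpha>, \<sigma>) \<in> labelled_pairs g n" "rmap_iso M (std_map n \<alpha> \<sigma>)"
proof -
  let ?H = "{..<2 * n}"
  have rm: "rooted_map M" and ce: "card (edges M) = n" and one: "card (faces M) = 1"
    and hg: "has_genus M g"
    using M by (auto simp: labelled_unicellular_maps_def)
  note D = rooted_mapD[OF rm]
  obtain h0' where "root M = Sector h0'" and vs: "verts M = vert M ` halfedges M"
    and cs: "corners M = Sector ` halfedges M"
    using unicellular_root[OF M n] by metis
  have img: "k ` halfedges M = ?H" and inj: "inj_on k (halfedges M)" using k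
    by (auto simp: bij_betw_def)
  have orb: "orbit \<sigma> (k x) = k ` {y \<in> halfedges M. vert M y = vert M x}" if x: "x \<in> halfedges M" for x
  proof -
    have "k ` orbit (rot M) x = orbit \<sigma> (k x)"
    proof (rule orbit_inverse)
      show "x \<in> orbit (rot M) x" using D(3,8) permutation_self_in_orbit permutation_permutes by metis
      fix y assume "y \<in> orbit (rot M) x"
      then have "y \<in> halfedges M" using permutes_orbit_subset[OF D(8) x] by blast
      then show "\<sigma> (k y) = k (rot M y)" using h by simp
    qed
    then show ?thesis using D(9)[OF x] by simp
  qed
  let ?f = "\<lambda>v. Min (k ` {y \<in> halfedges M. vert M y = v})"
  have fin: "finite {y \<in> halfedges M. vert M y = v}" for v using D(3) by simp
  have sep: "u = v"
    if u: "k ` {y \<in> halfedges M. vert M y = u} \<inter> k ` {y \<in> halfedges M. vert M y = v} \<noteq> {}" for u v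
  proof -
    obtain a b where "a \<in> halfedges M" "b \<in> halfedges M" "vert M a = u" "vert M b = v" "k a = k b"
      using u by blast
    then show ?thesis using inj by (metis inj_onD)
  qed
  have finj: "inj_on ?f (verts M)"
  proof (rule inj_onI)
    fix u v assume "u \<in> verts M" "v \<in> verts M" and e: "?f u = ?f v"
    then have "{y \<in> halfedges M. vert M y = u} \<noteq> {}" "{y \<in> halfedges M. vert M y = v} \<noteq> {}" using vs
      by auto
    then have "?f u \<in> k ` {y \<in> halfedges M. vert M y = u}" "?f v \<in> k ` {y \<in> halfedges M. vert M y = v}"
      using fin by (intro Min_in; simp)+
    then show "u = v" using sep e by (metis (no_types, lifting) disjoint_iff)
  qed
  have "verts (std_map n \<alpha> \<sigma>) = (\<lambda>x. Min (orbit \<sigma> (k x))) ` halfedges M"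
    unfolding std_map_simps img[symmetric] image_image ..
  also have "\<dots> = ?f ` verts M" unfolding vs image_image using orb by (intro image_cong) auto
  finally have fb: "bij_betw ?f (verts M) (verts (std_map n \<alpha> \<sigma>))" using finj
    by (simp only: bij_betw_def)
  show "rmap_iso M (std_map n \<alpha> \<sigma>)"
    unfolding rmap_iso_def
    using fb k h orb root by (intro exI[of _ ?f] exI[of _ k]) (simp del: std_map_simps(1))
  have m: "\<alpha> \<in> matchings n"
  proof -
    have "\<alpha> y \<noteq> y \<and> \<alpha> (\<alpha> y) = y" if "y < 2 * n" for y
    proof -
      have "y \<in> k ` halfedges M" unfolding img using that by simp
      then obtain x where x: "x \<in> halfedges M" "y = k x" by blast
      have "k (opp M x) \<noteq> k x" using inj x(1) D(6,12)[OF x(1)] by (meson inj_onD)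
      then show ?thesis using h[OF x(1)] h[OF D(12)[OF x(1)]] D(7)[OF x(1)] x(2) by simp
    qed
    then show ?thesis using p(1) by (simp add: matchings_def)
  qed
  interpret rooted_involution ?H \<alpha> 0 by (rule matchings_involution[OF n m])
  have "cyclic_on (next_corner M) (corners M)"
  proof -
    obtain F where F: "faces M = {F}" using one by (meson card_1_singletonE)
    have "orbit (next_corner M) c = F" if "c \<in> corners M" for c using F that unfolding faces_def
      by blast
    moreover have "F = corners M"
    proof (intro subset_antisym subsetI)
      fix c assume "c \<in> corners M"
      then show "c \<in> F" using calculation permutation_self_in_orbit[OF next_corner_permutation[OF rm]]
        by metis
    next
      fix c assume "c \<in> F"
      then have "c \<in> orbit (next_corner M) (root M)" using calculation D(11) by blast
      then obtain i where "c = (next_corner M ^^ i) (root M)" unfolding orbit_altdef by blast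
      then show "c \<in> corners M" using funpow_next_corner_in[OF rm] by simp
    qed
    ultimately show ?thesis unfolding cyclic_on_def using D(11) by blast
  qed
  \<comment> \<open>All corners are sectors here; the value 0 on \<open>Around\<close> is a
    dummy.\<close>
  then have "cyclic_on (\<sigma> \<circ> \<alpha>) ((\<lambda>c. case c of Sector x \<Rightarrow> k x | Around v \<Rightarrow> 0) ` corners M)"
  proof (rule cyclic_on_image)
    fix c assume "c \<in> corners M"
    then obtain x where "x \<in> halfedges M" "c = Sector x" using cs by blast
    then show "(\<sigma> \<circ> \<alpha>) (case c of Sector x \<Rightarrow> k x | Around v \<Rightarrow> 0) =
        (case next_corner M c of Sector x \<Rightarrow> k x | Around v \<Rightarrow> 0)"
      using h[of x] h[of "opp M x"] D(12) by simp
  qed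
  moreover have "(\<lambda>c. case c of Sector x \<Rightarrow> k x | Around v \<Rightarrow> 0) ` corners M = ?H"
    unfolding cs image_image using img by simp
  ultimately have "cyclic_on (\<alpha> \<circ> \<sigma>) ?H"
    using cyclic_on_comp_commute[of \<sigma> \<alpha> ?H] permutes_image[OF p(1)] by simp
  then have rot: "\<sigma> \<in> rotations" using p by (simp add: rotations_def)
  have "orbit \<sigma> ` ?H = (\<lambda>v. k ` {y \<in> halfedges M. vert M y = v}) ` verts M"
    unfolding vs img[symmetric] image_image using orb by (intro image_cong) auto
  moreover have "inj_on (\<lambda>v. k ` {y \<in> halfedges M. vert M y = v}) (verts M)"
  proof (rule inj_onI)
    fix u v assume u: "u \<in> verts M"
      and e: "k ` {y \<in> halfedges M. vert M y = u} = k ` {y \<in> halfedges M. vert M y = v}"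
    have "k ` {y \<in> halfedges M. vert M y = u} \<noteq> {}" using u vs by auto
    then show "u = v" using sep[of u v] e by simp
  qed
  ultimately have "card (orbit \<sigma> ` ?H) = card (verts M)" by (simp add: card_image)
  then have "card (orbit \<sigma> ` ?H) + 2 * g = n + 1"
    using hg ce one unfolding has_genus_def by simp
  then show "(\<alpha>, \<sigma>) \<in> labelled_pairs g n" using m rot by (simp add: labelled_pairs_def)
qed

lemma permutes_transport:
  assumes k: "bij_betw k A B" and f: "f permutes A"
  shows "(\<lambda>y. if y \<in> B then k (f (inv_into A k y)) else y) permutes B"
    and "x \<in> A \<Longrightarrow> (if k x \<in> B then k (f (inv_into A k (k x))) else k x) = k (f x)"
proof -
  have "bij_betw (k \<circ> f \<circ> inv_into A k) B B"
    using bij_betw_trans[OF bij_betw_inv_into[OF k] bij_betw_trans[OF permutes_imp_bij[OF f] k]]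
    by (simp add: comp_assoc)
  then have "bij_betw (\<lambda>y. if y \<in> B then k (f (inv_into A k y)) else y) B B"
    by (rule bij_betw_cong[THEN iffD1, rotated]) simp
  then show "(\<lambda>y. if y \<in> B then k (f (inv_into A k y)) else y) permutes B"
    by (rule bij_imp_permutes) simp
  show "x \<in> A \<Longrightarrow> (if k x \<in> B then k (f (inv_into A k (k x))) else k x) = k (f x)"
    using k bij_betwE[OF k] by (simp add: bij_betw_def)
qed

lemma labelled_pair_exists:
  assumes M: "M \<in> labelled_unicellular_maps g n" and n: "0 < n"
  shows "\<exists>x \<in> labelled_pairs g n. rmap_iso M (std_map n (fst x) (snd x))"
proof -
  let ?H = "{..<2 * n}"
  have rm: "rooted_map M" and ce: "card (edges M) = n" using M
    by (auto simp: labelled_unicellular_maps_def)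
  note D = rooted_mapD[OF rm]
  obtain h0 where h0: "h0 \<in> halfedges M" "root M = Sector h0" using unicellular_root[OF M n] by metis
  have "card (halfedges M) = 2 * card (edges M)"
    unfolding edges_def using D(3,6,7,12) by (intro card_fixpoint_free_involution) auto
  then obtain k1 where k1: "bij_betw k1 (halfedges M) ?H"
    using finite_same_card_bij[OF D(3), of ?H] ce by auto
  \<comment> \<open>The transposition moves the root half-edge to 0.\<close>
  define k where "k = transpose 0 (k1 h0) \<circ> k1"
  have "k1 h0 \<in> ?H" using bij_betwE[OF k1] h0 by blast
  then have "transpose 0 (k1 h0) permutes ?H" using n by (intro permutes_swap_id) auto
  then have k: "bij_betw k (halfedges M) ?H" unfolding k_def using k1 permutes_imp_bij bij_betw_trans
    by blast
  have k0: "k h0 = 0" by (simp add: k_def)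
  let ?t = "\<lambda>f y. if y \<in> ?H then k (f (inv_into (halfedges M) k y)) else y"
  have "(?t (opp M), ?t (rot M)) \<in> labelled_pairs g n \<and> rmap_iso M (std_map n (?t (opp M)) (?t (rot M)))"
    using transport_labelled_pair[OF M n k h0(2) k0 permutes_transport(1)[OF k D(5)] permutes_transport(1)[OF k D(8)]]
      permutes_transport(2)[OF k D(5)] permutes_transport(2)[OF k D(8)] by blast
  then show ?thesis by force
qed

section \<open>Relabellings and the absence of automorphisms\<close>

definition conj_pair :: "('a \<Rightarrow> 'a) \<Rightarrow> ('a \<Rightarrow> 'a) \<times> ('a \<Rightarrow> 'a) \<Rightarrow> ('a \<Rightarrow> 'a) \<times> ('a \<Rightarrow> 'a)" where
  "conj_pair s x = (s \<circ> fst x \<circ> inv s, s \<circ> snd x \<circ> inv s)"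

text \<open>An isomorphism of standard maps is a relabelling of the half-edges that fixes the root
  0, so it acts by conjugation. It is determined by following the face from the root, so different
  relabellings give different pairs.\<close>

lemma isomorphic_labelled_pairs:
  assumes n: "0 < n" and x: "x \<in> labelled_pairs g n"
  shows "{y \<in> labelled_pairs g n. rmap_iso (std_map n (fst x) (snd x)) (std_map n (fst y) (snd y))} =
    (\<lambda>s. conj_pair s x) ` {s. s permutes {1..<2 * n}}" (is "?L = ?R")
    and "inj_on (\<lambda>s. conj_pair s x) {s. s permutes {1..<2 * n}}"
proof -
  let ?H = "{..<2 * n}"
  obtain \<alpha> \<sigma> where xe: "x = (\<alpha>, \<sigma>)" by fastforce
  note D = labelled_pairsD[OF n x[unfolded xe]]
  let ?M = "std_map n \<alpha> \<sigma>"
  have M: "?M \<in> labelled_unicellular_maps g n" by (rule std_map_labelled[OF n x[unfolded xe]])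
  have sub: "{1..<2 * n} \<subseteq> ?H" by auto
  show "?L = ?R"
  proof (intro subset_antisym subsetI)
    fix y assume "y \<in> ?R"
    then obtain s where s: "s permutes {1..<2 * n}" "y = conj_pair s x" by blast
    have sH: "s permutes ?H" using permutes_subset[OF s(1) sub] .
    have s0: "s 0 = 0" using s(1) by (simp add: permutes_def)
    have inv: "inv s (s h) = h" for h using permutes_inverses(2)[OF s(1)] .
    let ?a = "s \<circ> \<alpha> \<circ> inv s" and ?b = "s \<circ> \<sigma> \<circ> inv s"
    have p: "?a permutes ?H" "?b permutes ?H"
      using permutes_compose permutes_inv[OF sH] sH D(3,4) by blast+
    have b: "bij_betw s (halfedges ?M) ?H" using permutes_imp_bij[OF sH] by simp
    have r: "root ?M = Sector 0" by simp
    have hh: "?a (s h) = s (opp ?M h) \<and> ?b (s h) = s (rot ?M h)" for h by (simp add: inv)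
    have "(?a, ?b) \<in> labelled_pairs g n" "rmap_iso ?M (std_map n ?a ?b)"
      by (fact transport_labelled_pair[OF M n b r s0 p hh])+
    then show "y \<in> ?L" using s(2) by (simp add: conj_pair_def xe)
  next
    fix y assume y: "y \<in> ?L"
    obtain \<alpha>' \<sigma>' where ye: "y = (\<alpha>', \<sigma>')" by fastforce
    have y': "(\<alpha>', \<sigma>') \<in> labelled_pairs g n" using y ye by simp
    note D' = labelled_pairsD[OF n y']
    obtain f k where k: "bij_betw k ?H ?H"
      and h: "\<And>h. h \<in> ?H \<Longrightarrow> \<alpha>' (k h) = k (\<alpha> h) \<and> \<sigma>' (k h) = k (\<sigma> h)"
      and r: "Sector 0 = map_corner f k (Sector 0)"
      using y unfolding xe ye rmap_iso_def by auto
    define s where "s h = (if h \<in> ?H then k h else h)" for h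
    have "bij_betw s ?H ?H" using k by (rule bij_betw_cong[THEN iffD1, rotated]) (simp add: s_def)
    then have sH: "s permutes ?H" by (rule bij_imp_permutes) (simp add: s_def)
    have s0: "s 0 = 0" using r n by (simp add: s_def)
    have s1: "s permutes {1..<2 * n}"
      by (rule permutes_superset[OF sH]) (use s0 in \<open>auto simp: Suc_le_eq\<close>)
    have sa: "\<alpha>' \<circ> s = s \<circ> \<alpha>"
    proof
      fix z
      show "(\<alpha>' \<circ> s) z = (s \<circ> \<alpha>) z"
        using h[of z] D(3,8) D'(3) by (cases "z \<in> ?H") (auto simp: s_def permutes_def)
    qed
    have sb: "\<sigma>' \<circ> s = s \<circ> \<sigma>"
    proof
      fix z
      show "(\<sigma>' \<circ> s) z = (s \<circ> \<sigma>) z"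
        using h[of z] D(4,9) D'(4) by (cases "z \<in> ?H") (auto simp: s_def permutes_def)
    qed
    have "s \<circ> inv s = id" using permutes_inv_o(1)[OF sH] .
    then have "\<alpha>' = s \<circ> \<alpha> \<circ> inv s" "\<sigma>' = s \<circ> \<sigma> \<circ> inv s"
      using sa sb by (metis comp_assoc comp_id)+
    then show "y \<in> ?R" using s1 by (auto simp: ye xe conj_pair_def)
  qed
  show "inj_on (\<lambda>s. conj_pair s x) {s. s permutes {1..<2 * n}}"
  proof (rule inj_onI)
    fix s t assume s: "s \<in> {s. s permutes {1..<2 * n}}" and t: "t \<in> {s. s permutes {1..<2 * n}}"
      and e: "conj_pair s x = conj_pair t x"
    have s0: "s 0 = 0" "t 0 = 0" using s t by (auto simp: permutes_def)
    have inv: "inv s (s z) = z" "inv t (t z) = z" for z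
      using s t permutes_inverses(2)[of _ "{1..<2 * n}" z] by simp_all
    have ea: "s (\<alpha> (inv s z)) = t (\<alpha> (inv t z))" and eb: "s (\<sigma> (inv s z)) = t (\<sigma> (inv t z))" for z
      using e unfolding conj_pair_def xe by (auto dest: fun_cong[of _ _ z])
    define \<gamma> where "\<gamma> = \<alpha> \<circ> \<sigma>"
    \<comment> \<open>Since the conjugated pairs are equal, agreement of \<open>s\<close> and
      \<open>t\<close> passes from one half-edge to the next along the face.\<close>
    have it: "s ((\<gamma> ^^ i) 0) = t ((\<gamma> ^^ i) 0)" for i
    proof (induction i)
      case (Suc i)
      let ?z = "(\<gamma> ^^ i) 0"
      have "inv t (s ?z) = ?z" using inv(2)[of ?z] Suc by simp
      then have 1: "s (\<sigma> ?z) = t (\<sigma> ?z)" using eb[of "s ?z"] inv(1)[of ?z] by simp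
      have "inv t (s (\<sigma> ?z)) = \<sigma> ?z" using inv(2)[of "\<sigma> ?z"] 1 by simp
      then have "s (\<alpha> (\<sigma> ?z)) = t (\<alpha> (\<sigma> ?z))" using ea[of "s (\<sigma> ?z)"] inv(1)[of "\<sigma> ?z"] by simp
      then have "s (\<gamma> ?z) = t (\<gamma> ?z)" by (simp only: \<gamma>_def comp_apply)
      then show ?case by simp
    qed (simp add: s0)
    show "s = t"
    proof
      fix z
      show "s z = t z"
      proof (cases "z \<in> ?H")
        case True
        have "z \<in> orbit \<gamma> 0" using D(5) True n by (simp add: cyclic_on_alldef \<gamma>_def)
        then show ?thesis using it unfolding orbit_altdef by blast
      next
        case False
        then show ?thesis using s t by (simp add: permutes_def)
      qed
    qed
  qed
qed

definition map_class :: "nat \<Rightarrow> nat \<Rightarrow> (nat \<Rightarrow> nat) \<times> (nat \<Rightarrow> nat) \<Rightarrow> nmap set" where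
  "map_class g n x = {N \<in> labelled_unicellular_maps g n. rmap_iso (std_map n (fst x) (snd x)) N}"

lemma finite_labelled_pairs: "finite (labelled_pairs g n)"
proof (rule finite_subset)
  show "labelled_pairs g n \<subseteq> {p. p permutes {..<2 * n}} \<times> {p. p permutes {..<2 * n}}"
  proof
    fix x assume x: "x \<in> labelled_pairs g n"
    obtain \<alpha> \<sigma> where xe: "x = (\<alpha>, \<sigma>)" by fastforce
    show "x \<in> {p. p permutes {..<2 * n}} \<times> {p. p permutes {..<2 * n}}"
    proof (cases "n = 0")
      case True
      \<comment> \<open>For \<open>n = 0\<close> there are no labelled pairs, because no permutation
        is cyclic on the empty set. Maps without edges are treated separately.\<close>
      have "\<not> cyclic_on f {}" for f :: "nat \<Rightarrow> nat" by (simp add: cyclic_on_alldef)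
      then show ?thesis using x True by (auto simp: xe labelled_pairs_def matchings_def)
    next
      case False
      then show ?thesis using labelled_pairsD(3,4)[of n \<alpha> \<sigma> g] x xe by simp
    qed
  qed
qed (simp add: finite_permutations)

text \<open>All classes have the same number of labellings, one for each permutation of the
  half-edges other than the root. So any sum over classes becomes one over labelled pairs, up to a
  factor that cancels later.\<close>

lemma sum_labelled_pairs:
  assumes n: "0 < n"
  shows "map_class g n ` labelled_pairs g n = unicellular_maps g n"
    and "(\<Sum>x\<in>labelled_pairs g n. w (map_class g n x)) = fact (2 * n - 1) * (\<Sum>C\<in>unicellular_maps g n. w C :: nat)"
proof -
  let ?X = "labelled_unicellular_maps g n"
  let ?r = "{(M, N). M \<in> ?X \<and> N \<in> ?X \<and> rmap_iso M N}"
  let ?s = "\<lambda>x. std_map n (fst x) (snd x)"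
  have s: "?s x \<in> ?X" if "x \<in> labelled_pairs g n" for x
    using std_map_labelled[OF n, of "fst x" "snd x"] that by simp
  have mc: "map_class g n x = ?r `` {?s x}" if "x \<in> labelled_pairs g n" for x
    using s[OF that] by (auto simp: map_class_def)
  show img: "map_class g n ` labelled_pairs g n = unicellular_maps g n"
  proof (intro subset_antisym subsetI)
    fix C assume "C \<in> map_class g n ` labelled_pairs g n"
    then obtain x where x: "x \<in> labelled_pairs g n" "C = map_class g n x" by blast
    then show "C \<in> unicellular_maps g n" unfolding unicellular_maps_def
      using mc[OF x(1)] quotientI[OF s[OF x(1)], of ?r] by simp
  next
    fix C assume "C \<in> unicellular_maps g n"
    then obtain M where M: "M \<in> ?X" "C = ?r `` {M}" unfolding unicellular_maps_def quotient_def by blast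
    obtain x where x: "x \<in> labelled_pairs g n" "rmap_iso M (?s x)" using labelled_pair_exists[OF M(1) n]
      by blast
    have "(M, ?s x) \<in> ?r" using M x s by simp
    then have "?r `` {M} = ?r `` {?s x}" by (rule equiv_class_eq[OF equiv_rmap_iso])
    then have "C = map_class g n x" using M(2) mc[OF x(1)] by simp
    then show "C \<in> map_class g n ` labelled_pairs g n" using x by blast
  qed
  have fibre: "card {y \<in> labelled_pairs g n. map_class g n y = C} = fact (2 * n - 1)"
    if C: "C \<in> unicellular_maps g n" for C
  proof -
    obtain x where x: "x \<in> labelled_pairs g n" "C = map_class g n x" using C img by blast
    have "map_class g n y = C \<longleftrightarrow> rmap_iso (?s x) (?s y)" if y: "y \<in> labelled_pairs g n" for y
      using eq_equiv_class_iff[OF equiv_rmap_iso s[OF x(1)] s[OF y]] mc[OF x(1)] mc[OF y] x s[OF x(1)] s[OF y] by auto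
    then have "{y \<in> labelled_pairs g n. map_class g n y = C} = {y \<in> labelled_pairs g n. rmap_iso (?s x) (?s y)}" by blast
    then have "card {y \<in> labelled_pairs g n. map_class g n y = C} = card {s. s permutes {1..<2 * n}}"
      using isomorphic_labelled_pairs[OF n x(1)] by (simp add: card_image)
    then show ?thesis by (simp add: card_permutations)
  qed
  have "(\<Sum>x\<in>labelled_pairs g n. w (map_class g n x)) =
      (\<Sum>C\<in>unicellular_maps g n. \<Sum>x | x \<in> labelled_pairs g n \<and> map_class g n x = C. w (map_class g n x))"
    unfolding img[symmetric] by (rule sum.image_gen[OF finite_labelled_pairs])
  also have "\<dots> = (\<Sum>C\<in>unicellular_maps g n. fact (2 * n - 1) * w C)"
    using fibre by (intro sum.cong) auto
  finally show "(\<Sum>x\<in>labelled_pairs g n. w (map_class g n x)) = fact (2 * n - 1) * (\<Sum>C\<in>unicellular_maps g n. w C)"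
    by (simp add: sum_distrib_left)
qed

section \<open>From vertex partitions back to rotations\<close>

context rooted_involution
begin

lemma sum_rotations_by_orbits:
  "(\<Sum>\<sigma> | \<sigma> \<in> rotations \<and> P (orbit \<sigma> ` H). F (orbit \<sigma> ` H)) =
   (\<Sum>\<pi> | partition_on H \<pi> \<and> P \<pi>. num_rotations \<pi> * F \<pi> :: nat)"
proof -
  let ?S = "{\<sigma>. \<sigma> \<in> rotations \<and> P (orbit \<sigma> ` H)}" and ?T = "{\<pi>. partition_on H \<pi> \<and> P \<pi>}"
  have finS: "finite ?S" using finite_rotations by simp
  have finT: "finite ?T" by (rule finite_subset[OF _ finitely_many_partition_on[OF finite_H]]) auto
  have "partition_on H (orbit \<sigma> ` H)" if "\<sigma> \<in> rotations" for \<sigma>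
    by (rule partition_on_orbits[OF that]) (use rotationsD(5)[OF that] in auto)
  then have "(\<Sum>\<sigma>\<in>?S. F (orbit \<sigma> ` H)) = (\<Sum>\<pi>\<in>?T. \<Sum>\<sigma> | \<sigma> \<in> ?S \<and> orbit \<sigma> ` H = \<pi>. F (orbit \<sigma> ` H))"
    by (intro sum.group[OF finS finT, symmetric]) blast
  also have "\<dots> = (\<Sum>\<pi>\<in>?T. num_rotations \<pi> * F \<pi>)"
  proof (rule sum.cong[OF refl])
    fix \<pi> assume \<pi>: "\<pi> \<in> ?T"
    then have "{\<sigma>. \<sigma> \<in> ?S \<and> orbit \<sigma> ` H = \<pi>} = {\<sigma> \<in> rotations. orbit \<sigma> ` H = \<pi>}" by blast
    then have "(\<Sum>\<sigma> | \<sigma> \<in> ?S \<and> orbit \<sigma> ` H = \<pi>. F (orbit \<sigma> ` H)) = (\<Sum>\<sigma> | \<sigma> \<in> rotations \<and> orbit \<sigma> ` H = \<pi>. F \<pi>)"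
      by (intro sum.cong) auto
    then show "(\<Sum>\<sigma> | \<sigma> \<in> ?S \<and> orbit \<sigma> ` H = \<pi>. F (orbit \<sigma> ` H)) = num_rotations \<pi> * F \<pi>"
      by (simp add: num_rotations_def)
  qed
  finally show ?thesis .
qed

text \<open>The identity for single partitions is summed over those with \<open>P\<close>, and the
  sum is rearranged so that the tree rotation \<open>\<tau>\<close> comes first. Later
  \<open>P\<close> prescribes the genus and the graph.\<close>

lemma weighted_count:
  "2 ^ (card H div 2 + 1) * card {\<sigma> \<in> rotations. P (orbit \<sigma> ` H)} =
   (\<Sum>\<tau> | \<tau> \<in> rotations \<and> card (orbit \<tau> ` H) = card H div 2 + 1.
      \<Sum>\<pi> | refines H (orbit \<tau> ` H) \<pi> \<and> P \<pi>. refinement_weight (orbit \<tau> ` H) \<pi>)"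
proof -
  let ?N = "card H div 2 + 1"
  let ?T = "{\<pi>. partition_on H \<pi> \<and> P \<pi>}" and ?R = "{\<rho>. partition_on H \<rho> \<and> card \<rho> = ?N}"
  have fin: "finite ?T" "finite ?R"
    by (rule finite_subset[OF _ finitely_many_partition_on[OF finite_H]]; blast)+
  have "2 ^ ?N * card {\<sigma> \<in> rotations. P (orbit \<sigma> ` H)} = 2 ^ ?N * (\<Sum>\<pi>\<in>?T. num_rotations \<pi>)"
    using sum_rotations_by_orbits[where P = P and F = "\<lambda>_. 1"] by simp
  also have "\<dots> = (\<Sum>\<pi>\<in>?T. num_tree_rotations \<pi>)"
    unfolding sum_distrib_left by (intro sum.cong refl num_tree_rotations_eq) simp
  also have "\<dots> = (\<Sum>\<pi>\<in>?T. \<Sum>\<rho> | \<rho> \<in> ?R \<and> refines H \<rho> \<pi>. num_rotations \<rho> * refinement_weight \<rho> \<pi>)"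
    unfolding num_tree_rotations_def by (intro sum.cong refl) (auto simp: refines_def)
  also have "\<dots> = (\<Sum>\<rho>\<in>?R. \<Sum>\<pi> | \<pi> \<in> ?T \<and> refines H \<rho> \<pi>. num_rotations \<rho> * refinement_weight \<rho> \<pi>)"
    by (rule sum.swap_restrict[OF fin])
  also have "\<dots> = (\<Sum>\<rho>\<in>?R. num_rotations \<rho> * (\<Sum>\<pi> | refines H \<rho> \<pi> \<and> P \<pi>. refinement_weight \<rho> \<pi>))"
    unfolding sum_distrib_left by (intro sum.cong refl) (auto simp: refines_def)
  also have "\<dots> = (\<Sum>\<tau> | \<tau> \<in> rotations \<and> card (orbit \<tau> ` H) = ?N.
      \<Sum>\<pi> | refines H (orbit \<tau> ` H) \<pi> \<and> P \<pi>. refinement_weight (orbit \<tau> ` H) \<pi>)"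
    by (rule sum_rotations_by_orbits[symmetric])
  finally show ?thesis .
qed

end

section \<open>Counting by underlying graph\<close>

definition block_of :: "'a set set \<Rightarrow> 'a \<Rightarrow> 'a set" where
  "block_of \<pi> x = (THE c. c \<in> \<pi> \<and> x \<in> c)"

lemma block_of_eq:
  assumes "partition_on A \<pi>" "c \<in> \<pi>" "x \<in> c"
  shows "block_of \<pi> x = c"
  unfolding block_of_def using assms partition_onD2[OF assms(1)]
  by (intro the_equality) (auto simp: disjoint_def)

text \<open>The meeting point of both sides: the underlying graph of a map and the merged graph of a
  decorated tree are both of this form, with \<open>\<pi>\<close> the resulting partition of the
  half-edges.\<close>

definition partition_graph :: "nat \<Rightarrow> (nat \<Rightarrow> nat) \<Rightarrow> nat set set \<Rightarrow> (nat set, nat set) rgraph" where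
  "partition_graph n \<alpha> \<pi> = \<lparr>rg_verts = \<pi>, rg_edges = (\<lambda>h. {h, \<alpha> h}) ` {..<2 * n},
     rg_ends = (\<lambda>e. block_of \<pi> ` e), rg_root = block_of \<pi> 0\<rparr>"

text \<open>An isomorphism class of graphs as a value of a fixed type, whatever the vertex and edge types.\<close>

definition graph_key :: "('v, 'e) rgraph \<Rightarrow> (nat set, nat set) rgraph set" where
  "graph_key G = {G'. rgraph_iso G G'}"

lemma graph_key_eqI:
  assumes "rgraph_iso G G'" "\<And>e. e \<in> rg_edges G \<Longrightarrow> rg_ends G e \<subseteq> rg_verts G" "rg_root G \<in> rg_verts G"
  shows "graph_key G = graph_key G'"
  unfolding graph_key_def
    using rgraph_iso_trans[OF assms(1)] rgraph_iso_trans[OF rgraph_iso_sym[OF assms]] by blast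

text \<open>\<open>G'\<close> has the type of the graphs collected in a key, so it is a member of
  its own key.\<close>

lemma rgraph_iso_if_graph_key_eq:
  fixes G' :: "(nat set, nat set) rgraph"
  assumes "graph_key G = graph_key G'"
  shows "rgraph_iso G G'"
  using assms rgraph_iso_refl[of G'] unfolding graph_key_def by blast

lemma underlying_graph_wf:
  assumes M: "rooted_map M"
  shows "e \<in> rg_edges (underlying_graph M) \<Longrightarrow> rg_ends (underlying_graph M) e \<subseteq> rg_verts (underlying_graph M)"
    and "rg_root (underlying_graph M) \<in> rg_verts (underlying_graph M)"
proof -
  show "rg_root (underlying_graph M) \<in> rg_verts (underlying_graph M)"
    using corner_vertex_in[OF M rooted_mapD(11)[OF M]]
    by (simp add: underlying_graph_def root_vertex_def)
  show "e \<in> rg_edges (underlying_graph M) \<Longrightarrow> rg_ends (underlying_graph M) e \<subseteq> rg_verts (underlying_graph M)"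
    using rooted_mapD(4,12)[OF M] by (auto simp: underlying_graph_def edges_def)
qed

lemma decorated_graph_wf:
  assumes M: "rooted_map M" and one: "card (faces M) = 1"
  shows "e \<in> rg_edges (decorated_graph M \<kappa>) \<Longrightarrow> rg_ends (decorated_graph M \<kappa>) e \<subseteq> rg_verts (decorated_graph M \<kappa>)"
    and "rg_root (decorated_graph M \<kappa>) \<in> rg_verts (decorated_graph M \<kappa>)"
proof -
  have d: "dfs_number M v \<in> {1..card (verts M)}" if "v \<in> verts M" for v
    using bij_betwE[OF dfs_number_bij[OF M one]] that by blast
  have "root_vertex M \<in> verts M"
    using corner_vertex_in[OF M rooted_mapD(11)[OF M]] by (simp add: root_vertex_def)
  then show "rg_root (decorated_graph M \<kappa>) \<in> rg_verts (decorated_graph M \<kappa>)"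
    using d[of "root_vertex M"]
    by (simp add: decorated_graph_def perm_cycles_def del: atLeastAtMost_iff)
  show "rg_ends (decorated_graph M \<kappa>) e \<subseteq> rg_verts (decorated_graph M \<kappa>)"
    if e: "e \<in> rg_edges (decorated_graph M \<kappa>)"
  proof -
    have "e \<subseteq> halfedges M" using e rooted_mapD(12)[OF M] by (auto simp: decorated_graph_def edges_def)
    then have "dfs_number M (vert M h) \<in> {1..card (verts M)}" if "h \<in> e" for h
      using d[OF rooted_mapD(4)[OF M]] that by blast
    then show ?thesis by (auto simp: decorated_graph_def perm_cycles_def simp del: atLeastAtMost_iff)
  qed
qed

lemma labelled_unicellular_mapsD:
  "M \<in> labelled_unicellular_maps g n \<Longrightarrow> rooted_map M" "M \<in> labelled_unicellular_maps g n \<Longrightarrow> card (faces M) = 1"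
  by (auto simp: labelled_unicellular_maps_def)

lemma unicellular_mapsD:
  assumes "C \<in> unicellular_maps g n"
  shows "C \<noteq> {}" "M \<in> C \<Longrightarrow> M \<in> labelled_unicellular_maps g n" "M \<in> C \<Longrightarrow> N \<in> C \<Longrightarrow> rmap_iso M N"
proof -
  let ?r = "{(M, N). M \<in> labelled_unicellular_maps g n \<and> N \<in> labelled_unicellular_maps g n \<and> rmap_iso M N}"
  have q: "C \<in> labelled_unicellular_maps g n // ?r" using assms by (simp add: unicellular_maps_def)
  show "C \<noteq> {}" by (rule in_quotient_imp_non_empty[OF equiv_rmap_iso q])
  show "M \<in> C \<Longrightarrow> M \<in> labelled_unicellular_maps g n" using in_quotient_imp_subset[OF equiv_rmap_iso q]
    by blast
  show "M \<in> C \<Longrightarrow> N \<in> C \<Longrightarrow> rmap_iso M N" using in_quotient_imp_in_rel[OF equiv_rmap_iso q] by blast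
qed

definition map_key :: "nmap set \<Rightarrow> (nat set, nat set) rgraph set" where
  "map_key C = graph_key (underlying_graph (SOME M. M \<in> C))"

definition decorated_key :: "nmap set \<Rightarrow> nat cperm \<Rightarrow> (nat set, nat set) rgraph set" where
  "decorated_key T \<kappa> = graph_key (decorated_graph (SOME N. N \<in> T) \<kappa>)"

text \<open>The chosen representative does not matter, since members of a class have isomorphic
  graphs.\<close>

lemma map_key_eq:
  assumes C: "C \<in> unicellular_maps g n" and M: "M \<in> C"
  shows "map_key C = graph_key (underlying_graph M)"
proof -
  have "(SOME M. M \<in> C) \<in> C" using M by (rule someI)
  note S = this
  have r: "rooted_map (SOME M. M \<in> C)"
    using labelled_unicellular_mapsD(1)[OF unicellular_mapsD(2)[OF C S]] .
  show ?thesis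
    unfolding map_key_def
    by (rule graph_key_eqI[OF rgraph_iso_underlying_graph[OF r unicellular_mapsD(3)[OF C S M]] underlying_graph_wf[OF r]])
qed

lemma decorated_key_eq:
  assumes T: "T \<in> unicellular_maps g n" and N: "N \<in> T"
  shows "decorated_key T \<kappa> = graph_key (decorated_graph N \<kappa>)"
proof -
  have "(SOME M. M \<in> T) \<in> T" using N by (rule someI)
  note S = this
  note r = labelled_unicellular_mapsD[OF unicellular_mapsD(2)[OF T S]]
  show ?thesis
    unfolding decorated_key_def
    by (rule graph_key_eqI[OF rgraph_iso_decorated_graph[OF r(1) unicellular_mapsD(3)[OF T S N]] decorated_graph_wf[OF r]])
qed

lemma partition_graph_wf:
  assumes \<pi>: "partition_on {..<2 * n} \<pi>" and n: "0 < n" and \<alpha>: "\<alpha> permutes {..<2 * n}"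
  shows "e \<in> rg_edges (partition_graph n \<alpha> \<pi>) \<Longrightarrow> rg_ends (partition_graph n \<alpha> \<pi>) e \<subseteq> rg_verts (partition_graph n \<alpha> \<pi>)"
    and "rg_root (partition_graph n \<alpha> \<pi>) \<in> rg_verts (partition_graph n \<alpha> \<pi>)"
proof -
  have b: "block_of \<pi> h \<in> \<pi>" if "h \<in> {..<2 * n}" for h
  proof -
    have "h \<in> \<Union>\<pi>" using partition_onD1[OF \<pi>] that by simp
    then obtain c where c: "c \<in> \<pi>" "h \<in> c" by blast
    show ?thesis using block_of_eq[OF \<pi> c] c(1) by simp
  qed
  show "rg_root (partition_graph n \<alpha> \<pi>) \<in> rg_verts (partition_graph n \<alpha> \<pi>)"
    using b[of 0] n by (simp add: partition_graph_def)
  show "rg_ends (partition_graph n \<alpha> \<pi>) e \<subseteq> rg_verts (partition_graph n \<alpha> \<pi>)"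
    if "e \<in> rg_edges (partition_graph n \<alpha> \<pi>)"
  proof -
    have "e \<in> (\<lambda>h. {h, \<alpha> h}) ` {..<2 * n}" using that by (simp add: partition_graph_def)
    then obtain h where h: "h \<in> {..<2 * n}" "e = {h, \<alpha> h}" by blast
    then have "\<alpha> h \<in> {..<2 * n}" using permutes_in_image[OF \<alpha>, of h] by blast
    then have "block_of \<pi> ` e \<subseteq> \<pi>" using b[OF h(1)] b[of "\<alpha> h"] h(2) by blast
    then show ?thesis by (simp add: partition_graph_def)
  qed
qed

lemma partition_graph_underlying:
  assumes n: "0 < n" and x: "(\<alpha>, \<sigma>) \<in> labelled_pairs g n"
  shows "graph_key (partition_graph n \<alpha> (orbit \<sigma> ` {..<2 * n})) = graph_key (underlying_graph (std_map n \<alpha> \<sigma>))"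
proof -
  let ?H = "{..<2 * n}" and ?\<pi> = "orbit \<sigma> ` {..<2 * n}"
  note D = labelled_pairsD[OF n x]
  interpret rooted_involution ?H \<alpha> 0 by (rule D(1))
  have \<pi>: "partition_on ?H ?\<pi>"
    by (rule partition_on_orbits[OF D(2)]) (use D(9) in auto)
  have b: "block_of ?\<pi> h = orbit \<sigma> h" if "h \<in> ?H" for h
    by (rule block_of_eq[OF \<pi>]) (use that rotationsD(4)[OF D(2)] in auto)
  have "inj_on Min ?\<pi>" using Min_orbit_eq_iff[OF D(4)] by (auto intro!: inj_onI)
  then have "bij_betw Min ?\<pi> ((\<lambda>h. Min (orbit \<sigma> h)) ` ?H)" by (simp add: bij_betw_def image_image)
  note f = this
  have ends: "(\<lambda>h. Min (orbit \<sigma> h)) ` e = Min ` block_of ?\<pi> ` e" if e: "e \<in> edges (std_map n \<alpha> \<sigma>)" for e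
    unfolding image_image
  proof (rule image_cong[OF refl])
    fix h assume "h \<in> e"
    then have "h \<in> ?H" using e D(8) by (auto simp: edges_def)
    then show "Min (orbit \<sigma> h) = Min (block_of ?\<pi> h)" using b by simp
  qed
  have "rgraph_iso (partition_graph n \<alpha> ?\<pi>) (underlying_graph (std_map n \<alpha> \<sigma>))"
    unfolding rgraph_iso_def
  proof (intro exI conjI ballI)
    show "bij_betw Min (rg_verts (partition_graph n \<alpha> ?\<pi>)) (rg_verts (underlying_graph (std_map n \<alpha> \<sigma>)))"
      using f by (simp add: partition_graph_def underlying_graph_def)
    show "bij_betw id (rg_edges (partition_graph n \<alpha> ?\<pi>)) (rg_edges (underlying_graph (std_map n \<alpha> \<sigma>)))"
      by (simp add: partition_graph_def underlying_graph_def edges_def)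
    show "rg_ends (underlying_graph (std_map n \<alpha> \<sigma>)) (id e) = Min ` rg_ends (partition_graph n \<alpha> ?\<pi>) e"
      if "e \<in> rg_edges (partition_graph n \<alpha> ?\<pi>)" for e
    proof -
      have "e \<in> edges (std_map n \<alpha> \<sigma>)" using that by (simp add: partition_graph_def edges_def)
      then have "vert (std_map n \<alpha> \<sigma>) ` e = Min ` block_of ?\<pi> ` e" using ends by simp
      then show ?thesis by (simp add: partition_graph_def underlying_graph_def)
    qed
    show "rg_root (underlying_graph (std_map n \<alpha> \<sigma>)) = Min (rg_root (partition_graph n \<alpha> ?\<pi>))"
      using b[of 0] n by (simp add: partition_graph_def underlying_graph_def root_vertex_def)
  qed
  then show ?thesis by (rule graph_key_eqI) (use partition_graph_wf[OF \<pi> n D(3)] in blast)+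
qed

text \<open>The depth-first numbering moved from vertices to half-edges. Its fibres are the cycles
  of \<open>\<tau>\<close>, so partitions of the numbers pull back to the coarsenings of the vertex
  partition of the tree.\<close>

definition corner_dfs :: "nat \<Rightarrow> (nat \<Rightarrow> nat) \<Rightarrow> (nat \<Rightarrow> nat) \<Rightarrow> nat \<Rightarrow> nat" where
  "corner_dfs n \<alpha> \<tau> h = dfs_number (std_map n \<alpha> \<tau>) (Min (orbit \<tau> h))"

lemma corner_dfs_properties:
  assumes n: "0 < n" and x: "(\<alpha>, \<tau>) \<in> labelled_pairs 0 n"
  shows "corner_dfs n \<alpha> \<tau> ` {..<2 * n} = {1..n + 1}"
    and "pull (corner_dfs n \<alpha> \<tau>) {..<2 * n} ((\<lambda>a. {a}) ` {1..n + 1}) = orbit \<tau> ` {..<2 * n}"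
    and "card (verts (std_map n \<alpha> \<tau>)) = n + 1"
proof -
  let ?H = "{..<2 * n}" and ?M = "std_map n \<alpha> \<tau>" and ?\<nu> = "corner_dfs n \<alpha> \<tau>"
  note D = labelled_pairsD[OF n x]
  note L = labelled_unicellular_mapsD[OF std_map_labelled[OF n x]]
  show cv: "card (verts ?M) = n + 1"
    using card_Min_orbit[OF D(4)] D(10) by simp
  have bij: "bij_betw (dfs_number ?M) (verts ?M) {1..n + 1}" using dfs_number_bij[OF L] unfolding cv .
  have "?\<nu> ` ?H = dfs_number ?M ` verts ?M" by (simp add: corner_dfs_def image_image)
  then show img: "?\<nu> ` ?H = {1..n + 1}" using bij by (simp add: bij_betw_def)
  have eq: "?\<nu> h = ?\<nu> h' \<longleftrightarrow> orbit \<tau> h = orbit \<tau> h'" if h: "h \<in> ?H" "h' \<in> ?H" for h h'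
  proof -
    have "?\<nu> h = ?\<nu> h' \<longleftrightarrow> Min (orbit \<tau> h) = Min (orbit \<tau> h')"
      unfolding corner_dfs_def using bij h
        by (intro inj_on_eq_iff[of _ "verts ?M"]) (auto simp: bij_betw_def)
    then show ?thesis using Min_orbit_eq_iff[OF D(4)] by simp
  qed
  interpret rooted_involution ?H \<alpha> 0 by (rule D(1))
  have fib: "?\<nu> -` {?\<nu> h} \<inter> ?H = orbit \<tau> h" if h: "h \<in> ?H" for h
  proof (intro subset_antisym subsetI)
    fix y assume "y \<in> ?\<nu> -` {?\<nu> h} \<inter> ?H"
    then have "orbit \<tau> y = orbit \<tau> h" using eq[of y h] h by simp
    then show "y \<in> orbit \<tau> h" using rotationsD(4)[OF D(2), of y] by simp
  next
    fix y assume y: "y \<in> orbit \<tau> h"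
    then have "y \<in> ?H" "orbit \<tau> y = orbit \<tau> h" using rotationsD(6)[OF D(2) h] orbit_eq[OF D(2) y]
      by auto
    then show "y \<in> ?\<nu> -` {?\<nu> h} \<inter> ?H" using eq[of y h] h by simp
  qed
  show "pull ?\<nu> ?H ((\<lambda>a. {a}) ` {1..n + 1}) = orbit \<tau> ` ?H"
    unfolding img[symmetric] pull_def image_image using fib by (intro image_cong) auto
qed

text \<open>A cycle of \<open>\<kappa>\<close> corresponds to the set of half-edges at the vertices
  that it merges; the edges are the same on both sides.\<close>

lemma partition_graph_decorated:
  assumes n: "0 < n" and x: "(\<alpha>, \<tau>) \<in> labelled_pairs 0 n" and \<kappa>: "\<kappa> \<in> cperms {1..n + 1}"
  shows "graph_key (decorated_graph (std_map n \<alpha> \<tau>) \<kappa>) =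
    graph_key (partition_graph n \<alpha> (pull (corner_dfs n \<alpha> \<tau>) {..<2 * n} (perm_cycles (fst \<kappa>) {1..n + 1})))"
proof -
  let ?H = "{..<2 * n}" and ?A = "{1..n + 1}" and ?M = "std_map n \<alpha> \<tau>" and ?\<nu> = "corner_dfs n \<alpha> \<tau>"
  let ?Q = "perm_cycles (fst \<kappa>) ?A"
  let ?\<pi> = "pull ?\<nu> ?H ?Q"
  note D = labelled_pairsD[OF n x]
  note L = labelled_unicellular_mapsD[OF std_map_labelled[OF n x]]
  note c = corner_dfs_properties[OF n x]
  have p: "fst \<kappa> permutes ?A" using \<kappa> by (auto simp: cperms_def)
  have Q: "partition_on ?A ?Q" by (rule partition_on_perm_cycles[OF _ p]) simp
  have \<pi>: "partition_on ?H ?\<pi>" by (rule pull_partition[OF c(1) Q])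
  let ?f = "\<lambda>b. ?\<nu> -` b \<inter> ?H"
  have QA: "?Q \<subseteq> Pow ?A" using Q by (auto simp: partition_on_def)
  have f: "bij_betw ?f ?Q ?\<pi>"
    unfolding bij_betw_def pull_def using inj_on_subset[OF inj_on_preimage[OF c(1)] QA] by simp
  have b: "block_of ?\<pi> h = ?f (orbit (fst \<kappa>) (?\<nu> h))" if h: "h \<in> ?H" for h
  proof (rule block_of_eq[OF \<pi>])
    have "?\<nu> h \<in> ?A" using c(1) h by blast
    then show "?f (orbit (fst \<kappa>) (?\<nu> h)) \<in> ?\<pi>" unfolding pull_def perm_cycles_def by blast
    have "?\<nu> h \<in> orbit (fst \<kappa>) (?\<nu> h)"
      using p permutation_self_in_orbit[of "fst \<kappa>"] by (auto simp: permutation_permutes)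
    then show "h \<in> ?f (orbit (fst \<kappa>) (?\<nu> h))" using h by simp
  qed
  have ends: "block_of ?\<pi> ` e = ?f ` (\<lambda>v. orbit (fst \<kappa>) (dfs_number ?M v)) ` (\<lambda>h. Min (orbit \<tau> h)) ` e"
    if e: "e \<in> edges ?M" for e
    unfolding image_image
  proof (rule image_cong[OF refl])
    fix h assume "h \<in> e"
    then have "h \<in> ?H" using e D(8) by (auto simp: edges_def)
    then show "block_of ?\<pi> h = ?f (orbit (fst \<kappa>) (dfs_number ?M (Min (orbit \<tau> h))))"
      using b by (simp add: corner_dfs_def)
  qed
  have "rgraph_iso (decorated_graph ?M \<kappa>) (partition_graph n \<alpha> ?\<pi>)"
    unfolding rgraph_iso_def
  proof (intro exI conjI ballI)
    show "bij_betw ?f (rg_verts (decorated_graph ?M \<kappa>)) (rg_verts (partition_graph n \<alpha> ?\<pi>))"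
      using f c(3) by (simp add: decorated_graph_def partition_graph_def del: std_map_simps)
    show "bij_betw id (rg_edges (decorated_graph ?M \<kappa>)) (rg_edges (partition_graph n \<alpha> ?\<pi>))"
      by (simp add: decorated_graph_def partition_graph_def edges_def)
    show "rg_ends (partition_graph n \<alpha> ?\<pi>) (id e) = ?f ` rg_ends (decorated_graph ?M \<kappa>) e"
      if "e \<in> rg_edges (decorated_graph ?M \<kappa>)" for e
      using ends[of e] that by (simp add: decorated_graph_def partition_graph_def)
    show "rg_root (partition_graph n \<alpha> ?\<pi>) = ?f (rg_root (decorated_graph ?M \<kappa>))"
      using b[of 0] n
      by (simp add: decorated_graph_def partition_graph_def root_vertex_def corner_dfs_def)
  qed
  then show ?thesis by (rule graph_key_eqI) (use decorated_graph_wf[OF L] in blast)+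
qed

lemma labelled_pairs_Sigma:
  "labelled_pairs g n = Sigma (matchings n)
     (\<lambda>\<alpha>. {\<sigma> \<in> rooted_matching.rotations {..<2 * n} \<alpha>. card (orbit \<sigma> ` {..<2 * n}) + 2 * g = n + 1})"
  by (auto simp: labelled_pairs_def)

lemma finite_matchings: "finite (matchings n)"
  by (rule finite_subset[OF _ finite_permutations[of "{..<2 * n}"]]) (auto simp: matchings_def)

lemma map_class_mem:
  assumes n: "0 < n" and x: "(\<alpha>, \<sigma>) \<in> labelled_pairs g n"
  shows "std_map n \<alpha> \<sigma> \<in> map_class g n (\<alpha>, \<sigma>)" "map_class g n (\<alpha>, \<sigma>) \<in> unicellular_maps g n"
proof -
  show "std_map n \<alpha> \<sigma> \<in> map_class g n (\<alpha>, \<sigma>)"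
    using std_map_labelled[OF n x] rmap_iso_refl[of "std_map n \<alpha> \<sigma>"] by (simp add: map_class_def)
  show "map_class g n (\<alpha>, \<sigma>) \<in> unicellular_maps g n"
    unfolding sum_labelled_pairs(1)[OF n, symmetric] using x by (rule imageI)
qed

text \<open>Multiplied by \<open>fact (2 * n - 1)\<close>, both sides become sums over labelled
  pairs. These are sorted by their matching, and for a fixed matching the identity is
  \<open>weighted_count\<close>.\<close>

lemma count_by_graph:
  assumes n: "0 < n"
  shows "2 ^ (n + 1) * card {C \<in> unicellular_maps g n. map_key C = K} =
    (\<Sum>T\<in>plane_trees n. card {\<kappa> \<in> cperms {1..n + 1}. cperm_genus {1..n + 1} \<kappa> = g \<and> decorated_key T \<kappa> = K})"
proof -
  let ?H = "{..<2 * n}" and ?A = "{1..n + 1}"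
  let ?c = "\<lambda>T. card {\<kappa> \<in> cperms ?A. cperm_genus ?A \<kappa> = g \<and> decorated_key T \<kappa> = K}"
  \<comment> \<open>Genus and graph expressed as one condition on the partition of the half-edges,
    the same for maps and for decorated trees.\<close>
  let ?P = "\<lambda>\<alpha> \<pi>. card \<pi> + 2 * g = n + 1 \<and> graph_key (partition_graph n \<alpha> \<pi>) = K"
  let ?rot = "\<lambda>\<alpha>. rooted_matching.rotations ?H \<alpha>"
  have finR: "finite (?rot \<alpha>)" if \<alpha>: "\<alpha> \<in> matchings n" for \<alpha>
  proof -
    interpret rooted_involution ?H \<alpha> 0 by (rule matchings_involution[OF n \<alpha>])
    show ?thesis by (rule finite_rotations)
  qed
  have finU: "finite (unicellular_maps g n)" unfolding sum_labelled_pairs(1)[OF n, symmetric]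
    using finite_labelled_pairs by simp
  have "fact (2 * n - 1) * card {C \<in> unicellular_maps g n. map_key C = K} =
      fact (2 * n - 1) * (\<Sum>C\<in>unicellular_maps g n. if map_key C = K then 1 else 0)"
    using finU by (simp add: sum.If_cases Int_def)
  also have "\<dots> = (\<Sum>x\<in>labelled_pairs g n. if map_key (map_class g n x) = K then 1 else 0)"
    by (rule sum_labelled_pairs(2)[OF n, symmetric])
  also have "\<dots> = (\<Sum>(\<alpha>, \<sigma>)\<in>labelled_pairs g n. if graph_key (partition_graph n \<alpha> (orbit \<sigma> ` ?H)) = K then 1 else 0)"
  proof (rule sum.cong[OF refl])
    fix x assume x: "x \<in> labelled_pairs g n"
    obtain \<alpha> \<sigma> where xe: "x = (\<alpha>, \<sigma>)" by fastforce
    have "map_key (map_class g n (\<alpha>, \<sigma>)) = graph_key (partition_graph n \<alpha> (orbit \<sigma> ` ?H))"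
      using map_key_eq[OF map_class_mem(2,1)[OF n]] partition_graph_underlying[OF n] x xe by simp
    then show "(if map_key (map_class g n x) = K then 1 else 0) =
        (case x of (\<alpha>, \<sigma>) \<Rightarrow>
          if graph_key (partition_graph n \<alpha> (orbit \<sigma> ` ?H)) = K then 1 else 0)" by (simp add: xe)
  qed
  also have "\<dots> = (\<Sum>\<alpha>\<in>matchings n. card {\<sigma> \<in> ?rot \<alpha>. ?P \<alpha> (orbit \<sigma> ` ?H)})"
    unfolding labelled_pairs_Sigma
    using finite_matchings finR
    by (subst sum.Sigma[symmetric]) (auto simp: sum.If_cases Int_def conj_ac intro!: sum.cong arg_cong[where f = card])
  finally have L: "fact (2 * n - 1) * card {C \<in> unicellular_maps g n. map_key C = K} =
      (\<Sum>\<alpha>\<in>matchings n. card {\<sigma> \<in> ?rot \<alpha>. ?P \<alpha> (orbit \<sigma> ` ?H)})" .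
  \<comment> \<open>For a fixed tree the C-permutations are grouped by their cycles, and these are
    pulled back to the half-edges.\<close>
  have tree: "?c (map_class 0 n (\<alpha>, \<tau>)) =
      (\<Sum>\<pi> | refines ?H (orbit \<tau> ` ?H) \<pi> \<and> ?P \<alpha> \<pi>. refinement_weight (orbit \<tau> ` ?H) \<pi>)"
    if x: "(\<alpha>, \<tau>) \<in> labelled_pairs 0 n" for \<alpha> \<tau>
  proof -
    let ?\<nu> = "corner_dfs n \<alpha> \<tau>"
    note c = corner_dfs_properties[OF n x]
    have key: "decorated_key (map_class 0 n (\<alpha>, \<tau>)) \<kappa> =
        graph_key (partition_graph n \<alpha> (pull ?\<nu> ?H (perm_cycles (fst \<kappa>) ?A)))" if "\<kappa> \<in> cperms ?A" for \<kappa>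
      using decorated_key_eq[OF map_class_mem(2,1)[OF n x]] partition_graph_decorated[OF n x that]
      by simp
    have "?c (map_class 0 n (\<alpha>, \<tau>)) = card {\<kappa> \<in> cperms ?A. cperm_genus ?A \<kappa> = g \<and>
        graph_key (partition_graph n \<alpha> (pull ?\<nu> ?H (perm_cycles (fst \<kappa>) ?A))) = K}"
      using key by (intro arg_cong[where f = card]) auto
    also have "\<dots> = (\<Sum>Q | partition_on ?A Q \<and> card Q + 2 * g = card ?A \<and>
        graph_key (partition_graph n \<alpha> (pull ?\<nu> ?H Q)) = K. partition_weight Q)"
      by (rule card_cperms_genus) simp
    also have "\<dots> = (\<Sum>Q | partition_on ?A Q \<and> ?P \<alpha> (pull ?\<nu> ?H Q). refinement_weight (orbit \<tau> ` ?H) (pull ?\<nu> ?H Q))"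
      using card_pull[OF c(1)] refinement_weight_pull[OF c(1)] c(2) by (intro sum.cong) auto
    also have "\<dots> = (\<Sum>\<pi> | refines ?H (orbit \<tau> ` ?H) \<pi> \<and> ?P \<alpha> \<pi>. refinement_weight (orbit \<tau> ` ?H) \<pi>)"
    proof (rule sum.reindex_bij_betw)
      have b: "bij_betw (pull ?\<nu> ?H) {Q. partition_on ?A Q} {\<pi>. refines ?H (orbit \<tau> ` ?H) \<pi>}"
        using pull_bij[OF c(1)] c(2) by simp
      have "pull ?\<nu> ?H ` {Q. partition_on ?A Q \<and> ?P \<alpha> (pull ?\<nu> ?H Q)} = {\<pi>. refines ?H (orbit \<tau> ` ?H) \<pi> \<and> ?P \<alpha> \<pi>}"
      proof -
        have "pull ?\<nu> ?H ` {Q. partition_on ?A Q \<and> ?P \<alpha> (pull ?\<nu> ?H Q)} = {\<pi> \<in> pull ?\<nu> ?H ` {Q. partition_on ?A Q}. ?P \<alpha> \<pi>}"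
          by blast
        then show ?thesis using b by (simp add: bij_betw_def)
      qed
      moreover have "inj_on (pull ?\<nu> ?H) {Q. partition_on ?A Q \<and> ?P \<alpha> (pull ?\<nu> ?H Q)}"
        by (rule inj_on_subset[OF bij_betw_imp_inj_on[OF b]]) blast
      ultimately show "bij_betw (pull ?\<nu> ?H) {Q. partition_on ?A Q \<and> ?P \<alpha> (pull ?\<nu> ?H Q)}
          {\<pi>. refines ?H (orbit \<tau> ` ?H) \<pi> \<and> ?P \<alpha> \<pi>}" by (simp add: bij_betw_def)
    qed
    finally show ?thesis .
  qed
  have "fact (2 * n - 1) * (\<Sum>T\<in>plane_trees n. ?c T) = (\<Sum>x\<in>labelled_pairs 0 n. ?c (map_class 0 n x))"
    by (rule sum_labelled_pairs(2)[OF n, symmetric])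
  also have "\<dots> = (\<Sum>(\<alpha>, \<tau>)\<in>labelled_pairs 0 n.
      \<Sum>\<pi> | refines ?H (orbit \<tau> ` ?H) \<pi> \<and> ?P \<alpha> \<pi>. refinement_weight (orbit \<tau> ` ?H) \<pi>)"
  proof (rule sum.cong[OF refl])
    fix x assume x: "x \<in> labelled_pairs 0 n"
    obtain \<alpha> \<tau> where xe: "x = (\<alpha>, \<tau>)" by fastforce
    show "?c (map_class 0 n x) = (case x of (\<alpha>, \<tau>) \<Rightarrow>
        \<Sum>\<pi> | refines ?H (orbit \<tau> ` ?H) \<pi> \<and> ?P \<alpha> \<pi>. refinement_weight (orbit \<tau> ` ?H) \<pi>)"
      unfolding xe prod.case by (rule tree[OF x[unfolded xe]])
  qed
  also have "\<dots> = (\<Sum>\<alpha>\<in>matchings n. \<Sum>\<tau> | \<tau> \<in> ?rot \<alpha> \<and> card (orbit \<tau> ` ?H) + 2 * 0 = n + 1.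
      \<Sum>\<pi> | refines ?H (orbit \<tau> ` ?H) \<pi> \<and> ?P \<alpha> \<pi>. refinement_weight (orbit \<tau> ` ?H) \<pi>)"
    unfolding labelled_pairs_Sigma using finite_matchings finR by (subst sum.Sigma[symmetric]) auto
  also have "\<dots> = (\<Sum>\<alpha>\<in>matchings n. 2 ^ (n + 1) * card {\<sigma> \<in> ?rot \<alpha>. ?P \<alpha> (orbit \<sigma> ` ?H)})"
  proof (rule sum.cong[OF refl])
    fix \<alpha> assume \<alpha>: "\<alpha> \<in> matchings n"
    interpret rooted_involution ?H \<alpha> 0 by (rule matchings_involution[OF n \<alpha>])
    show "(\<Sum>\<tau> | \<tau> \<in> ?rot \<alpha> \<and> card (orbit \<tau> ` ?H) + 2 * 0 = n + 1.
        \<Sum>\<pi> | refines ?H (orbit \<tau> ` ?H) \<pi> \<and> ?P \<alpha> \<pi>. refinement_weight (orbit \<tau> ` ?H) \<pi>) =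
        2 ^ (n + 1) * card {\<sigma> \<in> ?rot \<alpha>. ?P \<alpha> (orbit \<sigma> ` ?H)}"
      using weighted_count[of "?P \<alpha>"] by simp
  qed
  also have "\<dots> = 2 ^ (n + 1) * (fact (2 * n - 1) * card {C \<in> unicellular_maps g n. map_key C = K})"
    unfolding L sum_distrib_left ..
  finally have "fact (2 * n - 1) * (\<Sum>T\<in>plane_trees n. ?c T) =
      fact (2 * n - 1) * (2 ^ (n + 1) * card {C \<in> unicellular_maps g n. map_key C = K})"
    by (simp only: mult.left_commute)
  then show ?thesis by (simp del: power_Suc)
qed

text \<open>One bijection is chosen for each key between the two fibres over it, and these are
  united; the fibres over different keys are disjoint.\<close>

lemma bij_betw_respecting_keys:
  assumes X: "finite X" and Y: "finite Y"
    and eq: "\<And>K. card {x \<in> X. f x = K} = card {y \<in> Y. h y = K}"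
  shows "\<exists>\<Phi>. bij_betw \<Phi> X Y \<and> (\<forall>x\<in>X. h (\<Phi> x) = f x)"
proof -
  have "\<exists>\<phi>. bij_betw \<phi> {x \<in> X. f x = K} {y \<in> Y. h y = K}" for K
    using finite_same_card_bij[of "{x \<in> X. f x = K}" "{y \<in> Y. h y = K}"] X Y eq[of K] by simp
  then obtain \<phi> where \<phi>: "\<And>K. bij_betw (\<phi> K) {x \<in> X. f x = K} {y \<in> Y. h y = K}" by metis
  define \<Phi> where "\<Phi> x = \<phi> (f x) x" for x
  have in_Y: "\<Phi> x \<in> Y \<and> h (\<Phi> x) = f x" if "x \<in> X" for x
    using bij_betwE[OF \<phi>[of "f x"]] that by (simp add: \<Phi>_def)
  have inj: "inj_on \<Phi> X"
  proof (rule inj_onI)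
    fix x y assume x: "x \<in> X" and y: "y \<in> X" and e: "\<Phi> x = \<Phi> y"
    then have fe: "f x = f y" using in_Y by metis
    then have "\<phi> (f x) x = \<phi> (f x) y" using e by (simp add: \<Phi>_def)
    then show "x = y" using bij_betw_imp_inj_on[OF \<phi>[of "f x"]] x y fe by (simp add: inj_on_def)
  qed
  have "Y \<subseteq> \<Phi> ` X"
  proof
    fix y assume "y \<in> Y"
    then have "y \<in> \<phi> (h y) ` {x \<in> X. f x = h y}" using \<phi>[of "h y"] by (simp add: bij_betw_def)
    then obtain x where "x \<in> X" "f x = h y" "y = \<phi> (h y) x" by blast
    then show "y \<in> \<Phi> ` X" by (intro image_eqI[of _ _ x]) (simp_all add: \<Phi>_def)
  qed
  then have "\<Phi> ` X = Y" using in_Y by blast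
  then show ?thesis using inj in_Y by (auto simp: bij_betw_def)
qed

section \<open>Maps without edges, where there is no root half-edge\<close>

lemma edgeless_unicellular_map:
  assumes M: "M \<in> labelled_unicellular_maps g 0"
  shows "halfedges M = {}" "g = 0" "verts M = {root_vertex M}" "root M = Around (root_vertex M)"
proof -
  have rm: "rooted_map M" and ce: "card (edges M) = 0" and one: "card (faces M) = 1"
    and hg: "has_genus M g"
    using M by (auto simp: labelled_unicellular_maps_def)
  note D = rooted_mapD[OF rm]
  show h: "halfedges M = {}" using ce D(3) by (simp add: edges_def)
  then obtain v where v: "root M = Around v" "v \<in> verts M" using D(11) by (auto simp: corners_def)
  then have rv: "root_vertex M = v" by (simp add: root_vertex_def)
  have "u = v" if "u \<in> verts M" for u using D(10)[OF that v(2)] h by simp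
  then have vs: "verts M = {v}" using v(2) by blast
  then show "verts M = {root_vertex M}" "root M = Around (root_vertex M)" using v rv by auto
  show "g = 0" using hg ce one vs unfolding has_genus_def by simp
qed

lemma unicellular_maps_0_0: "unicellular_maps 0 0 = {labelled_unicellular_maps 0 0}"
proof -
  let ?X = "labelled_unicellular_maps 0 0"
  define M :: nmap where "M = \<lparr>verts = {0}, halfedges = {}, vert = id, opp = id, rot = id, root = Around 0\<rparr>"
  have cor: "corners M = {Around 0}" by (simp add: M_def corners_def)
  have "orbit (next_corner M) (Around 0) = {Around 0}" by (simp add: orbit_eq_singleton_iff)
  then have "faces M = {{Around 0}}" unfolding faces_def cor by simp
  moreover have "rooted_map M" unfolding rooted_map_def cor by (simp add: M_def)
  ultimately have MX: "M \<in> ?X"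
    by (simp add: labelled_unicellular_maps_def has_genus_def edges_def) (simp add: M_def)
  have iso: "rmap_iso N P" if N: "N \<in> ?X" and P: "P \<in> ?X" for N P :: nmap
  proof -
    note n = edgeless_unicellular_map[OF N] and p = edgeless_unicellular_map[OF P]
    show ?thesis
      unfolding rmap_iso_def
    proof (intro exI conjI)
      show "bij_betw (\<lambda>_. root_vertex P) (verts N) (verts P)" unfolding n(3) p(3)
        by (simp add: bij_betw_def)
      show "bij_betw id (halfedges N) (halfedges P)" unfolding n(1) p(1) by simp
      show "\<forall>h\<in>halfedges N. vert P (id h) = root_vertex P \<and> opp P (id h) = id (opp N h) \<and> rot P (id h) = id (rot N h)"
        unfolding n(1) by simp
      show "root P = map_corner (\<lambda>_. root_vertex P) id (root N)" by (subst n(4), subst p(4)) simp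
    qed
  qed
  have "{(M, N). M \<in> ?X \<and> N \<in> ?X \<and> rmap_iso M N} `` {N} = ?X" if "N \<in> ?X" for N
    using iso that by blast
  then show ?thesis unfolding unicellular_maps_def quotient_def using MX by auto
qed

lemma decorated_graph_edgeless:
  assumes N: "N \<in> labelled_unicellular_maps g 0"
  shows "rg_edges (decorated_graph N \<kappa>) = {}" "rg_verts (decorated_graph N \<kappa>) = {rg_root (decorated_graph N \<kappa>)}"
proof -
  note p = edgeless_unicellular_map[OF N]
  show "rg_edges (decorated_graph N \<kappa>) = {}" by (simp add: decorated_graph_def edges_def p(1))
  have "rg_verts (decorated_graph N \<kappa>) = {orbit (fst \<kappa>) 1}"
    by (simp add: decorated_graph_def perm_cycles_def) (subst p(3), simp)
  then show "rg_verts (decorated_graph N \<kappa>) = {rg_root (decorated_graph N \<kappa>)}"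
    using decorated_graph_wf(2)[OF labelled_unicellular_mapsD[OF N], of \<kappa>] by simp
qed

text \<open>Both graphs consist of the root vertex alone.\<close>

lemma map_key_edgeless:
  assumes C: "C \<in> unicellular_maps 0 0"
  shows "map_key C = decorated_key C \<kappa>"
proof -
  obtain M where M: "M \<in> C" using unicellular_mapsD(1)[OF C] by blast
  have L: "M \<in> labelled_unicellular_maps 0 0" by (rule unicellular_mapsD(2)[OF C M])
  note p = edgeless_unicellular_map[OF L] and d = decorated_graph_edgeless[OF L, of \<kappa>]
  have u: "rg_verts (underlying_graph M) = {root_vertex M}" "rg_edges (underlying_graph M) = {}"
    using p(1,3) by (simp_all add: underlying_graph_def edges_def)
  have "rgraph_iso (underlying_graph M) (decorated_graph M \<kappa>)"
    unfolding rgraph_iso_def d u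
  proof (intro exI conjI)
    show "bij_betw (\<lambda>_. rg_root (decorated_graph M \<kappa>)) {root_vertex M} {rg_root (decorated_graph M \<kappa>)}"
      by (simp add: bij_betw_def)
    show "bij_betw id {} {}" by (simp add: bij_betw_def)
    show "\<forall>e\<in>{}. rg_ends (decorated_graph M \<kappa>) (id e) = (\<lambda>_. rg_root (decorated_graph M \<kappa>)) ` rg_ends (underlying_graph M) e"
      by simp
  qed simp
  then have "graph_key (underlying_graph M) = graph_key (decorated_graph M \<kappa>)"
    by (rule graph_key_eqI) (use underlying_graph_wf[OF labelled_unicellular_mapsD(1)[OF L]] in blast)+
  then show ?thesis using map_key_eq[OF C M] decorated_key_eq[OF C M] by simp
qed

text \<open>The two elements are the identity with either sign on its fixed point.\<close>

lemma card_cperms_edgeless: "card {\<kappa> \<in> cperms {1 :: nat}. cperm_genus {1} \<kappa> = 0} = 2"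
proof -
  have *: "partition_on {1 :: nat} Q \<longleftrightarrow> Q = {{1}}" for Q
  proof
    assume Q: "partition_on {1 :: nat} Q"
    have "b = {1}" if "b \<in> Q" for b
    proof -
      have "b \<subseteq> {1}" "b \<noteq> {}" using that Q by (auto simp: partition_on_def)
      then show ?thesis by blast
    qed
    moreover have "Q \<noteq> {}" using partition_onD1[OF Q] by auto
    ultimately show "Q = {{1}}" by blast
  next
    assume "Q = {{1}}"
    then show "partition_on {1 :: nat} Q" using partition_on_space[of "{1 :: nat}"] by simp
  qed
  have "Q \<in> {Q. partition_on {1 :: nat} Q \<and> card Q + 2 * 0 = card {1 :: nat} \<and> True} \<longleftrightarrow> Q \<in> {{{1}}}"
    for Q
    unfolding mem_Collect_eq * by auto
  then have "{Q. partition_on {1 :: nat} Q \<and> card Q + 2 * 0 = card {1 :: nat} \<and> True} = {{{1}}}"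
    by (rule set_eqI)
  then have "card {\<kappa> \<in> cperms {1 :: nat}. cperm_genus {1} \<kappa> = 0 \<and> True} = partition_weight {{1 :: nat}}"
    using card_cperms_genus[of "{1 :: nat}" 0 "\<lambda>_. True"] by (simp only: sum.insert finite.intros) simp
  then show ?thesis by (simp add: partition_weight_def block_weight_def)
qed

lemma count_by_graph_edgeless:
  "2 ^ (0 + 1) * card {C \<in> unicellular_maps g 0. map_key C = K} =
    (\<Sum>T\<in>plane_trees 0. card {\<kappa> \<in> cperms {1..0 + 1}. cperm_genus {1..0 + 1} \<kappa> = g \<and> decorated_key T \<kappa> = K})"
proof -
  have "2 ^ (0 + 1) * card {C \<in> unicellular_maps g 0. map_key C = K} =
    (\<Sum>T\<in>plane_trees 0. card {\<kappa> \<in> cperms {1}. cperm_genus {1} \<kappa> = g \<and> decorated_key T \<kappa> = K})"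
  proof (cases "g = 0")
    case True
    let ?C = "labelled_unicellular_maps 0 0"
    have C: "?C \<in> unicellular_maps 0 0" by (simp add: unicellular_maps_0_0)
    show ?thesis
    proof (cases "map_key ?C = K")
      case k: True
      have "{C \<in> unicellular_maps 0 0. map_key C = K} = {?C}" using k
        by (auto simp: unicellular_maps_0_0)
      then show ?thesis
        using card_cperms_edgeless map_key_edgeless[OF C] k True by (simp add: unicellular_maps_0_0)
    next
      case k: False
      have "{C \<in> unicellular_maps 0 0. map_key C = K} = {}" using k by (auto simp: unicellular_maps_0_0)
      then show ?thesis
        using map_key_edgeless[OF C] k True by (simp add: unicellular_maps_0_0)
    qed
  next
    case False
    have e: "unicellular_maps g 0 = {}"
    proof (rule equals0I)
      fix C assume C: "C \<in> unicellular_maps g 0"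
      then obtain M where "M \<in> C" using unicellular_mapsD(1) by blast
      then show False using edgeless_unicellular_map(2)[OF unicellular_mapsD(2)[OF C]] False by blast
    qed
    have "cperm_genus {1} \<kappa> \<noteq> g" for \<kappa> :: "nat cperm"
      using False by (simp add: cperm_genus_def)
    then show ?thesis using e by simp
  qed
  moreover have "{1..0 + 1} = {1 :: nat}" by auto
  ultimately show ?thesis by (simp only:)
qed

lemma finite_unicellular_maps: "finite (unicellular_maps g n)"
proof (cases "n = 0")
  case True
  show ?thesis
  proof (cases "g = 0")
    case g: True
    then show ?thesis using True by (simp add: unicellular_maps_0_0)
  next
    case False
    have "labelled_unicellular_maps g 0 = {}" using edgeless_unicellular_map(2) False by blast
    then show ?thesis using True by (simp add: unicellular_maps_def)
  qed
next
  case False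
  then show ?thesis using sum_labelled_pairs(1)[of n g] finite_labelled_pairs[of g n]
    by (metis finite_imageI neq0_conv)
qed

theorem theorem2p6:
  fixes n g :: nat
  shows "(\<exists>\<Phi> :: nat \<times> nmap set \<Rightarrow> nmap set \<times> nat cperm.
            bij_betw \<Phi> ({1..2 ^ (n + 1)} \<times> unicellular_maps g n) (decorated_trees g n) \<and>
            (\<forall>i \<in> {1..2 ^ (n + 1)}. \<forall>C \<in> unicellular_maps g n. \<forall>T \<sigma>. \<Phi> (i, C) = (T, \<sigma>) \<longrightarrow>
               (\<forall>M \<in> C. \<forall>N \<in> T. rgraph_iso (underlying_graph M) (decorated_graph N \<sigma>)))) \<and>
         finite (unicellular_maps g n) \<and> finite (decorated_trees g n) \<and>
         2 ^ (n + 1) * card (unicellular_maps g n) = card (decorated_trees g n)"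
proof -
  let ?X = "{1..2 ^ (n + 1) :: nat} \<times> unicellular_maps g n" and ?A = "{1..n + 1}"
  have finX: "finite ?X" using finite_unicellular_maps by simp
  have dec: "decorated_trees g n = Sigma (plane_trees n) (\<lambda>_. {\<kappa> \<in> cperms ?A. cperm_genus ?A \<kappa> = g})"
    by (auto simp: decorated_trees_def)
  have finY: "finite (decorated_trees g n)"
    unfolding dec using finite_unicellular_maps finite_cperms[of ?A] by (intro finite_SigmaI) auto
  \<comment> \<open>The index \<open>i\<close> supplies the factor \<open>2 ^ (n + 1)\<close>, so
    the fibres over a key \<open>K\<close> have equal size by the count for a prescribed
    graph.\<close>
  have cards: "card {x \<in> ?X. (\<lambda>(i, C). map_key C) x = K} = card {y \<in> decorated_trees g n. (\<lambda>(T, \<kappa>). decorated_key T \<kappa>) y = K}" for K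
  proof -
    have "{x \<in> ?X. (\<lambda>(i, C). map_key C) x = K} = {1..2 ^ (n + 1)} \<times> {C \<in> unicellular_maps g n. map_key C = K}"
      by auto
    then have "card {x \<in> ?X. (\<lambda>(i, C). map_key C) x = K} = 2 ^ (n + 1) * card {C \<in> unicellular_maps g n. map_key C = K}"
      by (simp add: card_cartesian_product)
    also have "\<dots> = (\<Sum>T\<in>plane_trees n. card {\<kappa> \<in> cperms ?A. cperm_genus ?A \<kappa> = g \<and> decorated_key T \<kappa> = K})"
    proof (cases "n = 0")
      case True
      show ?thesis unfolding True by (rule count_by_graph_edgeless)
    next
      case False
      then show ?thesis by (intro count_by_graph) simp
    qed
    also have "\<dots> = card (Sigma (plane_trees n) (\<lambda>T. {\<kappa> \<in> cperms ?A. cperm_genus ?A \<kappa> = g \<and> decorated_key T \<kappa> = K}))"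
      using finite_unicellular_maps finite_cperms[of ?A] by (intro card_SigmaI[symmetric]) auto
    also have "Sigma (plane_trees n) (\<lambda>T. {\<kappa> \<in> cperms ?A. cperm_genus ?A \<kappa> = g \<and> decorated_key T \<kappa> = K}) =
        {y \<in> decorated_trees g n. (\<lambda>(T, \<kappa>). decorated_key T \<kappa>) y = K}"
      unfolding dec by auto
    finally show ?thesis .
  qed
  obtain \<Phi> where \<Phi>: "bij_betw \<Phi> ?X (decorated_trees g n)"
    and key: "\<forall>x\<in>?X. (\<lambda>(T, \<kappa>). decorated_key T \<kappa>) (\<Phi> x) = (\<lambda>(i, C). map_key C) x"
    using bij_betw_respecting_keys[OF finX finY cards] by (elim exE conjE) (rule that)
  have "rgraph_iso (underlying_graph M) (decorated_graph N \<sigma>)"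
    if i: "i \<in> {1..2 ^ (n + 1)}" and C: "C \<in> unicellular_maps g n" and e: "\<Phi> (i, C) = (T, \<sigma>)"
    and M: "M \<in> C" and N: "N \<in> T"
    for i C T \<sigma> M N
  proof -
    have x: "(i, C) \<in> ?X" using i C by simp
    have "\<Phi> (i, C) \<in> decorated_trees g n" using bij_betwE[OF \<Phi>] x by blast
    then have "T \<in> plane_trees n" unfolding dec e by simp
    \<comment> \<open>Keys are independent of representatives, so the equality holds for the given
      \<open>M\<close> and \<open>N\<close>.\<close>
    then have "graph_key (underlying_graph M) = graph_key (decorated_graph N \<sigma>)"
      using bspec[OF key x] e map_key_eq[OF C M] decorated_key_eq[OF _ N] by simp
    then show ?thesis by (rule rgraph_iso_if_graph_key_eq)
  qed
  moreover have "2 ^ (n + 1) * card (unicellular_maps g n) = card (decorated_trees g n)"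
    using bij_betw_same_card[OF \<Phi>] by (simp add: card_cartesian_product)
  ultimately show ?thesis
    using \<Phi> finite_unicellular_maps finY by (intro conjI exI[of _ \<Phi>]) blast+
qed

end
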